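(* Let $p$ and $q$ be monic polynomials with degree $2$ of $\mathbb{F}[t]$ such that $p(0)q(0)\neq 0$. Assume that $p$ is irreducible over $\mathbb{F}$ and that $q$ splits over $\mathbb{F}$ with distinct roots $y_1$ and $y_2$. Assume furthermore that $(\operatorname{tr}p,\operatorname{tr}q)\neq(0,0)$. Let $u$ be an endomorphism of a finite-dimensional vector space $V$ over $\mathbb{F}$. The following conditions are then equivalent: (i) $u$ is a q-exceptional $(p,q)$-quotient. (ii) The irreducible monic divisors of the minimal polynomial of $u$ belong to $\bigl\{H_{y_1}(p),H_{y_2}(p)\bigr\}$. Moreover, in writing the invariant factors of $u$ as $r_1=H_{y_1}(p)^{\alpha_1}H_{y_2}(p)^{\beta_1},\dots,r_k=H_{y_1}(p)^{\alpha_k}H_{y_2}(p)^{\beta_k},\dots$, we have $|\alpha_k-\beta_k|\leq 1$ for all $k\geq 1$. (iii) In some basis of $V$, the endomorphism $u$ is represented by a block-diagonal matrix in which every diagonal block equals $C\bigl(H_{y_1}(p)^n\bigr)\oplus C\bigl(H_{y_2}(p)^n\bigr)$, $C\bigl(H_{y_1}(p)^n\bigr)\oplus C\bigl(H_{y_2}(p)^{n-1}\bigr)$ or $C\bigl(H_{y_1}(p)^{n-1}\bigr)\oplus C\bigl(H_{y_2}(p)^n\bigr)$ for some positive integer $n$.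
   Context: $\mathbb{F}$ is an arbitrary field with algebraic closure $\overline{\mathbb{F}}$. For a monic polynomial $p$ of degree $n\ge 1$, $\operatorname{tr}(p)$ is the opposite of the coefficient of $p$ on $t^{n-1}$, and $\operatorname{Root}(p)$ is its set of roots in $\overline{\mathbb{F}}$. For $p$ monic of degree $2$ and $d\in\mathbb{F}\setminus\{0\}$, $H_d(p):=d^{-2}p(dt)$. An endomorphism $u$ of $V$ is a $(p,q)$-quotient if $u=ab^{-1}$ for some automorphisms $a,b$ of $V$ with $p(a)=0$ and $q(b)=0$. It is q-exceptional with respect to $(p,q)$ if all its eigenvalues in $\overline{\mathbb{F}}$ belong to $\operatorname{Root}(p)\operatorname{Root}(q)^{-1}=\{xy^{-1}: x\in\operatorname{Root}(p),\,y\in\operatorname{Root}(q)\}$; a q-exceptional $(p,q)$-quotient is a $(p,q)$-quotient that is q-exceptional with respect to $(p,q)$. $C(r)$ is the companion matrix of the monic polynomial $r$ ($C(1)$ is the $0\times0$ matrix), and $\oplus$ is block-diagonal sum. The invariant factors of $u$ are the monic polynomials $r_1,r_2,\dots$ with $r_{i+1}\mid r_i$ such that $u$ is represented in some basis by $C(r_1)\oplus C(r_2)\oplus\cdots$; the finite list of nonconstant ones is extended to an infinite sequence by $r_i=1$. *)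

theory Defs
  imports
    "Jordan_Normal_Form.Char_Poly"
    "HOL-Algebra.Algebraic_Closure_Type"
begin

text \<open>The trace of a monic polynomial of positive degree, its roots in the algebraic closure,
  and \<open>H d p = d\<^sup>-\<^sup>2 p(d t)\<close>, meant for \<open>p\<close> monic of degree 2 and \<open>d \<noteq> 0\<close>.\<close>

definition poly_tr :: "'a::field poly \<Rightarrow> 'a" where
  "poly_tr p = - Polynomial.coeff p (Polynomial.degree p - 1)"

definition Root :: "'a::field poly \<Rightarrow> 'a alg_closure set" where
  "Root p = {x. poly (map_poly to_ac p) x = 0}"

definition H :: "'a::field \<Rightarrow> 'a poly \<Rightarrow> 'a poly" where
  "H d p = Polynomial.smult (inverse (d ^ 2)) (pcompose p [:0, d:])"

text \<open>The companion matrix has ones on the subdiagonal and the negated coefficients in the last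
  column; for \<open>r = 1\<close> it is the 0-by-0 matrix.\<close>

definition companion_mat :: "'a::field poly \<Rightarrow> 'a mat" where
  "companion_mat r = mat (Polynomial.degree r) (Polynomial.degree r)
     (\<lambda>(i, j). if j = Polynomial.degree r - 1 then - Polynomial.coeff r i
       else if i = Suc j then 1 else 0)"

text \<open>Below, \<open>scale\<close> is the scalar multiplication of a vector space over \<open>'a\<close> whose set of vectors
  is the whole type \<open>'b\<close>.\<close>

definition endo_poly ::
    "('a::field \<Rightarrow> 'b::ab_group_add \<Rightarrow> 'b) \<Rightarrow> 'a poly \<Rightarrow> ('b \<Rightarrow> 'b) \<Rightarrow> 'b \<Rightarrow> 'b" where
  "endo_poly scale f u x =
     (\<Sum>i\<le>Polynomial.degree f. scale (Polynomial.coeff f i) ((u ^^ i) x))"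

definition annihilates ::
    "('a::field \<Rightarrow> 'b::ab_group_add \<Rightarrow> 'b) \<Rightarrow> 'a poly \<Rightarrow> ('b \<Rightarrow> 'b) \<Rightarrow> bool" where
  "annihilates scale f u \<longleftrightarrow> (\<forall>x. endo_poly scale f u x = 0)"

definition min_poly ::
    "('a::field \<Rightarrow> 'b::ab_group_add \<Rightarrow> 'b) \<Rightarrow> ('b \<Rightarrow> 'b) \<Rightarrow> 'a poly" where
  "min_poly scale u = (THE m. Polynomial.lead_coeff m = 1 \<and> annihilates scale m u \<and>
     (\<forall>f. annihilates scale f u \<longrightarrow> m dvd f))"

definition automorphism ::
    "('a::field \<Rightarrow> 'b::ab_group_add \<Rightarrow> 'b) \<Rightarrow> ('b \<Rightarrow> 'b) \<Rightarrow> bool" where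
  "automorphism scale a \<longleftrightarrow> Vector_Spaces.linear scale scale a \<and> bij a"

definition pq_quotient ::
    "('a::field \<Rightarrow> 'b::ab_group_add \<Rightarrow> 'b) \<Rightarrow> 'a poly \<Rightarrow> 'a poly \<Rightarrow> ('b \<Rightarrow> 'b) \<Rightarrow> bool" where
  "pq_quotient scale p q u \<longleftrightarrow> (\<exists>a b. automorphism scale a \<and> automorphism scale b \<and>
     annihilates scale p a \<and> annihilates scale q b \<and> u = a \<circ> inv_into UNIV b)"

definition ordered_basis ::
    "('a::field \<Rightarrow> 'b::ab_group_add \<Rightarrow> 'b) \<Rightarrow> 'b list \<Rightarrow> bool" where
  "ordered_basis scale bs \<longleftrightarrow> distinct bs \<and>
     \<not> Modules.module.dependent scale (set bs) \<and> Modules.module.span scale (set bs) = UNIV"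

text \<open>Column \<open>j\<close> of \<open>A\<close> holds the coordinates of the image of the \<open>j\<close>-th basis vector.\<close>

definition represented_by ::
    "('a::field \<Rightarrow> 'b::ab_group_add \<Rightarrow> 'b) \<Rightarrow> ('b \<Rightarrow> 'b) \<Rightarrow> 'b list \<Rightarrow> 'a mat \<Rightarrow> bool" where
  "represented_by scale u bs A \<longleftrightarrow>
     ordered_basis scale bs \<and> A \<in> carrier_mat (length bs) (length bs) \<and>
     (\<forall>j<length bs. u (bs ! j) = (\<Sum>i<length bs. scale (A $$ (i, j)) (bs ! i)))"

text \<open>Eigenvalues in the algebraic closure are those of a representing matrix, viewed over the
  closure; the choice of the basis is immaterial.\<close>

definition closure_eigenvalue ::
    "('a::field \<Rightarrow> 'b::ab_group_add \<Rightarrow> 'b) \<Rightarrow> ('b \<Rightarrow> 'b) \<Rightarrow> 'a alg_closure \<Rightarrow> bool" where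
  "closure_eigenvalue scale u l \<longleftrightarrow>
     (\<exists>bs A. represented_by scale u bs A \<and> eigenvalue (map_mat to_ac A) l)"

definition q_exceptional ::
    "('a::field \<Rightarrow> 'b::ab_group_add \<Rightarrow> 'b) \<Rightarrow> 'a poly \<Rightarrow> 'a poly \<Rightarrow> ('b \<Rightarrow> 'b) \<Rightarrow> bool" where
  "q_exceptional scale p q u \<longleftrightarrow> (\<forall>l. closure_eigenvalue scale u l \<longrightarrow>
     l \<in> {x * inverse y | x y. x \<in> Root p \<and> y \<in> Root q})"

text \<open>The sequence of invariant factors, indexed from 0 and eventually equal to 1. Trailing
  constant factors contribute empty blocks, so the choice of \<open>N\<close> does not matter.\<close>

definition invariant_factors ::
    "('a::field \<Rightarrow> 'b::ab_group_add \<Rightarrow> 'b) \<Rightarrow> ('b \<Rightarrow> 'b) \<Rightarrow> (nat \<Rightarrow> 'a poly) \<Rightarrow> bool" where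
  "invariant_factors scale u r \<longleftrightarrow>
     (\<forall>k. Polynomial.lead_coeff (r k) = 1) \<and> (\<forall>k. r (Suc k) dvd r k) \<and>
     (\<exists>N bs. (\<forall>k\<ge>N. r k = 1) \<and>
        represented_by scale u bs (diag_block_mat (map (\<lambda>k. companion_mat (r k)) [0..<N])))"

end

theory Submission
  imports Defs
begin

text \<open>Let \<open>u = a b\<^sup>-\<^sup>1\<close> be a \<open>(p, q)\<close>-quotient, \<open>c = p(0) / q(0)\<close> and \<open>u* = c u\<^sup>-\<^sup>1\<close>. The operator
  \<open>s = u b - b u\<close> satisfies \<open>s u = u* s\<close>, and \<open>s\<^sup>2\<close> equals \<open>H\<^sub>1(u) H\<^sub>2(u)\<close> up to the factor \<open>q(0) u\<^sup>-\<^sup>2\<close>,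
  where \<open>H\<^sub>i\<close> is \<open>H y\<^sub>i p\<close>. As the roots of \<open>H\<^sub>1\<close> and \<open>H\<^sub>2\<close> are exchanged by \<open>x \<mapsto> c / x\<close>, \<open>s\<close> exchanges the
  \<open>H\<^sub>1\<close>- and the \<open>H\<^sub>2\<close>-primary part of the space, and it is nilpotent if \<open>u\<close> is exceptional.
  Under \<open>u\<close> and \<open>s\<close> together the space is then a direct sum of uniserial pieces, each generated by
  a single vector \<open>x\<close> of one of the two primary parts: as an \<open>F[u]\<close>-module such a piece is the sum of
  the cyclic modules of \<open>x\<close> and \<open>s x\<close>, whose exponents differ by at most 1. Conversely, on a sum of
  two cyclic modules with such exponents an \<open>s\<close> with these properties can be written down, and since
  \<open>u - u*\<close> is invertible (here \<open>(tr p, tr q) \<noteq> (0, 0)\<close> enters), \<open>b\<close> and \<open>a = u b\<close> are recovered from it.\<close>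

subsection \<open>Polynomials over a field\<close>

text \<open>Conjugation does not in general act on the ring \<open>F[u]\<close>: on a nonzero space
  killed by \<open>H\<^sub>1\<close> it would have to send the zero operator to an invertible one, a
  unit times \<open>H\<^sub>2(u)\<close>. It is therefore performed on polynomials, by substituting
  a polynomial that represents \<open>c u\<^sup>-\<^sup>1\<close> modulo a power of
  \<open>H\<^sub>1 H\<^sub>2\<close>, and polynomials are compared through their action on the
  space. The pieces are uniserial for the following reason. Both \<open>H\<^sub>i\<close> are
  irreducible, because \<open>p\<close> is, and they are distinct. So \<open>H\<^sub>2\<close> is
  invertible on the \<open>H\<^sub>1\<close>-part, where \<open>s\<^sup>2\<close> is then
  \<open>H\<^sub>1\<close> up to a unit, and likewise with the indices exchanged. Thus
  \<open>s\<close> behaves like a uniformizer: a nonzero multiple of a vector of one primary part is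
  a power of \<open>s\<close> applied to a unit multiple of that vector. One application of
  \<open>s\<close> counts for half a factor \<open>H\<^sub>i\<close>, which is the origin of the
  bound 1. All three conditions are compared with one normal form, \<open>split_form\<close>. It
  pairs the exponents piece by piece, whereas (ii) pairs them by rank; the bound survives the
  sorting.\<close>

lemma poly_ideal_principal:
  fixes I :: "'a::field poly set"
  assumes "0 \<in> I" and "\<And>f g. f \<in> I \<Longrightarrow> g \<in> I \<Longrightarrow> f + g \<in> I" and "\<And>f g. f \<in> I \<Longrightarrow> g * f \<in> I"
  obtains g where "\<And>f. f \<in> I \<longleftrightarrow> g dvd f"
proof (cases "I = {0}")
  case True
  then show ?thesis using that[of 0] by simp
next
  case False
  with assms(1) have "\<exists>g. g \<in> I \<and> g \<noteq> 0" by blast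
  then obtain g where g: "g \<in> I" "g \<noteq> 0"
    and min: "\<And>f. f \<in> I \<Longrightarrow> f \<noteq> 0 \<Longrightarrow> Polynomial.degree g \<le> Polynomial.degree f"
    using ex_has_least_nat[of "\<lambda>g. g \<in> I \<and> g \<noteq> 0" _ Polynomial.degree] by blast
  have "g dvd f" if "f \<in> I" for f
  proof -
    have "f mod g = f + (- (f div g)) * g"
      by (simp add: minus_div_mult_eq_mod[symmetric])
    then have "f mod g \<in> I" using assms g that by metis
    then have "f mod g = 0" using min[of "f mod g"] degree_mod_less'[OF g(2), of f] by force
    then show ?thesis by (simp add: dvd_eq_mod_eq_0)
  qed
  moreover have "f \<in> I" if "g dvd f" for f
    using that assms(3)[OF g(1)] by (metis dvd_div_mult_self)
  ultimately have "f \<in> I \<longleftrightarrow> g dvd f" for f by metis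
  then show ?thesis by (rule that)
qed

lemma poly_bezout:
  fixes f g :: "'a::field poly"
  assumes "coprime f g"
  obtains a b where "a * f + b * g = 1"
proof -
  let ?I = "{a * f + b * g | a b. True}"
  have "0 \<in> ?I" using mult_zero_left[of f] mult_zero_left[of g] by (metis (mono_tags, lifting) add_0 mem_Collect_eq)
  moreover have "x + y \<in> ?I" if xy: "x \<in> ?I" "y \<in> ?I" for x y
  proof -
    from xy obtain a b a' b' where "x = a * f + b * g" "y = a' * f + b' * g" by blast
    then have "x + y = (a + a') * f + (b + b') * g" by (simp add: algebra_simps)
    then show ?thesis by blast
  qed
  moreover have "y * x \<in> ?I" if "x \<in> ?I" for x y
  proof -
    from that obtain a b where "x = a * f + b * g" by blast
    then have "y * x = (y * a) * f + (y * b) * g" by (simp add: algebra_simps)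
    then show ?thesis by blast
  qed
  ultimately obtain d where d: "\<And>x. x \<in> ?I \<longleftrightarrow> d dvd x" using poly_ideal_principal[of ?I] by blast
  have "f \<in> ?I" "g \<in> ?I"
    by (force intro: exI[of _ 1] exI[of _ 0])+
  with d have "d dvd f" "d dvd g" by auto
  with assms have "d dvd 1" using coprime_common_divisor by blast
  with d[of 1] obtain a b where "1 = a * f + b * g" by blast
  then show ?thesis using that by metis
qed

lemma irreducible_coprime:
  fixes d f :: "'a::field poly"
  assumes "Factorial_Ring.irreducible d" "\<not> d dvd f"
  shows "coprime d f"
proof (rule coprimeI)
  fix e assume e: "e dvd d" "e dvd f"
  then obtain k where k: "d = e * k" by (blast elim: Rings.dvdE)
  with assms(1) have "e dvd 1 \<or> k dvd 1" by (auto dest: Factorial_Ring.irreducibleD)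
  moreover have "\<not> k dvd 1"
  proof
    assume "k dvd 1"
    then have "d dvd e" using k by (metis dvd_mult_unit_iff dvd_refl mult.commute)
    with e assms show False using dvd_trans by blast
  qed
  ultimately show "e dvd 1" by blast
qed

lemma poly_coprime_dvd_mult:
  fixes s t f :: "'a::field poly"
  assumes "coprime s t" "s dvd f * t"
  shows "s dvd f"
proof -
  obtain a b where "a * s + b * t = 1" using poly_bezout[OF assms(1)] .
  then have "f = f * (a * s + b * t)" by simp
  then have "f = (f * a) * s + b * (f * t)" by (simp add: algebra_simps)
  moreover have "s dvd (f * a) * s + b * (f * t)"
    by (rule dvd_add[OF dvd_triv_right dvd_mult[OF assms(2)]])
  ultimately show ?thesis by simp
qed

lemma poly_coprime_mult_dvd:
  fixes s t f :: "'a::field poly"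
  assumes "coprime s t" "s dvd f" "t dvd f"
  shows "s * t dvd f"
proof -
  from assms(2) obtain k where k: "f = s * k" by (blast elim: Rings.dvdE)
  have "t dvd k * s" using assms(3) by (simp add: k mult.commute)
  with assms(1) have "t dvd k" using poly_coprime_dvd_mult coprime_commute by metis
  then show ?thesis unfolding k by (intro mult_dvd_mono) simp_all
qed

lemma poly_coprime_mult_right:
  fixes f g h :: "'a::field poly"
  assumes "coprime f g" "coprime f h"
  shows "coprime f (g * h)"
proof (rule coprimeI)
  fix e assume e: "e dvd f" "e dvd g * h"
  have "coprime e h" using coprime_divisors[OF e(1) dvd_refl assms(2)] .
  then have "e dvd g" by (rule poly_coprime_dvd_mult[OF _ e(2)])
  with e(1) show "e dvd 1" by (rule coprime_common_divisor[OF assms(1)])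
qed

lemma poly_coprime_power_right:
  fixes f g :: "'a::field poly"
  shows "coprime f g \<Longrightarrow> coprime f (g ^ n)"
  by (induction n) (simp_all add: poly_coprime_mult_right)

lemma monic_dvd_antisym:
  fixes d e :: "'a::field poly"
  assumes "d dvd e" "e dvd d" "Polynomial.lead_coeff d = 1" "Polynomial.lead_coeff e = 1"
  shows "d = e"
proof -
  from assms(1) obtain k where k: "e = d * k" by (blast elim: Rings.dvdE)
  have "d \<noteq> 0" "e \<noteq> 0" using assms by auto
  with k assms have "Polynomial.degree e \<le> Polynomial.degree d" by (simp add: dvd_imp_degree_le)
  with k \<open>e \<noteq> 0\<close> have "Polynomial.degree k = 0" by (cases "k = 0") (auto simp: degree_mult_eq \<open>d \<noteq> 0\<close>)
  then obtain c where "k = [:c:]" by (auto elim: degree_eq_zeroE)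
  moreover have "Polynomial.lead_coeff k = 1" using assms(3,4) unfolding k by (simp add: lead_coeff_mult)
  ultimately have "k = 1" by (simp add: one_pCons)
  with k show ?thesis by simp
qed

lemma monic_irreducible_dvd:
  fixes d e :: "'a::field poly"
  assumes "Polynomial.lead_coeff d = 1" "Factorial_Ring.irreducible d"
    and "Polynomial.lead_coeff e = 1" "Factorial_Ring.irreducible e" "d dvd e"
  shows "d = e"
proof -
  from assms(5) obtain k where k: "e = d * k" by (blast elim: Rings.dvdE)
  have "\<not> d dvd 1" using assms(2) by (rule Factorial_Ring.irreducible_not_unit)
  with k assms(4) have "k dvd 1" by (auto dest: Factorial_Ring.irreducibleD)
  then have "e dvd d" using k by (metis dvd_mult_unit_iff dvd_refl mult.commute)
  with assms show ?thesis by (intro monic_dvd_antisym)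
qed

text \<open>A nonconstant divisor of least degree is irreducible; it is then made monic.\<close>

lemma irreducible_dvd_cases:
  fixes f :: "'a::field poly"
  assumes "Polynomial.degree f > 0"
  obtains d where "Factorial_Ring.irreducible d" "Polynomial.lead_coeff d = 1" "d dvd f"
proof -
  have f0: "f \<noteq> 0" using assms by auto
  have "\<exists>d. d dvd f \<and> Polynomial.degree d > 0"
    using assms by (intro exI[of _ f]) simp
  then obtain d where d: "d dvd f" "Polynomial.degree d > 0"
    and min: "\<And>e. e dvd f \<Longrightarrow> Polynomial.degree e > 0 \<Longrightarrow> Polynomial.degree d \<le> Polynomial.degree e"
    using ex_has_least_nat[of "\<lambda>d. d dvd f \<and> Polynomial.degree d > 0" _ Polynomial.degree] by metis
  have d0: "d \<noteq> 0" using d by auto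
  have irr: "Factorial_Ring.irreducible d"
  proof (rule Factorial_Ring.irreducibleI)
    show "d \<noteq> 0" by fact
    show "\<not> d dvd 1" using d by (simp add: poly_dvd_1)
    fix a b assume ab: "d = a * b"
    then have ne: "a \<noteq> 0" "b \<noteq> 0" using d0 by auto
    with ab have deg: "Polynomial.degree d = Polynomial.degree a + Polynomial.degree b" by (simp add: degree_mult_eq)
    have "a dvd f" "b dvd f" using d(1) unfolding ab by (rule dvd_mult_left, rule dvd_mult_right)
    with min[of a] min[of b] deg d(2) have "Polynomial.degree a = 0 \<or> Polynomial.degree b = 0" by linarith
    then show "a dvd 1 \<or> b dvd 1" using ne by (auto simp: is_unit_iff_degree)
  qed
  let ?e = "Polynomial.smult (inverse (Polynomial.lead_coeff d)) d"
  have c: "inverse (Polynomial.lead_coeff d) \<noteq> 0" using d0 by simp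
  have "?e = [:inverse (Polynomial.lead_coeff d):] * d" by simp
  moreover have "[:inverse (Polynomial.lead_coeff d):] dvd 1" using c by (simp add: is_unit_iff_degree)
  ultimately have "Factorial_Ring.irreducible ?e" using irr by (metis irreducible_mult_unit_left)
  moreover have "Polynomial.lead_coeff ?e = 1" using d0 by simp
  moreover have "?e dvd f" using c d(1) by (simp add: smult_dvd_iff)
  ultimately show ?thesis by (rule that)
qed

text \<open>Coefficients are indexed by \<open>J\<close>, so repeated vectors \<open>e j\<close>
  need no separate treatment. It serves over the field, for bases, and over the polynomial ring, for
  \<open>u\<close>-stable spans.\<close>

lemma (in Modules.module) span_image_finite:
  assumes "finite J"
  shows "span (e ` J) = {\<Sum>j\<in>J. c j *s e j | c. True}" (is "_ = ?S")
proof
  show "?S \<subseteq> span (e ` J)" by (auto intro!: span_sum intro: span_scale span_base)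
  have "subspace ?S"
  proof (rule subspaceI)
    show "0 \<in> ?S" by (auto intro!: exI[of _ "\<lambda>_. 0"])
    fix v w assume "v \<in> ?S" "w \<in> ?S"
    then obtain c d where "v = (\<Sum>j\<in>J. c j *s e j)" "w = (\<Sum>j\<in>J. d j *s e j)" by blast
    then show "v + w \<in> ?S" by (auto intro!: exI[of _ "\<lambda>j. c j + d j"] simp: scale_left_distrib sum.distrib)
  next
    fix k v assume "v \<in> ?S"
    then obtain c where "v = (\<Sum>j\<in>J. c j *s e j)" by blast
    then show "k *s v \<in> ?S" by (auto intro!: exI[of _ "\<lambda>j. k * c j"] simp: scale_sum_right)
  qed
  moreover have "e ` J \<subseteq> ?S"
  proof
    fix v assume "v \<in> e ` J"
    then obtain j where j: "j \<in> J" "v = e j" by blast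
    have "v = (\<Sum>k\<in>J. (if k = j then 1 else 0) *s e k)"
      using j assms by (simp add: if_distrib[of "\<lambda>z. z *s _"] cong: if_cong)
    then show "v \<in> ?S"
      unfolding mem_Collect_eq by (intro exI[of _ "\<lambda>k. if k = j then 1 else 0"]) simp
  qed
  ultimately show "span (e ` J) \<subseteq> ?S" by (rule span_minimal[rotated])
qed

subsection \<open>The module of an endomorphism\<close>

locale endo = finite_dimensional_vector_space scale Basis
  for scale :: "'a::field \<Rightarrow> 'b::ab_group_add \<Rightarrow> 'b" (infixr "*s" 75) and Basis :: "'b set" +
  fixes u :: "'b \<Rightarrow> 'b"
  assumes lin: "Vector_Spaces.linear scale scale u"
begin

abbreviation act :: "'a poly \<Rightarrow> 'b \<Rightarrow> 'b" (infixr "\<star>" 75)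
  where "f \<star> x \<equiv> endo_poly scale f u x"

lemma u_add: "u (x + y) = u x + u y" and u_scale: "u (c *s x) = c *s u x" and u_0: "u 0 = 0"
  and u_sum: "u (sum g I) = (\<Sum>i\<in>I. u (g i))"
proof -
  interpret Vector_Spaces.linear scale scale u by (rule lin)
  show "u (x + y) = u x + u y" "u (c *s x) = c *s u x" "u 0 = 0" "u (sum g I) = (\<Sum>i\<in>I. u (g i))"
    by (fact add scale zero sum)+
qed

lemma act_altdef:
  assumes "Polynomial.degree f \<le> n"
  shows "f \<star> x = (\<Sum>i\<le>n. Polynomial.coeff f i *s (u ^^ i) x)"
  unfolding endo_poly_def
  by (rule sum.mono_neutral_left) (use assms in \<open>auto simp: coeff_eq_0\<close>)

lemma act_add_left: "(f + g) \<star> x = f \<star> x + g \<star> x"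
proof -
  define n where "n = max (Polynomial.degree f) (Polynomial.degree g)"
  have "Polynomial.degree f \<le> n" "Polynomial.degree g \<le> n" "Polynomial.degree (f + g) \<le> n"
    by (auto simp: n_def degree_add_le_max)
  then show ?thesis by (simp add: act_altdef[where n = n] scale_left_distrib sum.distrib)
qed

lemma act_smult: "Polynomial.smult c f \<star> x = c *s f \<star> x"
  by (subst act_altdef[of _ "Polynomial.degree f"]) 
    (auto simp: endo_poly_def scale_sum_right degree_smult_le)

lemma act_0: "0 \<star> x = 0"
  by (simp add: endo_poly_def)

lemma act_pCons: "pCons a f \<star> x = a *s x + u (f \<star> x)"
proof -
  have "pCons a f \<star> x = (\<Sum>i\<le>Suc (Polynomial.degree f). Polynomial.coeff (pCons a f) i *s (u ^^ i) x)"
    by (rule act_altdef) (simp add: degree_pCons_le)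
  also have "\<dots> = a *s x + (\<Sum>i\<le>Polynomial.degree f. Polynomial.coeff f i *s u ((u ^^ i) x))"
    by (subst sum.atMost_Suc_shift) simp
  also have "\<dots> = a *s x + u (f \<star> x)"
    by (simp add: endo_poly_def u_sum u_scale)
  finally show ?thesis .
qed

lemma act_u: "f \<star> u x = u (f \<star> x)"
  by (induction f) (auto simp: act_0 act_pCons u_add u_scale u_0)

lemma act_add_right: "f \<star> (x + y) = f \<star> x + f \<star> y"
  by (induction f) (auto simp: act_0 act_pCons u_add scale_right_distrib algebra_simps)

lemma act_scale: "f \<star> (c *s x) = c *s f \<star> x"
proof (induction f)
  case (pCons a f)
  then show ?case by (simp add: act_pCons u_scale scale_right_distrib mult.commute)
qed (simp add: act_0)

lemma act_zero_right: "f \<star> 0 = 0"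
  using act_scale[of f 0 0] by simp

lemma act_mult: "(f * g) \<star> x = f \<star> (g \<star> x)"
proof (induction f)
  case (pCons a f)
  then show ?case by (simp add: act_pCons act_add_left act_smult)
qed (simp add: act_0)

lemma act_const: "[:a:] \<star> x = a *s x"
  by (simp add: act_pCons act_0 u_0)

lemma act_1: "1 \<star> x = x"
  using act_const[of 1 x] by (simp add: one_pCons)

lemma act_X: "[:0, 1:] \<star> x = u x"
  by (simp add: act_pCons act_0 u_0)

sublocale P: Modules.module "\<lambda>f. endo_poly scale f u"
  by unfold_locales (simp_all add: act_add_left act_add_right act_mult act_1)

text \<open>This rule is \<open>act_mult\<close> read from right to left; together the two would
  rewrite forever.\<close>

declare P.scale_scale [simp del]

end

subsection \<open>Cyclic decompositions and block matrices\<close>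

context endo
begin

text \<open>The space is the internal direct sum of the cyclic modules generated by the
  \<open>x i\<close>, with annihilators generated by the \<open>r i\<close>: the single equivalence
  encodes both facts. Trivial summands, with \<open>r i = 1\<close> and \<open>x i = 0\<close>, are
  allowed, so that families can be padded.\<close>

definition decomp :: "'i set \<Rightarrow> ('i \<Rightarrow> 'b) \<Rightarrow> ('i \<Rightarrow> 'a poly) \<Rightarrow> bool" where
  "decomp I x r \<longleftrightarrow> finite I \<and> (\<forall>v. \<exists>f. v = (\<Sum>i\<in>I. f i \<star> x i)) \<and>
     (\<forall>f. (\<Sum>i\<in>I. f i \<star> x i) = 0 \<longleftrightarrow> (\<forall>i\<in>I. r i dvd f i))"

lemma decompI:
  assumes "finite I" "\<And>v. \<exists>f. v = (\<Sum>i\<in>I. f i \<star> x i)"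
    and "\<And>f i. (\<Sum>i\<in>I. f i \<star> x i) = 0 \<Longrightarrow> i \<in> I \<Longrightarrow> r i dvd f i"
    and "\<And>i. i \<in> I \<Longrightarrow> r i \<star> x i = 0"
  shows "decomp I x r"
  unfolding decomp_def
proof (intro conjI allI iffI ballI)
  fix f assume f: "\<forall>i\<in>I. r i dvd f i"
  show "(\<Sum>i\<in>I. f i \<star> x i) = 0"
  proof (rule sum.neutral, rule ballI)
    fix i assume i: "i \<in> I"
    with f obtain k where "f i = k * r i" by (metis dvd_div_mult_self)
    with assms(4)[OF i] show "f i \<star> x i = 0" by (simp add: act_mult act_zero_right)
  qed
qed (use assms in auto)

lemma decomp_gen: "decomp I x r \<Longrightarrow> \<exists>f. v = (\<Sum>i\<in>I. f i \<star> x i)"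
  and decomp_indep: "decomp I x r \<Longrightarrow> (\<Sum>i\<in>I. f i \<star> x i) = 0 \<longleftrightarrow> (\<forall>i\<in>I. r i dvd f i)"
  and decomp_dvd: "decomp I x r \<Longrightarrow> (\<Sum>i\<in>I. f i \<star> x i) = 0 \<Longrightarrow> i \<in> I \<Longrightarrow> r i dvd f i"
  and decomp_finite: "decomp I x r \<Longrightarrow> finite I"
  unfolding decomp_def by blast+

lemma decomp_ann:
  assumes "decomp I x r" "i \<in> I"
  shows "f \<star> x i = 0 \<longleftrightarrow> r i dvd f"
proof -
  have "(\<Sum>j\<in>I. (if j = i then f else 0) \<star> x j) = (\<Sum>j\<in>I. if j = i then f \<star> x j else 0)"
    by (rule sum.cong) (auto simp: act_0)
  also have "\<dots> = f \<star> x i" using decomp_finite[OF assms(1)] assms(2) by simp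
  finally have "f \<star> x i = 0 \<longleftrightarrow> (\<forall>j\<in>I. r j dvd (if j = i then f else 0))"
    using decomp_indep[OF assms(1), of "\<lambda>j. if j = i then f else 0"] by simp
  then show ?thesis using assms(2) by auto
qed

lemma decomp_reindex:
  assumes d: "decomp I x r" and b: "bij_betw \<phi> J I"
  shows "decomp J (x \<circ> \<phi>) (r \<circ> \<phi>)"
proof (rule decompI)
  show "finite J" using b decomp_finite[OF d] by (simp add: bij_betw_finite)
  show "\<exists>f. v = (\<Sum>j\<in>J. f j \<star> (x \<circ> \<phi>) j)" for v
  proof -
    obtain f where "v = (\<Sum>i\<in>I. f i \<star> x i)" using decomp_gen[OF d] by blast
    also have "\<dots> = (\<Sum>j\<in>J. f (\<phi> j) \<star> x (\<phi> j))" by (rule sum.reindex_bij_betw[OF b, symmetric])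
    finally show ?thesis by (intro exI[of _ "f \<circ> \<phi>"]) simp
  qed
  show "(r \<circ> \<phi>) j dvd f j" if f: "(\<Sum>j\<in>J. f j \<star> (x \<circ> \<phi>) j) = 0" and j: "j \<in> J" for f j
  proof -
    let ?g = "\<lambda>i. f (the_inv_into J \<phi> i)"
    have inv: "the_inv_into J \<phi> (\<phi> j) = j" if "j \<in> J" for j
      using b that by (simp add: bij_betw_def the_inv_into_f_f)
    have "(\<Sum>i\<in>I. ?g i \<star> x i) = (\<Sum>j\<in>J. ?g (\<phi> j) \<star> x (\<phi> j))"
      by (rule sum.reindex_bij_betw[OF b, symmetric])
    also have "\<dots> = 0" using f inv by (simp cong: sum.cong)
    finally have "r (\<phi> j) dvd ?g (\<phi> j)" by (rule decomp_dvd[OF d]) (use b j in \<open>auto simp: bij_betw_def\<close>)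
    then show ?thesis using inv[OF j] by simp
  qed
  show "(r \<circ> \<phi>) j \<star> (x \<circ> \<phi>) j = 0" if "j \<in> J" for j
    using decomp_ann[OF d, of "\<phi> j"] b that by (auto simp: bij_betw_def)
qed

lemma decomp_cong:
  assumes "decomp I x r" "\<And>i. i \<in> I \<Longrightarrow> x i = x' i" "\<And>i. i \<in> I \<Longrightarrow> r i = r' i"
  shows "decomp I x' r'"
  using assms unfolding decomp_def by (simp cong: sum.cong)

lemma decomp_remove_trivial:
  assumes d: "decomp I x r" and "J \<subseteq> I" and r: "\<And>i. i \<in> I - J \<Longrightarrow> r i = 1"
  shows "decomp J x r"
proof (rule decompI)
  note fin = decomp_finite[OF d]
  show "finite J" using fin \<open>J \<subseteq> I\<close> finite_subset by blast
  have x: "x i = 0" if "i \<in> I - J" for i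
    using decomp_ann[OF d, of i 1] r[OF that] that by (simp add: act_1)
  have sum: "(\<Sum>i\<in>I. f i \<star> x i) = (\<Sum>i\<in>J. f i \<star> x i)" for f
    by (rule sum.mono_neutral_right) (use fin \<open>J \<subseteq> I\<close> x in \<open>auto simp: act_zero_right\<close>)
  show "\<exists>f. v = (\<Sum>i\<in>J. f i \<star> x i)" for v
    using decomp_gen[OF d, of v] unfolding sum .
  show "r i dvd f i" if "(\<Sum>i\<in>J. f i \<star> x i) = 0" "i \<in> J" for f i
    using decomp_dvd[OF d, of f i] that \<open>J \<subseteq> I\<close> unfolding sum by auto
  show "r i \<star> x i = 0" if "i \<in> J" for i
    using decomp_ann[OF d, of i "r i"] that \<open>J \<subseteq> I\<close> by auto
qed

text \<open>Chinese remaindering on each summand: \<open>t i \<star> x i\<close> has annihilator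
  \<open>s i\<close>, \<open>s i \<star> x i\<close> has annihilator \<open>t i\<close>, and a
  Bezout relation recovers \<open>x i\<close> from the two.\<close>

lemma decomp_split:
  assumes d: "decomp I x (\<lambda>i. s i * t i)" and cop: "\<And>i. i \<in> I \<Longrightarrow> coprime (s i) (t i)"
  shows "decomp (I <+> I) (case_sum (\<lambda>i. t i \<star> x i) (\<lambda>i. s i \<star> x i)) (case_sum s t)"
proof (rule decompI)
  note fin = decomp_finite[OF d]
  have sum: "(\<Sum>i\<in>I <+> I. f i \<star> case_sum (\<lambda>i. t i \<star> x i) (\<lambda>i. s i \<star> x i) i) =
      (\<Sum>i\<in>I. (f (Inl i) * t i + f (Inr i) * s i) \<star> x i)" for f
    using fin by (simp add: sum.Plus act_add_left act_mult sum.distrib)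
  show "finite (I <+> I)" using fin by simp
  show "\<exists>f. v = (\<Sum>i\<in>I <+> I. f i \<star> case_sum (\<lambda>i. t i \<star> x i) (\<lambda>i. s i \<star> x i) i)" for v
  proof -
    obtain f where f: "v = (\<Sum>i\<in>I. f i \<star> x i)" using decomp_gen[OF d] by blast
    have "\<forall>i\<in>I. \<exists>a b. a * s i + b * t i = 1" using cop poly_bezout by metis
    then obtain a b where ab: "\<And>i. i \<in> I \<Longrightarrow> a i * s i + b i * t i = 1" by metis
    have "f i = (f i * b i) * t i + (f i * a i) * s i" if "i \<in> I" for i
      using arg_cong[OF ab[OF that], of "\<lambda>z. f i * z"] by (simp add: algebra_simps)
    then have "v = (\<Sum>i\<in>I. ((f i * b i) * t i + (f i * a i) * s i) \<star> x i)"
      unfolding f by (intro sum.cong) auto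
    then show ?thesis unfolding sum
      by (intro exI[of _ "case_sum (\<lambda>i. f i * b i) (\<lambda>i. f i * a i)"]) simp
  qed
  show "case_sum s t j dvd f j"
    if f: "(\<Sum>i\<in>I <+> I. f i \<star> case_sum (\<lambda>i. t i \<star> x i) (\<lambda>i. s i \<star> x i) i) = 0" and j: "j \<in> I <+> I" for f j
  proof -
    have *: "s i * t i dvd f (Inl i) * t i + f (Inr i) * s i" if "i \<in> I" for i
      using f that unfolding sum by (rule decomp_dvd[OF d])
    have "s i dvd f (Inl i)" "t i dvd f (Inr i)" if "i \<in> I" for i
    proof -
      have "s i dvd f (Inl i) * t i + f (Inr i) * s i" using *[OF that] by (rule dvd_mult_left)
      then have "s i dvd f (Inl i) * t i" using dvd_add_left_iff[of "s i" "f (Inr i) * s i"] by simp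
      then show "s i dvd f (Inl i)" by (rule poly_coprime_dvd_mult[OF cop[OF that]])
      have "t i dvd f (Inl i) * t i + f (Inr i) * s i" using *[OF that] by (rule dvd_mult_right)
      then have "t i dvd f (Inr i) * s i" using dvd_add_right_iff[of "t i" "f (Inl i) * t i"] by simp
      then show "t i dvd f (Inr i)"
        using poly_coprime_dvd_mult cop[OF that] coprime_commute by metis
    qed
    with j show ?thesis by auto
  qed
  show "case_sum s t j \<star> case_sum (\<lambda>i. t i \<star> x i) (\<lambda>i. s i \<star> x i) j = 0" if "j \<in> I <+> I" for j
    using that decomp_ann[OF d] by (auto simp: act_mult[symmetric] mult.commute)
qed

lemma decomp_merge:
  assumes d: "decomp (I <+> I) (case_sum x y) (case_sum s t)"
    and cop: "\<And>i. i \<in> I \<Longrightarrow> coprime (s i) (t i)"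
  shows "decomp I (\<lambda>i. x i + y i) (\<lambda>i. s i * t i)"
proof (rule decompI)
  have fin: "finite I" using decomp_finite[OF d] by (simp add: finite_Plus_iff)
  have ann: "s i \<star> x i = 0" "t i \<star> y i = 0" if "i \<in> I" for i
    using decomp_ann[OF d, of "Inl i" "s i"] decomp_ann[OF d, of "Inr i" "t i"] that by auto
  show "finite I" by fact
  show "\<exists>f. v = (\<Sum>i\<in>I. f i \<star> (x i + y i))" for v
  proof -
    obtain f where "v = (\<Sum>i\<in>I <+> I. f i \<star> case_sum x y i)" using decomp_gen[OF d] by blast
    then have f: "v = (\<Sum>i\<in>I. f (Inl i) \<star> x i + f (Inr i) \<star> y i)"
      using fin by (simp add: sum.Plus sum.distrib)
    have "\<forall>i\<in>I. \<exists>a b. a * s i + b * t i = 1" using cop poly_bezout by metis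
    then obtain a b where ab: "\<And>i. i \<in> I \<Longrightarrow> a i * s i + b i * t i = 1" by metis
    \<comment> \<open>By the Bezout relation, \<open>b i * t i\<close> fixes \<open>x i\<close> and
      kills \<open>y i\<close>, while \<open>a i * s i\<close> kills \<open>x i\<close> and fixes
      \<open>y i\<close>.\<close>
    let ?g = "\<lambda>i. f (Inl i) * (b i * t i) + f (Inr i) * (a i * s i)"
    have "?g i \<star> (x i + y i) = f (Inl i) \<star> x i + f (Inr i) \<star> y i" if i: "i \<in> I" for i
    proof -
      have "b i \<star> t i \<star> x i = x i" "a i \<star> s i \<star> y i = y i"
        using arg_cong[OF ab[OF i], of "\<lambda>f. f \<star> x i"] arg_cong[OF ab[OF i], of "\<lambda>f. f \<star> y i"]
        by (simp_all add: act_add_left act_mult ann i act_zero_right act_1)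
      then show ?thesis
        by (simp add: act_add_left act_add_right act_mult ann i act_zero_right)
    qed
    then show ?thesis unfolding f by (intro exI[of _ ?g] sum.cong) auto
  qed
  show "s i * t i dvd f i" if f: "(\<Sum>i\<in>I. f i \<star> (x i + y i)) = 0" and i: "i \<in> I" for f i
  proof -
    have "(\<Sum>i\<in>I <+> I. case_sum f f i \<star> case_sum x y i) = 0"
      using f fin by (simp add: sum.Plus sum.distrib act_add_right)
    from decomp_dvd[OF d this InlI[OF i]] decomp_dvd[OF d this InrI[OF i]]
    show ?thesis using cop[OF i] by (simp add: poly_coprime_mult_dvd)
  qed
  show "(s i * t i) \<star> (x i + y i) = 0" if "i \<in> I" for i
    using ann[OF that] act_mult[of "t i" "s i" "x i"]
    by (simp add: act_mult act_add_right act_zero_right mult.commute)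
qed

text \<open>\<open>represented_by\<close> without the basis requirement, since the condition must
  pass to the parts of \<open>bs\<close> that belong to the single blocks.\<close>

definition acts_as :: "'b list \<Rightarrow> 'a mat \<Rightarrow> bool" where
  "acts_as bs A \<longleftrightarrow> A \<in> carrier_mat (length bs) (length bs) \<and>
     (\<forall>j<length bs. u (bs ! j) = (\<Sum>i<length bs. (A $$ (i, j)) *s (bs ! i)))"

lemma represented_by_acts_as: "represented_by scale u bs A \<longleftrightarrow> ordered_basis scale bs \<and> acts_as bs A"
  by (auto simp: represented_by_def acts_as_def)

lemma sum_lessThan_add: "(\<Sum>i<m + n. g i) = (\<Sum>i<m. g i) + (\<Sum>i<n. g (m + i))" for g :: "nat \<Rightarrow> 'b"
  by (induction n) (simp_all add: algebra_simps)

lemma acts_as_append: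
  assumes A: "A \<in> carrier_mat m m" and B: "B \<in> carrier_mat n n"
  shows "acts_as bs (four_block_mat A (0\<^sub>m m n) (0\<^sub>m n m) B) \<longleftrightarrow>
    length bs = m + n \<and> acts_as (take m bs) A \<and> acts_as (drop m bs) B" (is "?l \<longleftrightarrow> ?r")
proof (cases "length bs = m + n")
  case True
  let ?M = "four_block_mat A (0\<^sub>m m n) (0\<^sub>m n m) B"
  have ij: "?M $$ (i, j) = (if i < m then if j < m then A $$ (i, j) else 0
      else if j < m then 0 else B $$ (i - m, j - m))" if "i < m + n" "j < m + n" for i j
    using that A B by auto
  have len: "length (take m bs) = m" "length (drop m bs) = n" using True by auto
  have left: "(\<Sum>i<m + n. ?M $$ (i, j) *s bs ! i) = (\<Sum>i<m. A $$ (i, j) *s take m bs ! i)" if "j < m" for j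
  proof -
    have "(\<Sum>i<m. ?M $$ (i, j) *s bs ! i) = (\<Sum>i<m. A $$ (i, j) *s take m bs ! i)"
      by (rule sum.cong) (use that in \<open>auto simp: ij simp del: index_mat_four_block\<close>)
    moreover have "(\<Sum>i<n. ?M $$ (m + i, j) *s bs ! (m + i)) = 0"
      by (rule sum.neutral) (use that in \<open>auto simp: ij simp del: index_mat_four_block\<close>)
    ultimately show ?thesis unfolding sum_lessThan_add by simp
  qed
  have right: "(\<Sum>i<m + n. ?M $$ (i, m + j) *s bs ! i) = (\<Sum>i<n. B $$ (i, j) *s drop m bs ! i)" if "j < n" for j
  proof -
    have "(\<Sum>i<n. ?M $$ (m + i, m + j) *s bs ! (m + i)) = (\<Sum>i<n. B $$ (i, j) *s drop m bs ! i)"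
      by (rule sum.cong) (use that True in \<open>auto simp: ij simp del: index_mat_four_block\<close>)
    moreover have "(\<Sum>i<m. ?M $$ (i, m + j) *s bs ! i) = 0"
      by (rule sum.neutral) (use that in \<open>auto simp: ij simp del: index_mat_four_block\<close>)
    ultimately show ?thesis unfolding sum_lessThan_add by simp
  qed
  have split: "(\<forall>j<m + n. Q j) \<longleftrightarrow> (\<forall>j<m. Q j) \<and> (\<forall>j<n. Q (m + j))" for Q
    by (metis add_less_cancel_left le_Suc_ex linorder_le_less_linear trans_less_add1)
  have "?M \<in> carrier_mat (m + n) (m + n)" using A B by auto
  then have "?l \<longleftrightarrow> (\<forall>j<m + n. u (bs ! j) = (\<Sum>i<m + n. ?M $$ (i, j) *s bs ! i))"
    by (simp add: acts_as_def True)
  also have "\<dots> \<longleftrightarrow> (\<forall>j<m. u (bs ! j) = (\<Sum>i<m. A $$ (i, j) *s take m bs ! i)) \<and>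
      (\<forall>j<n. u (bs ! (m + j)) = (\<Sum>i<n. B $$ (i, j) *s drop m bs ! i))"
    unfolding split using left right by simp
  also have "\<dots> \<longleftrightarrow> ?r"
    unfolding acts_as_def len using A B True by auto
  finally show ?thesis .
next
  case False
  then show ?thesis using A B by (auto simp: acts_as_def)
qed

text \<open>The ones below the diagonal force \<open>bs\<close> to be the chain of iterates of its
  first vector \<open>x\<close>, and the last column then says \<open>r \<star> x = 0\<close>. For
  \<open>r = 1\<close> the chain is empty and the witness is \<open>x = 0\<close>.\<close>

lemma acts_as_companion:
  assumes r: "Polynomial.lead_coeff r = 1"
  shows "acts_as bs (companion_mat r) \<longleftrightarrow>
    (\<exists>x. bs = map (\<lambda>j. (u ^^ j) x) [0..<Polynomial.degree r] \<and> r \<star> x = 0)" (is "?l \<longleftrightarrow> ?r")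
proof (cases "Polynomial.degree r")
  case 0
  then have "r = 1" using r by (auto elim: degree_eq_zeroE simp: one_pCons)
  then show ?thesis
    by (auto simp: acts_as_def companion_mat_def act_1)
next
  case (Suc n)
  let ?C = "companion_mat r"
  have C: "?C \<in> carrier_mat (Suc n) (Suc n)" by (simp add: companion_mat_def Suc)
  have ent: "?C $$ (i, j) = (if j = n then - Polynomial.coeff r i else if i = Suc j then 1 else 0)"
    if "i < Suc n" "j < Suc n" for i j
    using that by (simp add: companion_mat_def Suc)
  have col: "(\<Sum>i<Suc n. ?C $$ (i, j) *s bs ! i) = bs ! Suc j" if "j < n" for j and bs :: "'b list"
  proof -
    have "(\<Sum>i<Suc n. ?C $$ (i, j) *s bs ! i) = (\<Sum>i<Suc n. if i = Suc j then bs ! i else 0)"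
      by (rule sum.cong) (use that in \<open>auto simp: ent\<close>)
    then show ?thesis using that by simp
  qed
  have last: "(\<Sum>i<Suc n. ?C $$ (i, n) *s bs ! i) = - (\<Sum>i<Suc n. Polynomial.coeff r i *s bs ! i)"
    for bs :: "'b list"
    unfolding sum_negf[symmetric] by (rule sum.cong) (auto simp: ent)
  have lead: "Polynomial.coeff r (Suc n) = 1" using r Suc by simp
  have act: "r \<star> x = (\<Sum>i<Suc n. Polynomial.coeff r i *s (u ^^ i) x) + (u ^^ Suc n) x" for x
    by (simp add: endo_poly_def Suc lessThan_Suc_atMost[symmetric] lead)
  show ?thesis
  proof
    assume l: ?l
    then have len: "length bs = Suc n" using C by (auto simp: acts_as_def)
    have step: "u (bs ! j) = (\<Sum>i<Suc n. ?C $$ (i, j) *s bs ! i)" if "j < Suc n" for j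
      using l that unfolding acts_as_def len by blast
    define x where "x = bs ! 0"
    have pow: "bs ! j = (u ^^ j) x" if "j < Suc n" for j
      using that
    proof (induction j)
      case (Suc j)
      then show ?case using step[of j] col[of j bs] by simp
    qed (simp add: x_def)
    have "(u ^^ Suc n) x = - (\<Sum>i<Suc n. Polynomial.coeff r i *s bs ! i)"
      using step[of n] unfolding last pow[OF lessI] by simp
    also have "\<dots> = - (\<Sum>i<Suc n. Polynomial.coeff r i *s (u ^^ i) x)"
      by (intro arg_cong[of _ _ uminus] sum.cong refl) (subst pow, simp_all)
    finally have "r \<star> x = 0" unfolding act by simp
    moreover have "bs = map (\<lambda>j. (u ^^ j) x) [0..<Suc n]"
      by (rule nth_equalityI) (use len pow in \<open>auto simp del: upt_Suc\<close>)
    ultimately show ?r unfolding Suc by blast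
  next
    assume ?r
    then obtain x where bs: "bs = map (\<lambda>j. (u ^^ j) x) [0..<Suc n]" and x: "r \<star> x = 0" by (auto simp: Suc)
    have len: "length bs = Suc n" by (simp add: bs)
    have pow: "bs ! j = (u ^^ j) x" if "j < Suc n" for j
      using that unfolding bs by (simp del: upt_Suc)
    have "u (bs ! j) = (\<Sum>i<Suc n. ?C $$ (i, j) *s bs ! i)" if "j < Suc n" for j
    proof (cases "j = n")
      case True
      have "u (bs ! j) = (u ^^ Suc n) x" using True pow[of n] by simp
      also have "\<dots> = - (\<Sum>i<Suc n. Polynomial.coeff r i *s (u ^^ i) x)"
        using x unfolding act add_eq_0_iff .
      also have "\<dots> = - (\<Sum>i<Suc n. Polynomial.coeff r i *s bs ! i)"
        by (intro arg_cong[of _ _ uminus] sum.cong refl) (subst pow, simp_all)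
      finally show ?thesis using True last[of bs] by simp
    next
      case False
      then show ?thesis using that col[of j bs] pow[of j] pow[of "Suc j"] by simp
    qed
    then show ?l using C by (simp add: acts_as_def len)
  qed
qed

lemma companion_carrier: "companion_mat r \<in> carrier_mat (Polynomial.degree r) (Polynomial.degree r)"
  by (simp add: companion_mat_def)

lemma diag_companion_carrier:
  "diag_block_mat (map (\<lambda>i. companion_mat (r i)) is) \<in>
     carrier_mat (\<Sum>i\<leftarrow>is. Polynomial.degree (r i)) (\<Sum>i\<leftarrow>is. Polynomial.degree (r i))"
proof (rule carrier_matI)
qed (simp_all add: dim_diag_block_mat o_def companion_mat_def)

lemma acts_as_diag_companion:
  assumes "distinct is" "\<And>i. i \<in> set is \<Longrightarrow> Polynomial.lead_coeff (r i) = 1"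
  shows "acts_as bs (diag_block_mat (map (\<lambda>i. companion_mat (r i)) is)) \<longleftrightarrow>
    (\<exists>x. bs = concat (map (\<lambda>i. map (\<lambda>j. (u ^^ j) (x i)) [0..<Polynomial.degree (r i)]) is) \<and>
      (\<forall>i\<in>set is. r i \<star> x i = 0))"
  using assms
proof (induction "is" arbitrary: bs)
  case Nil
  then show ?case by (auto simp: acts_as_def)
next
  case (Cons k ks)
  define m n where "m = Polynomial.degree (r k)" and "n = (\<Sum>i\<leftarrow>ks. Polynomial.degree (r i))"
  let ?D = "diag_block_mat (map (\<lambda>i. companion_mat (r i)) ks)"
  let ?b = "\<lambda>x i. map (\<lambda>j. (u ^^ j) (x i)) [0..<Polynomial.degree (r i)]"
  have A: "companion_mat (r k) \<in> carrier_mat m m" unfolding m_def by (rule companion_carrier)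
  have B: "?D \<in> carrier_mat n n" unfolding n_def by (rule diag_companion_carrier)
  have "acts_as bs (diag_block_mat (map (\<lambda>i. companion_mat (r i)) (k # ks))) \<longleftrightarrow>
      length bs = m + n \<and> acts_as (take m bs) (companion_mat (r k)) \<and> acts_as (drop m bs) ?D"
    using acts_as_append[OF A B, of bs] A B by (simp add: Let_def)
  also have "\<dots> \<longleftrightarrow> length bs = m + n \<and> (\<exists>z. take m bs = ?b (\<lambda>_. z) k \<and> r k \<star> z = 0) \<and>
      (\<exists>x. drop m bs = concat (map (?b x) ks) \<and> (\<forall>i\<in>set ks. r i \<star> x i = 0))"
    using Cons by (simp add: acts_as_companion)
  also have "\<dots> \<longleftrightarrow> (\<exists>x. bs = concat (map (?b x) (k # ks)) \<and> (\<forall>i\<in>set (k # ks). r i \<star> x i = 0))"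
    (is "?l \<longleftrightarrow> ?r")
  proof
    assume ?l
    then obtain z x where *: "take m bs = ?b (\<lambda>_. z) k" "r k \<star> z = 0" 
      "drop m bs = concat (map (?b x) ks)" "\<forall>i\<in>set ks. r i \<star> x i = 0" by blast
    \<comment> \<open>Distinctness of the indices allows the witness of the first block to be joined
      to those of the others.\<close>
    let ?x = "x(k := z)"
    have mk: "map (?b ?x) ks = map (?b x) ks" using Cons.prems(1) by auto
    have "concat (map (?b ?x) (k # ks)) = take m bs @ drop m bs"
      unfolding *(1,3) list.map concat.simps mk by simp
    then have "bs = concat (map (?b ?x) (k # ks))" by simp
    moreover have "\<forall>i\<in>set (k # ks). r i \<star> ?x i = 0" using * by auto
    ultimately show ?r by blast
  next
    assume ?r
    then obtain x where bs: "bs = concat (map (?b x) (k # ks))" and ann: "\<forall>i\<in>set (k # ks). r i \<star> x i = 0" by blast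
    have "take m bs = ?b x k" "drop m bs = concat (map (?b x) ks)" "length bs = m + n"
      unfolding bs by (simp_all add: m_def n_def length_concat o_def)
    with ann show ?l by auto
  qed
  finally show ?case .
qed

section \<open>Bases as indexed families, and their translation into cyclic decompositions\<close>

lemma independent_image:
  assumes "finite J" "inj_on e J"
  shows "independent (e ` J) \<longleftrightarrow> (\<forall>c. (\<Sum>j\<in>J. c j *s e j) = 0 \<longrightarrow> (\<forall>j\<in>J. c j = 0))"
proof -
  have "independent (e ` J) \<longleftrightarrow> (\<forall>c. (\<Sum>v\<in>e ` J. c v *s v) = 0 \<longrightarrow> (\<forall>v\<in>e ` J. c v = 0))"
    using assms(1) by (simp add: dependent_finite) blast
  also have "\<dots> \<longleftrightarrow> (\<forall>c. (\<Sum>j\<in>J. c (e j) *s e j) = 0 \<longrightarrow> (\<forall>j\<in>J. c (e j) = 0))"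
    using assms(2) by (simp add: sum.reindex)
  also have "\<dots> \<longleftrightarrow> (\<forall>c. (\<Sum>j\<in>J. c j *s e j) = 0 \<longrightarrow> (\<forall>j\<in>J. c j = 0))" (is "?l \<longleftrightarrow> ?r")
  proof
    assume l: ?l
    show ?r
    proof (intro allI impI)
      fix c assume c: "(\<Sum>j\<in>J. c j *s e j) = 0"
      have inv: "the_inv_into J e (e j) = j" if "j \<in> J" for j
        using assms(2) that by (rule the_inv_into_f_f)
      then have "(\<Sum>j\<in>J. c (the_inv_into J e (e j)) *s e j) = 0" using c by (simp cong: sum.cong)
      with l[rule_format, of "\<lambda>v. c (the_inv_into J e v)"] inv show "\<forall>j\<in>J. c j = 0" by auto
    qed
  next
    assume r: ?r
    show ?l
      using r[rule_format, of "\<lambda>j. _ (e j)"] by blast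
  qed
  finally show ?thesis .
qed

text \<open>The relation has coefficient 1 at \<open>i\<close> and -1 at \<open>j\<close>. Hence
  independence of an indexed family includes its injectivity, which \<open>ordered_basis\<close>
  demands in the form of distinctness.\<close>

lemma collision_relation:
  assumes "finite J" "i \<in> J" "j \<in> J" "i \<noteq> j" "e i = e j"
  shows "\<exists>c. (\<Sum>k\<in>J. c k *s e k) = 0 \<and> c i \<noteq> 0"
proof -
  let ?c = "\<lambda>k. (if k = i then 1 else 0) - (if k = j then 1 else 0)"
  have "(\<Sum>k\<in>J. ?c k *s e k) = (\<Sum>k\<in>J. if k = i then e k else 0) - (\<Sum>k\<in>J. if k = j then e k else 0)"
    unfolding sum_subtractf[symmetric] by (rule sum.cong) (auto simp: scale_left_diff_distrib)
  also have "\<dots> = 0" using assms by simp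
  finally show ?thesis using \<open>i \<noteq> j\<close> by (intro exI[of _ ?c]) simp
qed

lemma ordered_basis_map:
  assumes "distinct js"
  shows "ordered_basis scale (map e js) \<longleftrightarrow>
    (\<forall>c. (\<Sum>j\<in>set js. c j *s e j) = 0 \<longrightarrow> (\<forall>j\<in>set js. c j = 0)) \<and>
    (\<forall>v. \<exists>c. v = (\<Sum>j\<in>set js. c j *s e j))" (is "_ \<longleftrightarrow> ?ind \<and> ?gen")
proof -
  have inj: "inj_on e (set js)" if ?ind
  proof (rule inj_onI, rule ccontr)
    fix i j assume ij: "i \<in> set js" "j \<in> set js" "e i = e j" "i \<noteq> j"
    with collision_relation[of "set js" i j e] that show False by auto
  qed
  show ?thesis
    unfolding ordered_basis_def using assms inj independent_image[of "set js" e]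
      span_image_finite[of "set js" e]
    by (auto simp: distinct_map)
qed

lemma act_poly_sum: "(\<Sum>j<n. Polynomial.monom (c j) j) \<star> x = (\<Sum>j<n. c j *s (u ^^ j) x)"
proof (induction n)
  case (Suc n)
  have "Polynomial.monom a m \<star> x = a *s (u ^^ m) x" for a m
    by (induction m) (simp_all add: act_const Polynomial.monom_0 Polynomial.monom_Suc act_pCons u_scale u_0)
  with Suc show ?case by (simp add: act_add_left)
qed (simp add: act_0)

lemma coeff_poly_sum: "Polynomial.coeff (\<Sum>j<n. Polynomial.monom (c j) j) i = (if i < n then c i else 0)"
  by (induction n) auto

lemma degree_poly_sum: "(\<Sum>j<n. Polynomial.monom (c j) j) = 0 \<or> Polynomial.degree (\<Sum>j<n. Polynomial.monom (c j) j) < n"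
  using coeff_poly_sum[where n = n and c = c and i = "Polynomial.degree (\<Sum>j<n. Polynomial.monom (c j) j)"]
  by (auto simp del: coeff_poly_sum split: if_splits)

lemma act_mod:
  assumes "Polynomial.degree (f mod r) < n \<or> f mod r = 0" "r \<star> x = 0"
  shows "f \<star> x = (\<Sum>j<n. Polynomial.coeff (f mod r) j *s (u ^^ j) x)"
proof -
  have "f \<star> x = (f mod r + (f div r) * r) \<star> x" by simp
  also have "\<dots> = (f mod r) \<star> x" using assms(2) by (simp only: act_add_left act_mult act_zero_right) simp
  also have "f mod r = (\<Sum>j<n. Polynomial.monom (Polynomial.coeff (f mod r) j) j)"
    by (rule poly_eqI) (use assms(1) in \<open>auto simp: coeff_poly_sum intro: coeff_eq_0\<close>)
  finally show ?thesis using act_poly_sum[where n = n and c = "Polynomial.coeff (f mod r)" and x = x] by simp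
qed

text \<open>A family of scalars indexed by the positions \<open>(i, j)\<close> of the basis is the
  same as a family of polynomials of degrees below those of the \<open>r i\<close>. Reduction modulo
  \<open>r i\<close> brings arbitrary polynomials into this form, and such a polynomial is divisible
  by \<open>r i\<close> only if it is 0; so linear independence corresponds to the relations of a
  decomposition.\<close>

theorem represented_by_decomp:
  fixes "is" :: "'i list"
  assumes "distinct is" and monic: "\<And>i. i \<in> set is \<Longrightarrow> Polynomial.lead_coeff (r i) = 1"
  shows "(\<exists>bs. represented_by scale u bs (diag_block_mat (map (\<lambda>i. companion_mat (r i)) is))) \<longleftrightarrow>
    (\<exists>x. decomp (set is) x r)"
proof -
  define js where "js = concat (map (\<lambda>i. map (Pair i) [0..<Polynomial.degree (r i)]) is)"
  have set_js: "set js = Sigma (set is) (\<lambda>i. {..<Polynomial.degree (r i)})"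
    by (auto simp: js_def)
  have "distinct js"
    unfolding js_def using assms(1)
    by (induction "is") (auto simp: distinct_map inj_on_def)
  define e where "e x = (\<lambda>(i, j). (u ^^ j) (x i))" for x :: "'i \<Rightarrow> 'b"
  have conc: "concat (map (\<lambda>i. map (\<lambda>j. (u ^^ j) (x i)) [0..<Polynomial.degree (r i)]) is) = map (e x) js" for x
    by (simp add: js_def e_def map_concat o_def)
  have deg: "Polynomial.degree (f mod r i) < Polynomial.degree (r i) \<or> f mod r i = 0" if "i \<in> set is" for f i
  proof -
    have "r i \<noteq> 0" using monic[OF that] by auto
    then show ?thesis using degree_mod_less[of "r i" f] by blast
  qed
  have main: "ordered_basis scale (map (e x) js) \<longleftrightarrow> decomp (set is) x r"
    if ann: "\<And>i. i \<in> set is \<Longrightarrow> r i \<star> x i = 0" for x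
  proof -
    define p where "p c i = (\<Sum>j<Polynomial.degree (r i). Polynomial.monom (c (i, j)) j)" for c :: "'i \<times> nat \<Rightarrow> 'a" and i
    have sum: "(\<Sum>j\<in>set js. c j *s e x j) = (\<Sum>i\<in>set is. p c i \<star> x i)" for c
      unfolding set_js p_def act_poly_sum by (simp add: sum.Sigma e_def case_prod_unfold)
    have p0: "p c i = 0 \<longleftrightarrow> (\<forall>j<Polynomial.degree (r i). c (i, j) = 0)" for c i
      unfolding p_def poly_eq_iff coeff_poly_sum by auto
    have pdvd: "r i dvd p c i \<longleftrightarrow> p c i = 0" for c i
    proof
      assume "r i dvd p c i"
      then have "Polynomial.degree (r i) \<le> Polynomial.degree (p c i)" if "p c i \<noteq> 0"
        using that by (rule dvd_imp_degree_le)
      moreover have "p c i = 0 \<or> Polynomial.degree (p c i) < Polynomial.degree (r i)"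
        unfolding p_def by (rule degree_poly_sum)
      ultimately show "p c i = 0" by linarith
    qed simp
    have red: "(\<Sum>i\<in>set is. f i \<star> x i) = (\<Sum>i\<in>set is. p (\<lambda>(i, j). Polynomial.coeff (f i mod r i) j) i \<star> x i)" for f
      by (rule sum.cong) (simp_all add: p_def act_poly_sum act_mod[OF deg ann])
    have coeff_dvd: "r i dvd f i" if "\<forall>j<Polynomial.degree (r i). Polynomial.coeff (f i mod r i) j = 0" "i \<in> set is" for f i
    proof -
      have "f i mod r i = 0" using deg[OF that(2), of "f i"] that(1) by (metis leading_coeff_0_iff)
      then show ?thesis by (simp add: dvd_eq_mod_eq_0)
    qed
    show ?thesis
    proof
      assume "ordered_basis scale (map (e x) js)"
      then have ind: "\<And>c j. (\<Sum>i\<in>set is. p c i \<star> x i) = 0 \<Longrightarrow> j \<in> set js \<Longrightarrow> c j = 0"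
        and gen: "\<And>v. \<exists>c. v = (\<Sum>i\<in>set is. p c i \<star> x i)"
        unfolding ordered_basis_map[OF \<open>distinct js\<close>] sum by blast+
      show "decomp (set is) x r"
      proof (rule decompI)
        show "\<exists>f. v = (\<Sum>i\<in>set is. f i \<star> x i)" for v using gen by blast
        fix f i assume "(\<Sum>i\<in>set is. f i \<star> x i) = 0" "i \<in> set is"
        then show "r i dvd f i"
          using ind[of "\<lambda>(i, j). Polynomial.coeff (f i mod r i) j"] red[of f]
          by (intro coeff_dvd) (auto simp: set_js)
      qed (use ann in auto)
    next
      assume d: "decomp (set is) x r"
      have "c j = 0" if "(\<Sum>i\<in>set is. p c i \<star> x i) = 0" "j \<in> set js" for c j
      proof -
        have "\<forall>i\<in>set is. p c i = 0" using decomp_indep[OF d, of "p c"] that(1) pdvd by blast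
        then show ?thesis using that(2) by (auto simp: p0 set_js)
      qed
      moreover have "\<exists>c. v = (\<Sum>i\<in>set is. p c i \<star> x i)" for v
      proof -
        obtain f where "v = (\<Sum>i\<in>set is. f i \<star> x i)" using decomp_gen[OF d] by blast
        then show ?thesis unfolding red[of f]
          by (intro exI[of _ "\<lambda>(i, j). Polynomial.coeff (f i mod r i) j"])
      qed
      ultimately show "ordered_basis scale (map (e x) js)"
        unfolding ordered_basis_map[OF \<open>distinct js\<close>] sum by blast
    qed
  qed
  have eq: "acts_as bs (diag_block_mat (map (\<lambda>i. companion_mat (r i)) is)) \<longleftrightarrow>
      (\<exists>x. bs = map (e x) js \<and> (\<forall>i\<in>set is. r i \<star> x i = 0))" for bs
    unfolding conc[symmetric] by (rule acts_as_diag_companion[OF assms])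
  have "(\<exists>bs. represented_by scale u bs (diag_block_mat (map (\<lambda>i. companion_mat (r i)) is))) \<longleftrightarrow>
      (\<exists>x. ordered_basis scale (map (e x) js) \<and> (\<forall>i\<in>set is. r i \<star> x i = 0))"
    unfolding represented_by_acts_as eq by metis
  also have "\<dots> \<longleftrightarrow> (\<exists>x. decomp (set is) x r)"
  proof (rule arg_cong[of _ _ Ex], rule ext)
    fix x
    have "\<forall>i\<in>set is. r i \<star> x i = 0" if "decomp (set is) x r"
      using decomp_ann[OF that] by simp
    with main[of x] show "(ordered_basis scale (map (e x) js) \<and> (\<forall>i\<in>set is. r i \<star> x i = 0)) = decomp (set is) x r"
      by blast
  qed
  finally show ?thesis .
qed

end

subsection \<open>Conjugation\<close>

text \<open>Here \<open>p\<close> is \<open>[:al, - lam, 1:]\<close>, the roots of \<open>q\<close>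
  are \<open>y\<^sub>1\<close> and \<open>y\<^sub>2\<close>, and \<open>K True\<close>,
  \<open>K False\<close> are the polynomials \<open>H y\<^sub>1 p\<close>,
  \<open>H y\<^sub>2 p\<close>. The Boolean index lets one statement cover both,
  \<open>K (\<not> b)\<close> being the other one. The trace condition enters through
  \<open>K_neq\<close>.\<close>

locale quad = endo scale Basis u
  for scale :: "'a::field \<Rightarrow> 'b::ab_group_add \<Rightarrow> 'b" (infixr "*s" 75) and Basis :: "'b set" and u +
  fixes lam al y\<^sub>1 y\<^sub>2 :: 'a and K :: "bool \<Rightarrow> 'a poly"
  assumes al: "al \<noteq> 0" and y: "y\<^sub>1 \<noteq> 0" "y\<^sub>2 \<noteq> 0"
    and K_True: "K True = [:al / y\<^sub>1^2, - lam / y\<^sub>1, 1:]"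
    and K_False: "K False = [:al / y\<^sub>2^2, - lam / y\<^sub>2, 1:]"
    and K_irred: "Factorial_Ring.irreducible (K c)"
    and K_neq: "K True \<noteq> K False"
begin

definition c where "c = al / (y\<^sub>1 * y\<^sub>2)"
definition mu where "mu = y\<^sub>1 + y\<^sub>2"
definition be where "be = y\<^sub>1 * y\<^sub>2"

lemma c_nz: "c \<noteq> 0" and be_nz: "be \<noteq> 0" and al_eq: "al = c * be"
  using al y by (simp_all add: c_def be_def)

lemma K_monic: "Polynomial.lead_coeff (K b) = 1"
  by (cases b) (simp_all add: K_True K_False)

lemma K_nz: "K b \<noteq> 0"
  by (cases b) (simp_all add: K_True K_False)

lemma K_degree: "Polynomial.degree (K b) = 2"
  by (cases b) (simp_all add: K_True K_False)

lemma K_coprime: "coprime (K True) (K False)"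
proof (rule irreducible_coprime[OF K_irred])
  show "\<not> K True dvd K False"
    using monic_irreducible_dvd[OF K_monic K_irred K_monic K_irred] K_neq by metis
qed

lemma K_coprime_Not: "coprime (K b) (K (\<not> b))"
  using K_coprime by (cases b) (simp_all add: coprime_commute)

lemma K_coprime_pow: "coprime (K b ^ m) (K (\<not> b) ^ n)"
  using poly_coprime_power_right[OF K_coprime_Not, of b n] poly_coprime_power_right[of "K (\<not> b) ^ n" "K b" m]
  by (simp add: coprime_commute)

lemma coprime_KK:
  assumes "\<And>b. \<not> K b dvd f"
  shows "coprime f ((K True * K False) ^ n)"
proof -
  have "coprime f (K b)" for b
    using irreducible_coprime[OF K_irred assms] by (simp add: coprime_commute)
  then show ?thesis by (intro poly_coprime_power_right poly_coprime_mult_right)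
qed

text \<open>Equality of the induced operators. Identities such as the one relating \<open>u\<close>
  to its inverse hold only in this sense, yet can be used inside polynomial computations thanks to
  the congruence rules that follow.\<close>

definition aeq :: "'a poly \<Rightarrow> 'a poly \<Rightarrow> bool" (infix "\<approx>" 50)
  where "f \<approx> g \<longleftrightarrow> (\<forall>v. f \<star> v = g \<star> v)"

lemma aeqD: "f \<approx> g \<Longrightarrow> f \<star> v = g \<star> v"
  by (simp add: aeq_def)

lemma aeq_refl: "f \<approx> f" and aeq_trans [trans]: "f \<approx> g \<Longrightarrow> g \<approx> h \<Longrightarrow> f \<approx> h"
  by (simp_all add: aeq_def)

lemma aeq_add: "f \<approx> g \<Longrightarrow> f' \<approx> g' \<Longrightarrow> f + f' \<approx> g + g'"
  and aeq_diff: "f \<approx> g \<Longrightarrow> f' \<approx> g' \<Longrightarrow> f - f' \<approx> g - g'"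
  and aeq_mult: "f \<approx> g \<Longrightarrow> f' \<approx> g' \<Longrightarrow> f * f' \<approx> g * g'"
  and aeq_smult: "f \<approx> g \<Longrightarrow> Polynomial.smult a f \<approx> Polynomial.smult a g"
  by (simp_all add: aeq_def act_add_left act_mult act_smult P.scale_left_diff_distrib)

lemma aeq_power: "f \<approx> g \<Longrightarrow> f ^ n \<approx> g ^ n"
  by (induction n) (simp_all add: aeq_refl aeq_mult)

lemma aeq_pcompose: "g \<approx> g' \<Longrightarrow> pcompose f g \<approx> pcompose f g'"
  by (induction f) (auto simp: pcompose_pCons aeq_refl intro!: aeq_add aeq_mult)

end

text \<open>Exceptionality expressed without eigenvalues, see
  \<open>exceptional_iff_torsion\<close>. Under this assumption every polynomial prime to both
  \<open>K b\<close> acts invertibly, in particular \<open>X\<close>.\<close>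

locale torsion = quad scale Basis u lam al y\<^sub>1 y\<^sub>2 K
  for scale :: "'a::field \<Rightarrow> 'b::ab_group_add \<Rightarrow> 'b" (infixr "*s" 75) and Basis u lam al y\<^sub>1 y\<^sub>2 K +
  fixes N :: nat
  assumes tors: "((K True * K False) ^ N) \<star> v = 0"
begin

abbreviation T :: "'a poly" where "T \<equiv> [:0, 1:]"

text \<open>A Bezout relation with the annihilating power. The first conclusion is kept as a
  divisibility of polynomials because \<open>star\<close> can be applied to it, but not to a
  relation \<open>\<approx>\<close>.\<close>

lemma unit_exists:
  assumes "\<And>b. \<not> K b dvd f"
  obtains g where "(K True * K False) ^ N dvd f * g - 1" "g * f \<approx> 1"
proof -
  obtain a b where ab: "a * f + b * (K True * K False) ^ N = 1"
    using poly_bezout[OF coprime_KK[OF assms, of N]] .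
  have "f * a - 1 = (K True * K False) ^ N * (- b)"
    unfolding ab[symmetric] by (simp add: algebra_simps)
  then have "(K True * K False) ^ N dvd f * a - 1" by (simp only: dvd_triv_left)
  moreover have "a * f \<approx> 1"
    unfolding aeq_def ab[symmetric] by (simp add: act_add_left act_mult[of b] tors act_zero_right)
  ultimately show ?thesis by (rule that)
qed

lemma K_ndvd_T: "\<not> K b dvd T"
proof
  assume "K b dvd T"
  then have "Polynomial.degree (K b) \<le> Polynomial.degree T" by (rule dvd_imp_degree_le) simp
  then show False by (simp add: K_degree)
qed

lemma sigma_exists: "\<exists>s. (K True * K False) ^ N dvd T * s - [:c:]"
proof -
  obtain g where g: "(K True * K False) ^ N dvd T * g - 1" using unit_exists[OF K_ndvd_T] .
  have "T * (Polynomial.smult c g) - [:c:] = [:c:] * (T * g - 1)"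
    by (simp add: algebra_simps one_pCons)
  with g show ?thesis by (metis dvd_mult)
qed

text \<open>By the choice of \<open>sigma\<close>, the polynomial \<open>star f\<close> acts as \<open>f (c u\<^sup>-\<^sup>1)\<close>; when \<open>u = a b\<^sup>-\<^sup>1\<close>,
  \<open>c u\<^sup>-\<^sup>1\<close> is the quaternionic conjugate of \<open>u\<close> in the algebra generated by \<open>a\<close> and \<open>b\<close>.\<close>

definition sigma where "sigma = (SOME s. (K True * K False) ^ N dvd T * s - [:c:])"

definition star :: "'a poly \<Rightarrow> 'a poly" where "star f = pcompose f sigma"

lemma sigma_dvd: "(K True * K False) ^ N dvd T * sigma - [:c:]"
  unfolding sigma_def by (rule someI_ex[OF sigma_exists])

lemma aeq_dvdI: "(K True * K False) ^ N dvd f - g \<Longrightarrow> f \<approx> g"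
proof -
  assume "(K True * K False) ^ N dvd f - g"
  then obtain k where "f - g = (K True * K False) ^ N * k" by (blast elim: Rings.dvdE)
  then have "f = g + k * (K True * K False) ^ N" by (simp add: algebra_simps)
  then show ?thesis by (simp add: aeq_def act_add_left act_mult[of k] tors act_zero_right)
qed

lemma T_sigma: "T * sigma \<approx> [:c:]"
  by (rule aeq_dvdI[OF sigma_dvd])

lemma T_inj: "T \<star> v = 0 \<Longrightarrow> v = 0"
proof -
  assume "T \<star> v = 0"
  then have "(sigma * T) \<star> v = 0" by (simp only: act_mult act_zero_right)
  then have "(T * sigma) \<star> v = 0" by (simp only: mult.commute)
  then show "v = 0" using aeqD[OF T_sigma, of v] c_nz by (simp add: act_const)
qed

lemma T_pow_inj: "T ^ m \<star> w = 0 \<Longrightarrow> w = 0"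
proof (induction m)
  case (Suc m)
  then show ?case using T_inj[of "T ^ m \<star> w"] by (simp only: power_Suc act_mult)
qed (simp add: act_1)

lemma sigma_inj: "sigma \<star> v = 0 \<Longrightarrow> v = 0"
proof -
  assume "sigma \<star> v = 0"
  then have "(T * sigma) \<star> v = 0" by (simp only: act_mult act_zero_right)
  then show "v = 0" using aeqD[OF T_sigma, of v] c_nz by (simp add: act_const)
qed

lemma star_mult: "star (f * g) = star f * star g"
  and star_add: "star (f + g) = star f + star g"
  and star_diff: "star (f - g) = star f - star g"
  and star_smult: "star (Polynomial.smult a f) = Polynomial.smult a (star f)"
  and star_power: "star (f ^ n) = star f ^ n"
  and star_const: "star [:a:] = [:a:]"
  and star_T: "star T = sigma"
  and star_0: "star 0 = 0" and star_1: "star 1 = 1"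
  by (simp_all add: star_def pcompose_mult pcompose_add pcompose_diff pcompose_smult pcompose_pCons
      pcompose_1 pcompose_hom.hom_power)

lemma K_act_square: "K b = T * T + Polynomial.smult (- lam / (if b then y\<^sub>1 else y\<^sub>2)) T +
    [:al / (if b then y\<^sub>1 else y\<^sub>2)^2:]"
  by (cases b) (simp_all add: K_True K_False)

text \<open>If \<open>r\<close> and \<open>r'\<close> are the roots of \<open>p\<close>, so that
  \<open>r r' = al\<close>, then \<open>r / d\<close> is a root of \<open>K b\<close> and
  \<open>c / (r / d) = r' / e\<close> is one of \<open>K (\<not> b)\<close>. The factor
  \<open>T * T\<close> clears denominators, and the constant coefficient
  \<open>al / d\<^sup>2\<close> of \<open>K b\<close> becomes the leading one.\<close>

lemma star_K: "T * T * star (K b) \<approx> Polynomial.smult (al / (if b then y\<^sub>1 else y\<^sub>2)^2) (K (\<not> b))"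
proof -
  define d e where "d = (if b then y\<^sub>1 else y\<^sub>2)" and "e = (if b then y\<^sub>2 else y\<^sub>1)"
  have de: "d \<noteq> 0" "e \<noteq> 0" "c = al / (d * e)" using y by (auto simp: d_def e_def c_def)
  have Kb: "K b = T * T + Polynomial.smult (- lam / d) T + [:al / d^2:]"
    unfolding d_def by (rule K_act_square)
  have Knb: "K (\<not> b) = T * T + Polynomial.smult (- lam / e) T + [:al / e^2:]"
    using K_act_square[of "\<not> b"] by (cases b) (simp_all add: e_def)
  have star_Kb: "star (K b) = [:al / d^2:] + sigma * ([:- lam / d:] + sigma)"
    unfolding d_def by (cases b) (simp_all add: star_def K_True K_False pcompose_pCons algebra_simps)
  have poly_id: "t * t * (a + s * (l + s)) = (t * s) * (t * s) + l * (t * (t * s)) + a * (t * t)"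
    for t s a l :: "'a poly" by (simp add: algebra_simps)
  have "T * T * star (K b) = (T * sigma) * (T * sigma) + [:- lam / d:] * (T * (T * sigma)) + [:al / d^2:] * (T * T)"
    unfolding star_Kb by (rule poly_id)
  also have "\<dots> \<approx> [:c:] * [:c:] + [:- lam / d:] * (T * [:c:]) + [:al / d^2:] * (T * T)"
    by (intro aeq_add aeq_mult T_sigma aeq_refl)
  also have "[:c:] * [:c:] + [:- lam / d:] * (T * [:c:]) + [:al / d^2:] * (T * T) =
      Polynomial.smult (al / d^2) (K (\<not> b))"
  proof -
    \<comment> \<open>Writing \<open>k * d * e\<close> for \<open>al\<close> avoids the fraction in
      \<open>c\<close>.\<close>
    have gen: "[:k:] * [:k:] + [:- lam / d:] * (T * [:k:]) + [:k * d * e / d^2:] * (T * T) =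
        Polynomial.smult (k * d * e / d^2) (T * T + Polynomial.smult (- lam / e) T + [:k * d * e / e^2:])" for k
      using de(1,2) by (simp add: field_simps power2_eq_square)
    have "c * d * e = al" using de by simp
    then show ?thesis using gen[of c] unfolding Knb by (simp only:)
  qed
  finally show ?thesis by (simp add: d_def)
qed

text \<open>As \<open>star\<close> need not respect \<open>\<approx>\<close>, it has to be checked
  that the conjugate of the annihilating power annihilates too. By \<open>star_K\<close> the product
  of both factors is conjugated into itself up to a constant and the injective factor
  \<open>T ^ 4\<close>.\<close>

lemma star_tors: "star ((K True * K False) ^ N) \<star> v = 0"
proof -
  define h where "h = K True * K False"
  define k where "k = (al / y\<^sub>1^2) * (al / y\<^sub>2^2)"
  have "(T * T * star (K True)) * (T * T * star (K False)) \<approx>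
      Polynomial.smult (al / y\<^sub>1^2) (K False) * Polynomial.smult (al / y\<^sub>2^2) (K True)"
    using aeq_mult[OF star_K[of True] star_K[of False]]
    by (simp only: if_True if_False not_True_eq_False not_False_eq_True)
  also have "(T * T * star (K True)) * (T * T * star (K False)) = T ^ 4 * star h"
    unfolding h_def star_mult by (simp only: power4_eq_xxxx ac_simps)
  also have "Polynomial.smult (al / y\<^sub>1^2) (K False) * Polynomial.smult (al / y\<^sub>2^2) (K True) = Polynomial.smult k h"
    by (simp add: k_def h_def mult.commute)
  finally have "(T ^ 4 * star h) ^ N \<approx> (Polynomial.smult k h) ^ N" by (rule aeq_power)
  then have "(T ^ (4 * N) * star (h ^ N)) \<star> v = Polynomial.smult (k ^ N) (h ^ N) \<star> v"
    unfolding aeq_def by (simp only: power_mult_distrib power_mult star_power smult_power)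
  also have "\<dots> = 0" by (simp add: act_smult h_def tors)
  finally have *: "T ^ (4 * N) \<star> star (h ^ N) \<star> v = 0" by (simp only: act_mult)
  from T_pow_inj[OF *] show ?thesis by (simp add: h_def)
qed

text \<open>Conjugating the divisibility behind \<open>sigma\<close> gives
  \<open>sigma * star sigma \<approx> [:c:]\<close>; comparison with
  \<open>T * sigma \<approx> [:c:]\<close> and injectivity of \<open>sigma\<close> yield the
  claim.\<close>

lemma sigma_sigma: "star sigma \<approx> T"
proof -
  obtain k where "T * sigma - [:c:] = (K True * K False) ^ N * k"
    using sigma_dvd by (blast elim: Rings.dvdE)
  then have "star (T * sigma - [:c:]) = star k * star ((K True * K False) ^ N)"
    by (simp add: star_mult mult.commute)
  then have "(sigma * star sigma - [:c:]) \<star> v = 0" for v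
    by (simp only: star_diff star_mult star_T star_const act_mult[of "star k"] star_tors act_zero_right)
  then have "sigma \<star> star sigma \<star> v = c *s v" for v
    by (simp add: P.scale_left_diff_distrib act_mult act_const)
  moreover have "sigma \<star> T \<star> v = c *s v" for v
    using aeqD[OF T_sigma, of v] by (simp only: act_mult[symmetric] mult.commute act_const)
  ultimately have "sigma \<star> (star sigma \<star> v - T \<star> v) = 0" for v
    by (simp only: P.scale_right_diff_distrib) simp
  then show ?thesis using sigma_inj unfolding aeq_def by (metis eq_iff_diff_eq_0)
qed

lemma star_star: "star (star f) \<approx> f"
proof -
  have "star (star f) = pcompose f (star sigma)" by (simp add: star_def pcompose_assoc)
  also have "\<dots> \<approx> pcompose f T" by (rule aeq_pcompose[OF sigma_sigma])
  finally show ?thesis by simp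
qed

text \<open>For \<open>u = a b\<^sup>-\<^sup>1\<close> and \<open>s = u b - b u\<close>, the relations \<open>delta b = A0 + s\<close> and \<open>s\<^sup>2 = kappa\<close> hold;
  conversely they recover \<open>b\<close> from \<open>s\<close>, as \<open>delta\<close> is invertible.\<close>

definition A0 where "A0 = [:lam:] - Polynomial.smult mu sigma"
definition A1 where "A1 = [:lam:] - Polynomial.smult mu T"
definition delta where "delta = T - sigma"
definition kappa where "kappa = A0 * A1 + Polynomial.smult be (delta * delta)"

lemma star_A0: "star A0 \<approx> A1"
  unfolding A0_def A1_def star_diff star_const star_smult
  by (intro aeq_diff aeq_refl aeq_smult sigma_sigma)

lemma star_A1: "star A1 = A0"
  unfolding A0_def A1_def star_diff star_const star_smult star_T ..

text \<open>Conjugation exchanges \<open>A0\<close> with \<open>A1\<close> and changes the sign of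
  \<open>delta\<close>. The invariance of \<open>kappa\<close> is what a value of
  \<open>s\<^sup>2\<close> must satisfy, as \<open>s\<close> commutes with its square.\<close>

lemma star_kappa: "star kappa \<approx> kappa"
proof -
  have "star delta \<approx> sigma - T"
    unfolding delta_def star_diff star_T by (intro aeq_diff aeq_refl sigma_sigma)
  then have "star kappa \<approx> A1 * A0 + Polynomial.smult be ((sigma - T) * (sigma - T))"
    unfolding kappa_def star_add star_mult star_smult star_A1
    by (intro aeq_add aeq_mult aeq_smult star_A0 aeq_refl)
  also have "\<dots> = kappa"
  proof -
    have "(s - t) * (s - t) = (t - s) * (t - s)" for s t :: "'a poly" by (simp add: algebra_simps)
    then show ?thesis unfolding kappa_def delta_def by (simp only: mult.commute)
  qed
  finally show ?thesis .
qed

lemma kappa_K: "T * T * kappa \<approx> Polynomial.smult be (K True * K False)"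
proof -
  have poly_id: "t * t * ((l - m * s) * (l - m * t) + b * ((t - s) * (t - s))) =
      (l * t - m * (t * s)) * (l - m * t) * t + b * ((t * t - t * s) * (t * t - t * s))"
    for t s l m b :: "'a poly" by (simp add: algebra_simps)
  have kappa: "T * T * kappa = ([:lam:] * T - [:mu:] * (T * sigma)) * ([:lam:] - [:mu:] * T) * T
      + [:be:] * ((T * T - T * sigma) * (T * T - T * sigma))"
    using poly_id[of T "[:lam:]" "[:mu:]" sigma "[:be:]"]
    by (simp add: kappa_def A0_def A1_def delta_def)
  \<comment> \<open>Once \<open>T * sigma\<close> is replaced by \<open>c\<close>, only an identity
    between explicit polynomials remains, checked by expansion.\<close>
  have KK: "([:lam:] * T - [:mu:] * [:c:]) * ([:lam:] - [:mu:] * T) * T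
      + [:be:] * ((T * T - [:c:]) * (T * T - [:c:])) = Polynomial.smult be (K True * K False)"
    unfolding K_True K_False using y by (simp add: mu_def be_def c_def field_simps power2_eq_square)
  show ?thesis
    unfolding kappa KK[symmetric]
    by (intro aeq_add aeq_mult aeq_diff T_sigma aeq_refl)
qed

text \<open>Up to the unit \<open>T\<close>, \<open>delta\<close> is \<open>X\<^sup>2 - c\<close>.
  If \<open>K b\<close> divided it, the two would coincide, being monic of degree 2; then
  \<open>lam = 0\<close> and \<open>y\<^sub>2 = - y\<^sub>1\<close>, which makes
  \<open>K True\<close> and \<open>K False\<close> equal.\<close>

lemma delta_inverse: obtains rho where "rho * delta \<approx> 1"
proof -
  have "\<not> K b dvd T * T - [:c:]" for b
  proof
    assume *: "K b dvd T * T - [:c:]"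
    have "Polynomial.lead_coeff (T * T - [:c:]) = 1" "Polynomial.degree (T * T - [:c:]) = 2" by simp_all
    with * obtain k where k: "T * T - [:c:] = K b * k" by (blast elim: Rings.dvdE)
    have "T * T - [:c:] \<noteq> 0" by simp
    with k have "k \<noteq> 0" by auto
    have "Polynomial.degree (T * T - [:c:]) = Polynomial.degree (K b) + Polynomial.degree k"
      unfolding k using K_nz \<open>k \<noteq> 0\<close> by (rule degree_mult_eq)
    then have "Polynomial.degree k = 0" by (simp add: K_degree)
    then obtain a where a: "k = [:a:]" by (auto elim: degree_eq_zeroE)
    have *: "lam = 0 \<and> (- (al * y\<^sub>1) = al * y\<^sub>2 \<or> - (al * y\<^sub>2) = al * y\<^sub>1)"
      using k y al unfolding a by (cases b) (auto simp: K_True K_False c_def field_simps power2_eq_square)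
    then have "al * (y\<^sub>1 + y\<^sub>2) = 0" by (metis add.commute add.right_inverse distrib_left)
    then have "y\<^sub>1 = - y\<^sub>2" using al by (simp add: eq_neg_iff_add_eq_0)
    with * have "K True = K False" by (simp add: K_True K_False)
    with K_neq show False by simp
  qed
  then obtain g where g: "g * (T * T - [:c:]) \<approx> 1" using unit_exists by blast
  have "(g * T) * delta = g * (T * T - T * sigma)"
    by (simp only: delta_def algebra_simps)
  also have "\<dots> \<approx> g * (T * T - [:c:])" by (intro aeq_mult aeq_diff T_sigma aeq_refl)
  also note g
  finally show ?thesis by (rule that)
qed

end

subsection \<open>Quotients and semilinear maps\<close>

context torsion
begin

lemma act_A0: "A0 \<star> v = lam *s v - mu *s sigma \<star> v"
  and act_A1: "A1 \<star> v = lam *s v - mu *s u v"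
  and act_delta: "delta \<star> v = u v - sigma \<star> v"
  by (simp_all only: A0_def A1_def delta_def P.scale_left_diff_distrib act_smult act_const act_X)

lemma act_kappa: "kappa \<star> v = A0 \<star> A1 \<star> v + be *s delta \<star> delta \<star> v"
  by (simp add: kappa_def act_add_left act_mult act_smult)

lemma u_sigma: "u (sigma \<star> v) = c *s v" and sigma_u: "sigma \<star> u v = c *s v"
  using aeqD[OF T_sigma, of v] by (simp_all only: act_mult act_X act_const act_u)

lemma act_diff_right: "f \<star> (v - w) = f \<star> v - f \<star> w"
  by (rule P.scale_right_diff_distrib)

lemma u_diff: "u (v - w) = u v - u w"
  using act_diff_right[of T v w] by (simp only: act_X)

text \<open>Since \<open>be b\<^sup>-\<^sup>1 = mu - b\<close>, the equation of
  \<open>a = u b\<close> becomes \<open>u b u = lam u - c mu + c b\<close>. Multiplication by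
  \<open>u\<^sup>-\<^sup>1\<close> on the left gives \<open>b u = A0 + sigma b\<close>, so every
  product of \<open>b\<close> and \<open>u\<close> can be brought into the form polynomial plus
  polynomial times \<open>b\<close>, and the claims on \<open>s\<close> become computations.\<close>

lemma semilinear_of_quotient:
  assumes b_add: "\<And>v w. b (v + w) = b v + b w" and b_scale: "\<And>k v. b (k *s v) = k *s b v"
    and bb: "\<And>v. b (b v) = mu *s b v - be *s v"
    and aa: "\<And>v. u (b (u (b v))) = lam *s u (b v) - al *s v"
  shows "\<exists>s. (\<forall>v w. s (v + w) = s v + s w) \<and> (\<forall>k v. s (k *s v) = k *s s v) \<and>
    (\<forall>v. s (u v) = sigma \<star> s v) \<and> (\<forall>v. s (s v) = kappa \<star> v)"
proof -
  have b_minus: "b (- v) = - b v" for v using b_scale[of "-1" v] by simp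
  have b_diff: "b (v - w) = b v - b w" for v w using b_add[of v "- w"] b_minus by simp
  note expand = u_add u_diff u_scale act_add_right act_diff_right act_scale b_add b_diff b_scale
    scale_right_distrib scale_right_diff_distrib scale_scale u_sigma sigma_u
  have aa': "u (b (u (b v))) = lam *s u (b v) - (c * be) *s v" for v
    by (simp only: aa al_eq[symmetric])
  \<comment> \<open>Instead of inverting \<open>b\<close>, the equation of \<open>u b\<close> is
    applied to \<open>be *s v = mu *s b v - b (b v)\<close>, which visibly lies in the image of
    \<open>b\<close>.\<close>
  have "be *s u (b (u v)) = be *s (lam *s u v - (c * mu) *s v + c *s b v)" for v
  proof -
    have "be *s v = mu *s b v - b (b v)" using bb[of v] by simp
    then have "be *s u (b (u v)) = u (b (u (mu *s b v - b (b v))))"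
      by (simp only: u_scale[symmetric] b_scale[symmetric])
    also have "\<dots> = mu *s (lam *s u (b v) - (c * be) *s v) - (lam *s u (b (b v)) - (c * be) *s b v)"
      by (simp only: u_diff b_diff u_scale b_scale aa')
    also have "\<dots> = be *s (lam *s u v - (c * mu) *s v + c *s b v)"
      by (simp add: bb expand algebra_simps)
    finally show ?thesis .
  qed
  then have ubu: "u (b (u v)) = lam *s u v - (c * mu) *s v + c *s b v" for v
    using scale_left_imp_eq[OF be_nz] by blast
  have bu: "b (u v) = lam *s v - mu *s sigma \<star> v + sigma \<star> b v" for v
  proof -
    have "c *s b (u v) = c *s (lam *s v - mu *s sigma \<star> v + sigma \<star> b v)"
      using arg_cong[OF ubu[of v], of "\<lambda>w. sigma \<star> w"] by (simp add: expand mult.commute)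
    then show ?thesis using scale_left_imp_eq[OF c_nz] by blast
  qed
  have bw: "b (sigma \<star> v) = u (b v) - lam *s v + mu *s sigma \<star> v" for v
  proof -
    have "c *s b (sigma \<star> v) = c *s (u (b v) - lam *s v + mu *s sigma \<star> v)"
      using arg_cong[OF bu[of "sigma \<star> v"], of u] by (simp add: expand mult.commute algebra_simps)
    then show ?thesis using scale_left_imp_eq[OF c_nz] by blast
  qed
  define s where "s v = u (b v) - sigma \<star> b v - lam *s v + mu *s sigma \<star> v" for v
  show ?thesis
  proof (intro exI[of _ s] conjI allI)
    show "s (v + w) = s v + s w" for v w by (simp add: s_def expand algebra_simps)
    show "s (k *s v) = k *s s v" for k v by (simp add: s_def expand mult.commute)
    show "s (u v) = sigma \<star> s v" for v by (simp add: s_def expand bu algebra_simps)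
    show "s (s v) = kappa \<star> v" for v
      by (simp add: s_def expand bu bw bb act_kappa act_A0 act_A1 act_delta algebra_simps)
  qed
qed

lemma semilinear_act:
  assumes "\<And>v w. s (v + w) = s v + s w" "\<And>k v. s (k *s v) = k *s s v" "\<And>v. s (u v) = sigma \<star> s v"
  shows "s (f \<star> v) = star f \<star> s v"
proof (induction f)
  case 0
  have "s 0 = 0" using assms(2)[of 0 0] by simp
  then show ?case by (simp add: act_0 star_0)
next
  case (pCons a f)
  have "star (pCons a f) = [:a:] + sigma * star f" by (simp add: star_def pcompose_pCons)
  then show ?case using pCons by (simp add: act_pCons assms act_add_left act_mult act_const u_0)
qed

text \<open>The equation \<open>delta b = A0 + s\<close> is solved for \<open>b\<close>. As
  \<open>s\<close> anticommutes with \<open>delta\<close>, turns \<open>A0\<close> into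
  \<open>A1\<close>, and \<open>A0 - A1 = mu delta\<close>, it follows that
  \<open>delta\<^sup>2 (b\<^sup>2 - mu b) = A0 A1 - s\<^sup>2\<close>. So the quadratic equation of
  \<open>b\<close> amounts to \<open>s\<^sup>2 = kappa\<close>, which explains the shape of
  \<open>kappa\<close>. The equation of \<open>u b\<close> then results from
  \<open>b u = A0 + sigma b\<close>.\<close>

lemma quotient_of_semilinear:
  assumes s_add: "\<And>v w. s (v + w) = s v + s w" and s_act: "\<And>f v. s (f \<star> v) = star f \<star> s v"
    and ss: "\<And>v. s (s v) = kappa \<star> v"
  shows "\<exists>b. (\<forall>v w. b (v + w) = b v + b w) \<and> (\<forall>k v. b (k *s v) = k *s b v) \<and>
    (\<forall>v. b (b v) = mu *s b v - be *s v) \<and> (\<forall>v. u (b (u (b v))) = lam *s u (b v) - al *s v)"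
proof -
  obtain rho where rho: "rho * delta \<approx> 1" using delta_inverse .
  have rd: "rho \<star> delta \<star> v = v" for v using aeqD[OF rho, of v] by (simp add: act_mult act_1)
  have comm: "f \<star> g \<star> v = g \<star> f \<star> v" for f g v by (simp only: act_mult[symmetric] mult.commute)
  have s_scale: "s (k *s v) = k *s s v" for k v using s_act[of "[:k:]" v] by (simp add: star_const act_const)
  have s_u: "s (u v) = sigma \<star> s v" for v using s_act[of T v] by (simp add: star_T act_X)
  have s_minus: "s (- v) = - s v" for v using s_scale[of "-1" v] by simp
  have s_diff: "s (v - w) = s v - s w" for v w using s_add[of v "- w"] s_minus by simp
  have s_sigma: "s (sigma \<star> v) = u (s v)" for v
    using s_act[of sigma v] aeqD[OF sigma_sigma] by (simp add: act_X)
  have s_delta: "s (delta \<star> v) = - (delta \<star> s v)" for v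
    by (simp add: act_delta s_diff s_u s_sigma)
  \<comment> \<open>No formula for \<open>star rho\<close> is at hand; anticommutation is inherited
    from \<open>delta\<close>, whose inverse \<open>rho\<close> represents.\<close>
  have s_rho: "s (rho \<star> v) = - (rho \<star> s v)" for v
  proof -
    have "rho \<star> s v = rho \<star> s (delta \<star> rho \<star> v)" by (simp only: comm[of delta rho] rd)
    also have "\<dots> = - s (rho \<star> v)" by (simp only: s_delta P.scale_minus_right rd)
    finally show ?thesis by simp
  qed
  have s_A0: "s (A0 \<star> v) = A1 \<star> s v" for v
    using s_act[of A0 v] aeqD[OF star_A0] by simp
  define w where "w v = s v + A0 \<star> v" for v
  define b where "b v = rho \<star> w v" for v
  have w_add: "w (x + y) = w x + w y" for x y by (simp add: w_def s_add act_add_right)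
  have w_scale: "w (k *s x) = k *s w x" for k x by (simp add: w_def s_scale act_scale scale_right_distrib)
  have A01: "A0 \<star> v - A1 \<star> v = mu *s delta \<star> v" for v
    by (simp add: act_A0 act_A1 act_delta scale_right_diff_distrib)
  have key: "A0 \<star> w v - s (w v) = mu *s delta \<star> w v - be *s delta \<star> delta \<star> v" for v
  proof -
    have "A0 \<star> w v - s (w v) = (A0 \<star> s v - A1 \<star> s v) + (A0 \<star> A0 \<star> v - A0 \<star> A1 \<star> v) - be *s delta \<star> delta \<star> v"
      by (simp add: w_def act_add_right s_add ss s_A0 act_kappa)
    also have "A0 \<star> A0 \<star> v - A0 \<star> A1 \<star> v = mu *s delta \<star> A0 \<star> v"
      by (simp only: act_diff_right[symmetric] A01 act_scale comm[of A0 delta])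
    finally show ?thesis by (simp add: A01 w_def act_add_right scale_right_distrib)
  qed
  have bb: "b (b v) = mu *s b v - be *s v" for v
  proof -
    have "b (b v) = rho \<star> rho \<star> (A0 \<star> w v - s (w v))"
      by (simp add: b_def w_def[of "rho \<star> w v"] s_rho comm[of A0 rho] act_diff_right act_add_right)
    also have "\<dots> = mu *s b v - be *s v"
      by (simp only: key act_diff_right act_scale comm[of rho delta] rd b_def)
        (simp add: comm[of delta rho] rd)
    finally show ?thesis .
  qed
  have bu: "b (u v) = A0 \<star> v + sigma \<star> b v" for v
  proof -
    have "w (u v) = sigma \<star> w v + A0 \<star> delta \<star> v"
      by (simp add: w_def s_u act_add_right act_delta act_diff_right comm[of A0 sigma])
    then show ?thesis
      by (simp add: b_def act_add_right comm[of rho sigma] comm[of A0 delta] comm[of rho A0] rd)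
  qed
  show ?thesis
  proof (intro exI[of _ b] conjI allI)
    show "b (x + y) = b x + b y" for x y by (simp add: b_def w_add act_add_right)
    show "b (k *s x) = k *s b x" for k x by (simp add: b_def w_scale act_scale)
    show "b (b v) = mu *s b v - be *s v" for v by (rule bb)
    have "u (b (u (b v))) = lam *s u (b v) - (c * be) *s v" for v
      by (simp add: bu bb u_add u_diff u_scale act_A0 u_sigma act_diff_right act_scale scale_right_diff_distrib algebra_simps)
    then show "u (b (u (b v))) = lam *s u (b v) - al *s v" for v
      by (simp only: al_eq[symmetric])
  qed
qed

text \<open>The images of the generators may be prescribed as soon as they satisfy the conjugated
  relations. \<open>F\<close> chooses coefficients arbitrarily: two choices differ by multiples of
  the \<open>r i\<close>, whose conjugates kill the \<open>z i\<close>.\<close>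

lemma semilinear_extension:
  assumes d: "decomp I x r" and z: "\<And>i. i \<in> I \<Longrightarrow> star (r i) \<star> z i = 0"
  shows "\<exists>s. (\<forall>v w. s (v + w) = s v + s w) \<and> (\<forall>f v. s (f \<star> v) = star f \<star> s v) \<and>
    (\<forall>i\<in>I. s (x i) = z i) \<and> (\<forall>f. s (\<Sum>i\<in>I. f i \<star> x i) = (\<Sum>i\<in>I. star (f i) \<star> z i))"
proof -
  define F where "F v = (SOME f. v = (\<Sum>i\<in>I. f i \<star> x i))" for v
  have F: "v = (\<Sum>i\<in>I. F v i \<star> x i)" for v
    unfolding F_def by (rule someI_ex[OF decomp_gen[OF d]])
  define s where "s v = (\<Sum>i\<in>I. star (F v i) \<star> z i)" for v
  have s: "s (\<Sum>i\<in>I. f i \<star> x i) = (\<Sum>i\<in>I. star (f i) \<star> z i)" for f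
  proof -
    let ?v = "\<Sum>i\<in>I. f i \<star> x i"
    have "(\<Sum>i\<in>I. (f i - F ?v i) \<star> x i) = ?v - (\<Sum>i\<in>I. F ?v i \<star> x i)"
      by (simp add: P.scale_left_diff_distrib sum_subtractf)
    also have "\<dots> = 0" using F[of ?v] by simp
    finally have dvd: "r i dvd f i - F ?v i" if "i \<in> I" for i using that by (rule decomp_dvd[OF d])
    have "star (f i) \<star> z i = star (F ?v i) \<star> z i" if i: "i \<in> I" for i
    proof -
      obtain k where "f i - F ?v i = r i * k" using dvd[OF i] by (blast elim: Rings.dvdE)
      then have "star (f i) - star (F ?v i) = star k * star (r i)"
        by (simp add: star_diff[symmetric] star_mult mult.commute)
      then have "(star (f i) - star (F ?v i)) \<star> z i = 0" by (simp add: act_mult z[OF i] act_zero_right)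
      then show ?thesis by (simp add: P.scale_left_diff_distrib)
    qed
    then show ?thesis unfolding s_def by (simp cong: sum.cong)
  qed
  show ?thesis
  proof (intro exI[of _ s] conjI allI ballI)
    fix v w
    have "v + w = (\<Sum>i\<in>I. (F v i + F w i) \<star> x i)"
      using F[of v] F[of w] by (simp add: act_add_left sum.distrib)
    then have "s (v + w) = (\<Sum>i\<in>I. star (F v i + F w i) \<star> z i)" using s by metis
    then show "s (v + w) = s v + s w" by (simp add: s_def star_add act_add_left sum.distrib)
  next
    fix f v
    have "f \<star> v = (\<Sum>i\<in>I. (f * F v i) \<star> x i)"
      using arg_cong[OF F[of v], of "\<lambda>w. f \<star> w"] by (simp add: P.scale_sum_right act_mult)
    then have "s (f \<star> v) = (\<Sum>i\<in>I. star (f * F v i) \<star> z i)" using s by metis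
    then show "s (f \<star> v) = star f \<star> s v" by (simp add: s_def star_mult act_mult P.scale_sum_right)
  next
    fix i assume i: "i \<in> I"
    note fin = decomp_finite[OF d]
    have "(\<Sum>j\<in>I. (if j = i then 1 else 0) \<star> x j) = (\<Sum>j\<in>I. if j = i then x j else 0)"
      by (rule sum.cong) (auto simp: act_0 act_1)
    also have "\<dots> = x i" using i fin by simp
    finally have "s (x i) = (\<Sum>j\<in>I. star (if j = i then 1 else 0) \<star> z j)" using s by metis
    also have "\<dots> = (\<Sum>j\<in>I. if j = i then z j else 0)"
      by (rule sum.cong) (auto simp: act_0 act_1 star_0 star_1)
    also have "\<dots> = z i" using i fin by simp
    finally show "s (x i) = z i" .
  qed (rule s)
qed

lemma star_K_pow: "star (K b ^ n) \<star> v = 0 \<longleftrightarrow> K (\<not> b) ^ n \<star> v = 0"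
proof -
  define k where "k = al / (if b then y\<^sub>1 else y\<^sub>2)^2"
  have k: "k \<noteq> 0" using al y by (simp add: k_def)
  have "(T * T * star (K b)) ^ n \<approx> (Polynomial.smult k (K (\<not> b))) ^ n"
    unfolding k_def by (rule aeq_power[OF star_K])
  from aeqD[OF this, of v]
  have *: "T ^ (2 * n) \<star> star (K b ^ n) \<star> v = k ^ n *s K (\<not> b) ^ n \<star> v"
    by (simp only: power_mult_distrib power2_eq_square[symmetric] power_mult[symmetric] star_power smult_power
        act_mult act_smult)
  show ?thesis
  proof
    assume "star (K b ^ n) \<star> v = 0"
    then show "K (\<not> b) ^ n \<star> v = 0" using * k by (simp add: act_zero_right)
  next
    assume "K (\<not> b) ^ n \<star> v = 0"
    then have "T ^ (2 * n) \<star> star (K b ^ n) \<star> v = 0" using * by simp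
    then show "star (K b ^ n) \<star> v = 0" by (rule T_pow_inj)
  qed
qed

text \<open>Up to the unit \<open>T * T\<close>, \<open>kappa\<close> is a multiple of
  \<open>K b\<close>, so applying it uses up one factor.\<close>

lemma kappa_K_pow: 
  assumes "K b ^ Suc n \<star> v = 0"
  shows "K b ^ n \<star> kappa \<star> v = 0"
proof (rule T_pow_inj[of 2])
  have "T\<^sup>2 \<star> K b ^ n \<star> kappa \<star> v = K b ^ n \<star> (T * T * kappa) \<star> v"
    by (simp only: act_mult[symmetric] power2_eq_square ac_simps)
  also have "(T * T * kappa) \<star> v = Polynomial.smult be (K True * K False) \<star> v" by (rule aeqD[OF kappa_K])
  also have "K True * K False = K (\<not> b) * K b" by (cases b) (simp_all add: mult.commute)
  also have "K b ^ n \<star> Polynomial.smult be (K (\<not> b) * K b) \<star> v = be *s K (\<not> b) \<star> K b ^ Suc n \<star> v"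
    by (simp add: act_mult[symmetric] act_smult act_scale ac_simps)
  finally show "T\<^sup>2 \<star> K b ^ n \<star> kappa \<star> v = 0" using assms by (simp add: act_zero_right)
qed

text \<open>On each pair, \<open>s\<close> sends the vector with the larger exponent to the other
  one, and the latter to \<open>kappa\<close> times the former. If \<open>b i \<le> a i\<close>, the
  relations to be respected are that \<open>K False ^ a i\<close> kills \<open>y i\<close>, which is
  clear, and that \<open>K True ^ b i\<close> kills \<open>kappa \<star> x i\<close>, which holds by
  \<open>a i \<le> b i + 1\<close>. The other case is symmetric.\<close>

theorem semilinear_of_decomp:
  fixes a b :: "nat \<Rightarrow> nat"
  assumes d: "decomp ({..<n} <+> {..<n}) (case_sum x y) (case_sum (\<lambda>i. K True ^ a i) (\<lambda>i. K False ^ b i))"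
    and ab: "\<And>i. i < n \<Longrightarrow> \<bar>int (a i) - int (b i)\<bar> \<le> 1"
  shows "\<exists>s. (\<forall>v w. s (v + w) = s v + s w) \<and> (\<forall>f v. s (f \<star> v) = star f \<star> s v) \<and>
    (\<forall>v. s (s v) = kappa \<star> v)"
proof -
  let ?I = "{..<n} <+> {..<n}"
  have ann: "K True ^ m \<star> x i = 0" if "i < n" "a i \<le> m" for m i
    using decomp_ann[OF d, of "Inl i"] that by (simp add: InlI le_imp_power_dvd)
  have ann': "K False ^ m \<star> y i = 0" if "i < n" "b i \<le> m" for m i
    using decomp_ann[OF d, of "Inr i"] that by (simp add: InrI le_imp_power_dvd)
  define z where "z = case_sum (\<lambda>i. if b i \<le> a i then y i else kappa \<star> y i)
    (\<lambda>i. if b i \<le> a i then kappa \<star> x i else x i)"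
  have z: "star (case_sum (\<lambda>i. K True ^ a i) (\<lambda>i. K False ^ b i) j) \<star> z j = 0" if j: "j \<in> ?I" for j
  proof (cases j)
    case (Inl i)
    then have i: "i < n" using j by auto
    have "K False ^ a i \<star> kappa \<star> y i = 0" if "\<not> b i \<le> a i"
      by (rule kappa_K_pow, rule ann'[OF i]) (use ab[OF i] that in linarith)
    then show ?thesis using ann'[OF i] by (auto simp: Inl star_K_pow z_def)
  next
    case (Inr i)
    then have i: "i < n" using j by auto
    have "K True ^ b i \<star> kappa \<star> x i = 0" if "b i \<le> a i"
      by (rule kappa_K_pow, rule ann[OF i]) (use ab[OF i] that in linarith)
    then show ?thesis using ann[OF i] by (auto simp: Inr star_K_pow z_def)
  qed
  obtain s where s_add: "\<And>v w. s (v + w) = s v + s w"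
    and s_act: "\<And>f v. s (f \<star> v) = star f \<star> s v" and sx: "\<And>j. j \<in> ?I \<Longrightarrow> s (case_sum x y j) = z j"
    and s_sum: "\<And>f. s (\<Sum>j\<in>?I. f j \<star> case_sum x y j) = (\<Sum>j\<in>?I. star (f j) \<star> z j)"
    using semilinear_extension[OF d z] by blast
  have sz: "s (z j) = kappa \<star> case_sum x y j" if j: "j \<in> ?I" for j
  proof (cases j)
    case (Inl i)
    have "s (x i) = z (Inl i)" "s (y i) = z (Inr i)" using sx[of "Inl i"] sx[of "Inr i"] j Inl by auto
    then show ?thesis using aeqD[OF star_kappa] by (auto simp: z_def s_act Inl split: if_splits)
  next
    case (Inr i)
    have "s (x i) = z (Inl i)" "s (y i) = z (Inr i)" using sx[of "Inl i"] sx[of "Inr i"] j Inr by auto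
    then show ?thesis using aeqD[OF star_kappa] by (auto simp: z_def s_act Inr split: if_splits)
  qed
  have s0: "s 0 = 0" using s_add[of 0 0] by simp
  have s_sum': "s (sum g J) = (\<Sum>j\<in>J. s (g j))" for g and J :: "(nat + nat) set"
    by (induction J rule: infinite_finite_induct) (simp_all add: s0 s_add)
  have "s (s v) = kappa \<star> v" for v
  proof -
    obtain f where f: "v = (\<Sum>j\<in>?I. f j \<star> case_sum x y j)" using decomp_gen[OF d] by blast
    have "s (s v) = (\<Sum>j\<in>?I. star (star (f j)) \<star> s (z j))"
      unfolding f s_sum unfolding s_sum' s_act ..
    also have "\<dots> = (\<Sum>j\<in>?I. kappa \<star> f j \<star> case_sum x y j)"
    proof (rule sum.cong[OF refl])
      fix j assume "j \<in> ?I"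
      then show "star (star (f j)) \<star> s (z j) = kappa \<star> f j \<star> case_sum x y j"
        unfolding sz[OF \<open>j \<in> ?I\<close>] aeqD[OF star_star] by (simp only: act_mult[symmetric] mult.commute)
    qed
    also have "\<dots> = kappa \<star> v" unfolding f P.scale_sum_right ..
    finally show ?thesis .
  qed
  with s_add s_act show ?thesis by blast
qed

end

subsection \<open>Uniserial decomposition\<close>

lemma bij_betw_map_sum:
  assumes "bij_betw f A A'" "bij_betw g B B'"
  shows "bij_betw (map_sum f g) (A <+> B) (A' <+> B')"
proof (rule bij_betw_imageI)
  show "inj_on (map_sum f g) (A <+> B)"
  proof (rule inj_onI)
    note f = bij_betw_imp_inj_on[OF assms(1)] and g = bij_betw_imp_inj_on[OF assms(2)]
    fix i j assume "i \<in> A <+> B" "j \<in> A <+> B" "map_sum f g i = map_sum f g j"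
    then show "i = j" by (auto dest: inj_onD[OF f] inj_onD[OF g])
  qed
  have "map_sum f g ` (A <+> B) = f ` A <+> g ` B"
    by (simp add: Plus_def image_Un image_image)
  then show "map_sum f g ` (A <+> B) = A' <+> B'"
    using assms by (simp add: bij_betw_def)
qed

text \<open>The space is now a module over the skew polynomial ring in which
  \<open>s f = star f s\<close>, with \<open>s\<^sup>2\<close> acting as
  \<open>kappa\<close>.\<close>

locale semilinear = torsion scale Basis u lam al y\<^sub>1 y\<^sub>2 K N
  for scale :: "'a::field \<Rightarrow> 'b::ab_group_add \<Rightarrow> 'b" (infixr "*s" 75) and Basis u lam al y\<^sub>1 y\<^sub>2 K N +
  fixes s :: "'b \<Rightarrow> 'b"
  assumes s_add: "s (v + w) = s v + s w"
    and s_act: "s (f \<star> v) = star f \<star> s v"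
    and s_s: "s (s v) = kappa \<star> v"
begin

lemma s_0: "s 0 = 0" using s_add[of 0 0] by simp

lemma s_pow_add: "(s ^^ k) (v + w) = (s ^^ k) v + (s ^^ k) w"
  by (induction k) (simp_all add: s_add)

lemma s_pow_0: "(s ^^ k) 0 = 0"
  by (induction k) (simp_all add: s_0)

lemma s_pow_sum: "(s ^^ k) (sum g I) = (\<Sum>i\<in>I. (s ^^ k) (g i))"
  by (induction I rule: infinite_finite_induct) (simp_all add: s_pow_0 s_pow_add)

lemma s_pow_act: "(s ^^ k) (f \<star> v) = (star ^^ k) f \<star> (s ^^ k) v"
  by (induction k) (simp_all add: s_act)

lemma s_s_act: "s (s (f \<star> v)) = f \<star> s (s v)"
  by (simp only: s_s act_mult[symmetric] mult.commute)

lemma s_nilpotent: "(s ^^ (2 * N)) v = 0"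
proof -
  have "(s ^^ (2 * n)) v = kappa ^ n \<star> v" for n
    by (induction n) (simp_all add: s_s act_mult act_1)
  moreover have "T ^ (2 * N) \<star> kappa ^ N \<star> v = 0"
  proof -
    have "T ^ (2 * N) * kappa ^ N = (T * T * kappa) ^ N"
      by (simp only: power_mult_distrib power_mult power2_eq_square)
    moreover have "(T * T * kappa) ^ N \<approx> (Polynomial.smult be (K True * K False)) ^ N"
      by (rule aeq_power[OF kappa_K])
    ultimately show ?thesis
      using tors by (simp only: act_mult[symmetric] aeq_def smult_power act_smult) simp
  qed
  then have "kappa ^ N \<star> v = 0" by (rule T_pow_inj)
  ultimately show ?thesis by simp
qed

section \<open>Primary parts and the normal form of a multiple\<close>

definition M :: "bool \<Rightarrow> 'b set" where "M b = {v. K b ^ N \<star> v = 0}"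

lemma M_0: "0 \<in> M b" and M_add: "v \<in> M b \<Longrightarrow> w \<in> M b \<Longrightarrow> v + w \<in> M b"
  by (simp_all add: M_def act_zero_right act_add_right)

lemma M_act: "v \<in> M b \<Longrightarrow> f \<star> v \<in> M b"
  unfolding M_def mem_Collect_eq by (metis act_mult act_zero_right mult.commute)

lemma M_sum: "(\<And>i. i \<in> I \<Longrightarrow> g i \<in> M b) \<Longrightarrow> sum g I \<in> M b"
  by (induction I rule: infinite_finite_induct) (simp_all add: M_0 M_add)

text \<open>On a single primary part it suffices that \<open>g\<close> be prime to the one factor
  \<open>K b\<close>.\<close>

lemma M_unit:
  assumes "\<not> K b dvd g"
  obtains g' where "\<And>v. v \<in> M b \<Longrightarrow> g' \<star> g \<star> v = v"
proof -
  have "coprime g (K b ^ N)"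
    using poly_coprime_power_right irreducible_coprime[OF K_irred assms] by (simp add: coprime_commute)
  then obtain a a' where a: "a * g + a' * K b ^ N = 1" by (rule poly_bezout)
  have "a \<star> g \<star> v = v" if "v \<in> M b" for v
    using arg_cong[OF a, of "\<lambda>f. f \<star> v"] that
    by (simp add: act_add_left act_mult M_def act_zero_right act_1)
  then show ?thesis by (rule that)
qed

lemma M_decompose: obtains v\<^sub>1 v\<^sub>2 where "v = v\<^sub>1 + v\<^sub>2" "v\<^sub>1 \<in> M True" "v\<^sub>2 \<in> M False"
proof -
  obtain a b where ab: "a * K True ^ N + b * K False ^ N = 1"
    by (rule poly_bezout[OF K_coprime_pow[of True N N, unfolded not_True_eq_False]])
  show ?thesis
  proof (rule that)
    show "v = (b * K False ^ N) \<star> v + (a * K True ^ N) \<star> v"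
      by (simp only: act_add_left[symmetric] add.commute[of "b * _"] ab act_1)
    have "K True ^ N * (b * K False ^ N) = b * (K True * K False) ^ N"
      "K False ^ N * (a * K True ^ N) = a * (K True * K False) ^ N"
      by (simp_all only: power_mult_distrib ac_simps)
    then show "(b * K False ^ N) \<star> v \<in> M True" "(a * K True ^ N) \<star> v \<in> M False"
      unfolding M_def mem_Collect_eq act_mult[symmetric]
      by (simp_all only:) (simp_all only: act_mult tors act_zero_right)
  qed
qed

lemma M_disjoint: assumes "v \<in> M True" "v \<in> M False" shows "v = 0"
proof -
  obtain a b where ab: "a * K True ^ N + b * K False ^ N = 1"
    by (rule poly_bezout[OF K_coprime_pow[of True N N, unfolded not_True_eq_False]])
  show ?thesis
    using arg_cong[OF ab, of "\<lambda>f. f \<star> v"] assms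
    by (simp add: act_add_left act_mult M_def act_zero_right act_1)
qed

lemma s_K_pow: "s (K b ^ n \<star> v) = 0 \<longleftrightarrow> K (\<not> b) ^ n \<star> s v = 0"
  by (simp add: s_act star_K_pow)

lemma s_M: "v \<in> M b \<Longrightarrow> s v \<in> M (\<not> b)"
  using s_K_pow[of b N v] by (simp add: M_def s_0)

lemma s_pow_M: "v \<in> M b \<Longrightarrow> (s ^^ k) v \<in> M (b \<noteq> odd k)"
proof (induction k)
  case (Suc k)
  then show ?case using s_M[of "(s ^^ k) v" "b \<noteq> odd k"] by (cases b; cases "odd k") auto
qed simp

text \<open>Up to a unit, \<open>s\<^sup>2 = kappa\<close> is \<open>K b * K (\<not> b)\<close>, and
  on \<open>M b\<close> the factor \<open>K (\<not> b)\<close> is inverted by \<open>e\<close>. This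
  is the sense in which \<open>s\<close> is a square root of \<open>K b\<close> there.\<close>

lemma K_s_s: obtains w where "\<And>v. v \<in> M b \<Longrightarrow> K b \<star> v = w \<star> s (s v)"
proof -
  have "\<not> K b dvd K (\<not> b)"
  proof
    assume "K b dvd K (\<not> b)"
    then have "K b = K (\<not> b)" by (rule monic_irreducible_dvd[OF K_monic K_irred K_monic K_irred])
    then show False using K_neq by (cases b) auto
  qed
  then obtain e where e: "\<And>v. v \<in> M b \<Longrightarrow> e \<star> K (\<not> b) \<star> v = v" using M_unit by blast
  have "K b \<star> v = Polynomial.smult (inverse be) (e * (T * T)) \<star> s (s v)" if "v \<in> M b" for v
  proof -
    have "Polynomial.smult (inverse be) (e * (T * T)) \<star> s (s v) = inverse be *s e \<star> (T * T * kappa) \<star> v"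
      by (simp only: s_s act_smult act_mult)
    also have "(T * T * kappa) \<star> v = Polynomial.smult be (K (\<not> b) * K b) \<star> v"
      unfolding aeqD[OF kappa_K] by (cases b) (simp_all add: mult.commute)
    also have "inverse be *s e \<star> Polynomial.smult be (K (\<not> b) * K b) \<star> v = e \<star> K (\<not> b) \<star> K b \<star> v"
      using be_nz by (simp add: act_smult act_scale act_mult)
    also have "\<dots> = K b \<star> v" using that by (intro e M_act)
    finally show ?thesis ..
  qed
  then show ?thesis by (rule that)
qed

text \<open>As in a discrete valuation ring, as many factors \<open>s\<^sup>2\<close> as possible
  are extracted; nilpotency of \<open>s\<close> bounds their number. The remaining \<open>g\<close>
  is prime to \<open>K b\<close>, for otherwise \<open>K_s_s\<close> would supply one more, and
  hence it is invertible on \<open>x\<close>.\<close>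

lemma act_normal_form:
  assumes x: "x \<in> M b" and nz: "f \<star> x \<noteq> 0"
  obtains e g g' where "f \<star> x = (s ^^ (2 * e)) (g \<star> x)" "g' \<star> g \<star> x = x"
proof -
  define P where "P e \<longleftrightarrow> (\<exists>g. f \<star> x = (s ^^ (2 * e)) (g \<star> x))" for e
  have "P 0" by (auto simp: P_def)
  moreover have "\<not> P N" using nz by (simp add: P_def s_nilpotent)
  ultimately obtain e where e: "P e" "\<not> P (Suc e)"
    using ex_least_nat_less[of "\<lambda>e. \<not> P e" N] by blast
  then obtain g where g: "f \<star> x = (s ^^ (2 * e)) (g \<star> x)" by (auto simp: P_def)
  have "\<not> K b dvd g"
  proof
    assume "K b dvd g"
    then obtain k where k: "g = K b * k" by (blast elim: Rings.dvdE)
    obtain w where w: "\<And>v. v \<in> M b \<Longrightarrow> K b \<star> v = w \<star> s (s v)" using K_s_s[of b] by blast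
    have "g \<star> x = s (s ((w * k) \<star> x))"
      unfolding k act_mult w[OF M_act[OF x]] by (simp only: s_s_act)
    then have "f \<star> x = (s ^^ (2 * Suc e)) ((w * k) \<star> x)"
      unfolding g by (simp add: funpow_swap1)
    with e(2) show False by (auto simp: P_def)
  qed
  then obtain g' where "\<And>v. v \<in> M b \<Longrightarrow> g' \<star> g \<star> v = v" using M_unit by blast
  with g x show ?thesis using that by blast
qed

section \<open>Generators under \<open>u\<close> and \<open>s\<close>, and their
  independence\<close>

definition s_ord :: "'b \<Rightarrow> nat" where "s_ord v = Least (\<lambda>e. (s ^^ e) v = 0)"

lemma s_ord_zero: "(s ^^ s_ord v) v = 0"
  unfolding s_ord_def by (rule LeastI[of "\<lambda>e. (s ^^ e) v = 0", OF s_nilpotent])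

lemma s_ord_le: "(s ^^ e) v = 0 \<Longrightarrow> s_ord v \<le> e"
  unfolding s_ord_def by (rule Least_le)

lemma s_ord_greater: "(s ^^ e) v \<noteq> 0 \<Longrightarrow> e < s_ord v"
  using s_ord_zero[of v] s_pow_0 by (metis comp_apply funpow_add le_add_diff_inverse2 not_less)

text \<open>The submodule generated by \<open>G\<close> under \<open>u\<close> and \<open>s\<close>.
  Since \<open>s\<^sup>2\<close> is a polynomial in \<open>u\<close>, the vectors of
  \<open>G\<close> and their images under \<open>s\<close> already generate it over the
  polynomials.\<close>

definition Rspan :: "'b set \<Rightarrow> 'b set" where "Rspan G = P.span (G \<union> s ` G)"

lemma Rspan_base: "x \<in> G \<Longrightarrow> x \<in> Rspan G"
  unfolding Rspan_def by (rule P.span_base) simp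

lemma Rspan_act: "v \<in> Rspan G \<Longrightarrow> f \<star> v \<in> Rspan G" and Rspan_diff: "v \<in> Rspan G \<Longrightarrow> w \<in> Rspan G \<Longrightarrow> v - w \<in> Rspan G"
  and Rspan_sum: "(\<And>i. i \<in> I \<Longrightarrow> g i \<in> Rspan G) \<Longrightarrow> sum g I \<in> Rspan G"
  unfolding Rspan_def by (fact P.span_scale P.span_diff P.span_sum)+

lemma Rspan_s: "v \<in> Rspan G \<Longrightarrow> s v \<in> Rspan G"
proof -
  assume v: "v \<in> Rspan G"
  have "Rspan G \<subseteq> {v. s v \<in> Rspan G}"
    unfolding Rspan_def[of G]
  proof (rule P.span_minimal)
    show "G \<union> s ` G \<subseteq> {v. s v \<in> P.span (G \<union> s ` G)}"
      by (auto simp: s_s P.span_base P.span_scale[OF P.span_base])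
    show "P.subspace {v. s v \<in> P.span (G \<union> s ` G)}"
      by (rule P.subspaceI) (auto simp: s_0 s_add s_act P.span_zero intro: P.span_add P.span_scale)
  qed
  with v show ?thesis by blast
qed

lemma Rspan_s_pow: "v \<in> Rspan G \<Longrightarrow> (s ^^ k) v \<in> Rspan G"
  by (induction k) (simp_all add: Rspan_s)

lemma Rspan_minimal: "G \<subseteq> Rspan Y \<Longrightarrow> Rspan G \<subseteq> Rspan Y"
  unfolding Rspan_def[of G]
proof (rule P.span_minimal)
  show "G \<union> s ` G \<subseteq> Rspan Y" if "G \<subseteq> Rspan Y" using that Rspan_s by auto
  show "P.subspace (Rspan Y)" by (simp add: Rspan_def P.subspace_span)
qed

text \<open>Each generator lies in one primary part because only there is the normal form of its
  multiples available.\<close>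

definition generators :: "'b set \<Rightarrow> bool" where
  "generators G \<longleftrightarrow> finite G \<and> G \<subseteq> M True \<union> M False \<and> Rspan G = UNIV"

lemma generators_exist: "\<exists>G. generators G"
proof -
  have "\<forall>v. \<exists>v\<^sub>1 v\<^sub>2. v = v\<^sub>1 + v\<^sub>2 \<and> v\<^sub>1 \<in> M True \<and> v\<^sub>2 \<in> M False" using M_decompose by metis
  then obtain p\<^sub>1 p\<^sub>2 where p: "\<And>v. v = p\<^sub>1 v + p\<^sub>2 v" "\<And>v. p\<^sub>1 v \<in> M True" "\<And>v. p\<^sub>2 v \<in> M False" by metis
  let ?G = "p\<^sub>1 ` Basis \<union> p\<^sub>2 ` Basis"
  have "span Basis \<subseteq> Rspan ?G"
  proof (rule span_minimal)
    show "Basis \<subseteq> Rspan ?G"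
    proof
      fix v assume "v \<in> Basis"
      then have "p\<^sub>1 v \<in> Rspan ?G" "p\<^sub>2 v \<in> Rspan ?G" by (auto intro: Rspan_base)
      then have "p\<^sub>1 v + p\<^sub>2 v \<in> Rspan ?G" unfolding Rspan_def by (rule P.span_add)
      then show "v \<in> Rspan ?G" using p(1) by metis
    qed
    show "subspace (Rspan ?G)"
    proof (rule subspaceI)
      fix k v assume "v \<in> Rspan ?G"
      from Rspan_act[OF this, of "[:k:]"] show "k *s v \<in> Rspan ?G" by (simp add: act_const)
    qed (auto simp: Rspan_def P.span_zero intro: P.span_add)
  qed
  then have "Rspan ?G = UNIV" using span_Basis by auto
  then show ?thesis using finite_Basis p(2,3) unfolding generators_def by (intro exI[of _ ?G]) auto
qed

text \<open>A relation in which every term is nonzero can be divided by the smallest power of \<open>s\<close>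
  occurring in it, which yields a replacement generator of smaller order.\<close>

lemma minimal_generators_independent:
  assumes gen: "generators G" and min: "\<And>Y. generators Y \<Longrightarrow> sum s_ord G \<le> sum s_ord Y"
    and t: "\<And>x. x \<in> G \<Longrightarrow> \<exists>b f. x \<in> M b \<and> t x = (if b = q then f \<star> x else f \<star> s x)"
    and sum: "(\<Sum>x\<in>G. t x) = 0" and "x \<in> G"
  shows "t x = 0"
proof (rule ccontr)
  assume "t x \<noteq> 0"
  define Y where "Y = {x \<in> G. t x \<noteq> 0}"
  have fin: "finite G" "finite Y" using gen by (auto simp: generators_def Y_def)
  \<comment> \<open>All terms of the relation lie in \<open>M q\<close>, which is why the parity of
    \<open>e\<close> is tied to the part containing \<open>x\<close>. In the odd case
    \<open>f \<star> s x = s (star f \<star> x)\<close> puts one \<open>s\<close> in front before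
    the normal form is taken.\<close>
  have "\<exists>e b g g'. t x = (s ^^ e) (g \<star> x) \<and> g' \<star> g \<star> x = x \<and> x \<in> M b \<and> q = (b \<noteq> odd e)" if "x \<in> Y" for x
  proof -
    from that have "x \<in> G" "t x \<noteq> 0" by (auto simp: Y_def)
    with t obtain b f where bf: "x \<in> M b" "t x = (if b = q then f \<star> x else f \<star> s x)" by blast
    show ?thesis
    proof (cases "b = q")
      case True
      with bf \<open>t x \<noteq> 0\<close> have "f \<star> x \<noteq> 0" by simp
      with bf(1) obtain e g g' where "f \<star> x = (s ^^ (2 * e)) (g \<star> x)" "g' \<star> g \<star> x = x" by (rule act_normal_form)
      with True bf show ?thesis by (intro exI[of _ "2 * e"] exI[of _ b] exI[of _ g] exI[of _ g']) simp
    next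
      case False
      have "s (star f \<star> x) = t x" using False bf aeqD[OF star_star] by (simp add: s_act)
      then have "star f \<star> x \<noteq> 0" using \<open>t x \<noteq> 0\<close> s_0 by auto
      with bf(1) obtain e g g' where "star f \<star> x = (s ^^ (2 * e)) (g \<star> x)" "g' \<star> g \<star> x = x" by (rule act_normal_form)
      then have "t x = (s ^^ Suc (2 * e)) (g \<star> x)" using \<open>s (star f \<star> x) = t x\<close> by simp
      with False bf \<open>g' \<star> g \<star> x = x\<close> show ?thesis
        by (intro exI[of _ "Suc (2 * e)"] exI[of _ b] exI[of _ g] exI[of _ g']) auto
    qed
  qed
  then obtain e b g g' where e: "\<And>x. x \<in> Y \<Longrightarrow> t x = (s ^^ e x) (g x \<star> x)"
    and g': "\<And>x. x \<in> Y \<Longrightarrow> g' x \<star> g x \<star> x = x" and b: "\<And>x. x \<in> Y \<Longrightarrow> x \<in> M (b x)"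
    and q: "\<And>x. x \<in> Y \<Longrightarrow> q = (b x \<noteq> odd (e x))" by metis
  have "x \<in> Y" using \<open>x \<in> G\<close> \<open>t x \<noteq> 0\<close> by (simp add: Y_def)
  then obtain x\<^sub>0 where x0: "x\<^sub>0 \<in> Y" and le: "\<And>x. x \<in> Y \<Longrightarrow> e x\<^sub>0 \<le> e x"
    using ex_has_least_nat[of "\<lambda>x. x \<in> Y" x e] by blast
  define y where "y = (\<Sum>x\<in>Y. (s ^^ (e x - e x\<^sub>0)) (g x \<star> x))"
  define G' where "G' = insert y (G - {x\<^sub>0})"
  have x0G: "x\<^sub>0 \<in> G" "t x\<^sub>0 \<noteq> 0" using x0 by (auto simp: Y_def)
  have "(s ^^ e x\<^sub>0) y = (\<Sum>x\<in>Y. t x)"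
    unfolding y_def s_pow_sum
  proof (rule sum.cong)
    fix x assume x: "x \<in> Y"
    show "(s ^^ e x\<^sub>0) ((s ^^ (e x - e x\<^sub>0)) (g x \<star> x)) = t x"
      using le[OF x] e[OF x] funpow_add[of "e x\<^sub>0" "e x - e x\<^sub>0" s] by simp
  qed simp
  also have "\<dots> = (\<Sum>x\<in>G. t x)"
    by (rule sum.mono_neutral_left) (use fin in \<open>auto simp: Y_def\<close>)
  finally have "s_ord y \<le> e x\<^sub>0" using sum by (intro s_ord_le) simp
  moreover have "e x\<^sub>0 < s_ord x\<^sub>0"
  proof (rule s_ord_greater)
    show "(s ^^ e x\<^sub>0) x\<^sub>0 \<noteq> 0"
      using e[OF x0] x0G(2) by (auto simp: s_pow_act act_zero_right)
  qed
  ultimately have "s_ord y < s_ord x\<^sub>0" by simp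
  have yM: "y \<in> M (b x\<^sub>0)"
    unfolding y_def
  proof (rule M_sum)
    fix x assume x: "x \<in> Y"
    have "(s ^^ (e x - e x\<^sub>0)) (g x \<star> x) \<in> M (b x \<noteq> odd (e x - e x\<^sub>0))"
      by (rule s_pow_M[OF M_act[OF b[OF x]]])
    \<comment> \<open>Parities agree because all terms of the relation lie in \<open>M q\<close>; so
      the divided relation \<open>y\<close> stays inside one primary part.\<close>
    moreover have "(b x \<noteq> odd (e x - e x\<^sub>0)) = b x\<^sub>0" using q[OF x] q[OF x0] le[OF x] by auto
    ultimately show "(s ^^ (e x - e x\<^sub>0)) (g x \<star> x) \<in> M (b x\<^sub>0)" by simp
  qed
  have "generators G'"
    unfolding generators_def
  proof (intro conjI)
    show "finite G'" using fin by (simp add: G'_def)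
    show "G' \<subseteq> M True \<union> M False"
      using gen yM unfolding generators_def G'_def by (cases "b x\<^sub>0") auto
    have others: "x \<in> Rspan G'" if "x \<in> G" "x \<noteq> x\<^sub>0" for x using that by (auto simp: G'_def intro: Rspan_base)
    \<comment> \<open>In \<open>y\<close> the vector \<open>x\<^sub>0\<close> occurs with exponent 0
      and invertible coefficient \<open>g x\<^sub>0\<close>, so it can be recovered from
      \<open>y\<close> and the other generators.\<close>
    have "g x\<^sub>0 \<star> x\<^sub>0 = y - (\<Sum>x\<in>Y - {x\<^sub>0}. (s ^^ (e x - e x\<^sub>0)) (g x \<star> x))"
      unfolding y_def using x0 fin by (simp add: sum.remove[of Y x\<^sub>0])
    moreover have "y \<in> Rspan G'" by (rule Rspan_base) (simp add: G'_def)
    then have "y - (\<Sum>x\<in>Y - {x\<^sub>0}. (s ^^ (e x - e x\<^sub>0)) (g x \<star> x)) \<in> Rspan G'"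
      by (rule Rspan_diff) (intro Rspan_sum Rspan_s_pow Rspan_act others; auto simp: Y_def)
    ultimately have "g' x\<^sub>0 \<star> g x\<^sub>0 \<star> x\<^sub>0 \<in> Rspan G'" by (simp add: Rspan_act)
    then have "G \<subseteq> Rspan G'" using others g'[OF x0] by auto
    then show "Rspan G' = UNIV" using Rspan_minimal gen unfolding generators_def by blast
  qed
  then have "sum s_ord G \<le> sum s_ord G'" by (rule min)
  \<comment> \<open>Only an inequality, since \<open>y\<close> may already be one of the remaining
    generators.\<close>
  also have "\<dots> \<le> s_ord y + sum s_ord (G - {x\<^sub>0})"
  proof (cases "y \<in> G - {x\<^sub>0}")
    case True
    then have "G' = G - {x\<^sub>0}" unfolding G'_def by (rule insert_absorb)
    then show ?thesis by simp
  next
    case False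
    have "finite (G - {x\<^sub>0})" using fin by simp
    from sum.insert[OF this False, of s_ord] show ?thesis unfolding G'_def by simp
  qed
  also have "\<dots> < s_ord x\<^sub>0 + sum s_ord (G - {x\<^sub>0})" using \<open>s_ord y < s_ord x\<^sub>0\<close> by simp
  also have "\<dots> = sum s_ord G" using x0G fin by (simp add: sum.remove)
  finally show False by simp
qed

definition K_ord :: "bool \<Rightarrow> 'b \<Rightarrow> nat" where "K_ord b v = Least (\<lambda>n. K b ^ n \<star> v = 0)"

lemma K_ord_le: "K b ^ n \<star> v = 0 \<Longrightarrow> K_ord b v \<le> n"
  unfolding K_ord_def by (rule Least_le)

lemma K_ord_zero: "v \<in> M b \<Longrightarrow> K b ^ K_ord b v \<star> v = 0"
  unfolding K_ord_def M_def by (rule LeastI[of "\<lambda>n. K b ^ n \<star> v = 0"]) simp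

text \<open>If \<open>f\<close> contained \<open>K b\<close> only to a power \<open>m\<close> below
  the order of \<open>v\<close>, the cofactor would be invertible on \<open>M b\<close> and
  \<open>K b ^ m\<close> would already kill \<open>v\<close>.\<close>

lemma K_ord_dvd:
  assumes v: "v \<in> M b" and f: "f \<star> v = 0"
  shows "K b ^ K_ord b v dvd f"
proof -
  have "m \<le> K_ord b v \<Longrightarrow> K b ^ m dvd f" for m
  proof (induction m)
    case (Suc m)
    then have "K b ^ m dvd f" by simp
    then obtain k where k: "f = K b ^ m * k" by (blast elim: Rings.dvdE)
    have "K b dvd k"
    proof (rule ccontr)
      assume "\<not> K b dvd k"
      then obtain k' where "\<And>v. v \<in> M b \<Longrightarrow> k' \<star> k \<star> v = v" using M_unit by blast
      then have "K b ^ m \<star> v = k' \<star> k \<star> K b ^ m \<star> v" using M_act[OF v] by simp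
      also have "k \<star> K b ^ m \<star> v = f \<star> v" unfolding k by (simp only: act_mult[symmetric] mult.commute)
      finally have "K_ord b v \<le> m" using f by (intro K_ord_le) (simp add: act_zero_right)
      with Suc show False by simp
    qed
    then show ?case unfolding k by (simp add: mult.commute[of "K b"] mult_dvd_mono)
  qed simp
  then show ?thesis by simp
qed

text \<open>Conjugated relations hold for \<open>s x\<close>, so the order does not grow.
  Conversely, if \<open>K (\<not> b) ^ m\<close> kills \<open>s x\<close>, then \<open>s\<close>
  kills \<open>K b ^ m \<star> x\<close>, and one more factor \<open>K b\<close> is a multiple of
  \<open>s\<^sup>2\<close>.\<close>

lemma K_ord_s:
  assumes x: "x \<in> M b"
  shows "\<bar>int (K_ord b x) - int (K_ord (\<not> b) (s x))\<bar> \<le> 1"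
proof -
  have "K_ord (\<not> b) (s x) \<le> K_ord b x"
    by (rule K_ord_le) (simp add: s_K_pow[symmetric] K_ord_zero[OF x] s_0)
  moreover have "K_ord b x \<le> Suc (K_ord (\<not> b) (s x))"
  proof (rule K_ord_le)
    let ?m = "K_ord (\<not> b) (s x)"
    obtain w where w: "\<And>v. v \<in> M b \<Longrightarrow> K b \<star> v = w \<star> s (s v)" using K_s_s[of b] by blast
    have "s (K b ^ ?m \<star> x) = 0" unfolding s_K_pow by (rule K_ord_zero[OF s_M[OF x]])
    then show "K b ^ Suc ?m \<star> x = 0"
      by (simp add: act_mult w[OF M_act[OF x]] s_0 act_zero_right)
  qed
  ultimately show ?thesis by linarith
qed

text \<open>Generators of least total order are taken. Each contributes itself and its image under
  \<open>s\<close>, one vector in each primary part. A relation among these vectors splits into its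
  two primary components, and each component has the shape to which
  \<open>minimal_generators_independent\<close> applies.\<close>

theorem decomp_exists:
  "\<exists>(n::nat) x y a b. decomp ({..<n} <+> {..<n}) (case_sum x y)
      (case_sum (\<lambda>i. K True ^ a i) (\<lambda>i. K False ^ b i)) \<and> (\<forall>i<n. \<bar>int (a i) - int (b i)\<bar> \<le> 1)"
proof -
  obtain G where gen: "generators G" and min: "\<And>Y. generators Y \<Longrightarrow> sum s_ord G \<le> sum s_ord Y"
    using generators_exist ex_has_least_nat[of generators _ "sum s_ord"] by metis
  have fin: "finite G" and GM: "\<And>x. x \<in> G \<Longrightarrow> x \<notin> M True \<Longrightarrow> x \<in> M False" and RG: "Rspan G = UNIV"
    using gen by (auto simp: generators_def)
  \<comment> \<open>Only 0 lies in both parts; for it the two choices agree.\<close>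
  define x where "x v = (if v \<in> M True then v else s v)" for v
  define y where "y v = (if v \<in> M True then s v else v)" for v
  have xM: "x v \<in> M True" if "v \<in> G" for v using GM[OF that] s_M[of v False] by (simp add: x_def)
  have yM: "y v \<in> M False" if "v \<in> G" for v using GM[OF that] s_M[of v True] by (simp add: y_def)
  define a where "a v = K_ord True (x v)" for v
  define b where "b v = K_ord False (y v)" for v
  have ab: "\<bar>int (a v) - int (b v)\<bar> \<le> 1" if "v \<in> G" for v
    using K_ord_s[of v True] K_ord_s[of v False] GM[OF that] by (auto simp: a_def b_def x_def y_def abs_minus_commute)
  have image: "G \<union> s ` G = case_sum x y ` (G <+> G)"
  proof -
    have "G \<union> s ` G = x ` G \<union> y ` G" by (auto simp: x_def y_def split: if_splits)
    then show ?thesis by (simp add: Plus_def image_Un image_image)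
  qed
  have d: "decomp (G <+> G) (case_sum x y) (case_sum (\<lambda>i. K True ^ a i) (\<lambda>i. K False ^ b i))"
  proof (rule decompI)
    show "finite (G <+> G)" using fin by simp
    show "\<exists>f. v = (\<Sum>i\<in>G <+> G. f i \<star> case_sum x y i)" for v
    proof -
      have "v \<in> P.span (case_sum x y ` (G <+> G))" using RG unfolding Rspan_def image by simp
      then show ?thesis using fin by (subst (asm) P.span_image_finite) auto
    qed
    fix f j assume sum: "(\<Sum>i\<in>G <+> G. f i \<star> case_sum x y i) = 0" and j: "j \<in> G <+> G"
    let ?A = "\<Sum>v\<in>G. f (Inl v) \<star> x v" and ?B = "\<Sum>v\<in>G. f (Inr v) \<star> y v"
    have AB: "?A + ?B = 0" using sum fin by (simp add: sum.Plus)
    have A: "?A \<in> M True" by (intro M_sum M_act xM)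
    have B: "?B \<in> M False" by (intro M_sum M_act yM)
    have "?A = [:-1:] \<star> ?B" using AB by (simp add: act_const add_eq_0_iff2)
    then have A0: "?A = 0" using A M_act[OF B] by (intro M_disjoint) simp_all
    with AB have B0: "?B = 0" by simp
    have "f (Inl v) \<star> x v = 0" if "v \<in> G" for v
      by (rule minimal_generators_independent[OF gen min _ A0 that, where q = True]) (use GM in \<open>auto simp: x_def\<close>)
    moreover have "f (Inr v) \<star> y v = 0" if "v \<in> G" for v
      by (rule minimal_generators_independent[OF gen min _ B0 that, where q = False]) (use GM in \<open>auto simp: y_def\<close>)
    ultimately show "case_sum (\<lambda>i. K True ^ a i) (\<lambda>i. K False ^ b i) j dvd f j"
      using j K_ord_dvd[OF xM] K_ord_dvd[OF yM] by (elim PlusE) (simp_all add: a_def b_def)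
  next
    fix j assume "j \<in> G <+> G"
    then show "case_sum (\<lambda>i. K True ^ a i) (\<lambda>i. K False ^ b i) j \<star> case_sum x y j = 0"
      using K_ord_zero[OF xM] K_ord_zero[OF yM] by (elim PlusE) (simp_all add: a_def b_def)
  qed
  obtain \<phi> where \<phi>: "bij_betw \<phi> {..<card G} G"
    using ex_bij_betw_nat_finite[OF fin] by (auto simp: atLeast0LessThan)
  have "bij_betw (map_sum \<phi> \<phi>) ({..<card G} <+> {..<card G}) (G <+> G)"
    by (rule bij_betw_map_sum[OF \<phi> \<phi>])
  from decomp_reindex[OF d this]
  have "decomp ({..<card G} <+> {..<card G}) (case_sum (x \<circ> \<phi>) (y \<circ> \<phi>))
      (case_sum (\<lambda>i. K True ^ a (\<phi> i)) (\<lambda>i. K False ^ b (\<phi> i)))"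
    by (rule decomp_cong) (auto split: sum.splits)
  moreover have "\<forall>i<card G. \<bar>int (a (\<phi> i)) - int (b (\<phi> i))\<bar> \<le> 1"
    using ab \<phi> by (auto simp: bij_betw_def)
  ultimately show ?thesis
    by (intro exI[of _ "card G"] exI[of _ "x \<circ> \<phi>"] exI[of _ "y \<circ> \<phi>"] exI[of _ "a \<circ> \<phi>"]
        exI[of _ "b \<circ> \<phi>"]) simp
qed

end

subsection \<open>Eigenvalues and the minimal polynomial\<close>

context endo
begin

lemma represented_by_representation:
  assumes "ordered_basis scale bs"
  shows "represented_by scale u bs (mat (length bs) (length bs) (\<lambda>(i, j). representation (set bs) (u (bs ! j)) (bs ! i)))"
proof -
  have bs: "distinct bs" "independent (set bs)" "span (set bs) = UNIV"
    using assms by (simp_all add: ordered_basis_def)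
  have v: "v = (\<Sum>i<length bs. representation (set bs) v (bs ! i) *s bs ! i)" for v
  proof -
    have "v = (\<Sum>b\<in>set bs. representation (set bs) v b *s b)"
      using sum_representation_eq[OF bs(2), of v "set bs"] bs(3) by simp
    also have "\<dots> = (\<Sum>i<length bs. representation (set bs) v (bs ! i) *s bs ! i)"
      by (rule sum.reindex_bij_betw[symmetric])
        (use bs(1) in \<open>auto simp: bij_betw_def inj_on_nth set_conv_nth\<close>)
    finally show ?thesis .
  qed
  have "u (bs ! j) = (\<Sum>i<length bs. mat (length bs) (length bs)
      (\<lambda>(i, j). representation (set bs) (u (bs ! j)) (bs ! i)) $$ (i, j) *s bs ! i)" if "j < length bs" for j
    by (subst v[of "u (bs ! j)"], rule sum.cong) (use that in auto)
  then show ?thesis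
    unfolding represented_by_def using assms by simp
qed

text \<open>An eigenvector of the transpose gives a linear functional \<open>\<phi>\<close> on the
  space itself, with values in the closure, such that \<open>\<phi> (u v) = l * \<phi> v\<close>.
  Hence \<open>f\<close> evaluated at \<open>l\<close> times \<open>\<phi>\<close> is
  \<open>\<phi>\<close> after \<open>f \<star> v\<close>, that is 0, and \<open>\<phi>\<close> is
  not zero; scalars need not be extended.\<close>

lemma eigenvalue_root:
  assumes rep: "represented_by scale u bs A" and ev: "eigenvalue (map_mat to_ac A) l"
    and ann: "\<And>v. f \<star> v = 0"
  shows "poly (map_poly to_ac f) l = 0"
proof -
  define n where "n = length bs"
  have A: "A \<in> carrier_mat n n" and col: "\<And>j. j < n \<Longrightarrow> u (bs ! j) = (\<Sum>i<n. A $$ (i, j) *s bs ! i)"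
    using rep by (auto simp: represented_by_def n_def)
  have bs: "distinct bs" "independent (set bs)" "span (set bs) = UNIV"
    using rep by (simp_all add: represented_by_def ordered_basis_def)
  let ?B = "map_mat to_ac A"
  have B: "?B \<in> carrier_mat n n" using A by simp
  then have Bt: "transpose_mat ?B \<in> carrier_mat n n" by simp
  have "eigenvalue (transpose_mat ?B) l"
    using ev unfolding eigenvalue_root_char_poly[OF B] eigenvalue_root_char_poly[OF Bt]
    by (simp add: char_poly_transpose_mat[OF B])
  then obtain w where "eigenvector (transpose_mat ?B) w l" by (auto simp: eigenvalue_def)
  then have w: "w \<in> carrier_vec n" "w \<noteq> 0\<^sub>v n" "transpose_mat ?B *\<^sub>v w = l \<cdot>\<^sub>v w"
    using A by (auto simp: eigenvector_def)
  have wj: "(\<Sum>i<n. to_ac (A $$ (i, j)) * w $ i) = l * w $ j" if "j < n" for j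
  proof -
    have "(transpose_mat ?B *\<^sub>v w) $ j = (\<Sum>i<n. to_ac (A $$ (i, j)) * w $ i)"
      using that A w(1) by (auto simp: scalar_prod_def atLeast0LessThan intro!: sum.cong)
    then show ?thesis using w that by simp
  qed
  define \<phi> where "\<phi> v = (\<Sum>i<n. to_ac (representation (set bs) v (bs ! i)) * w $ i)" for v
  have \<phi>_add: "\<phi> (v + v') = \<phi> v + \<phi> v'" for v v'
    using representation_add[OF bs(2), of v v'] bs(3)
    by (simp add: \<phi>_def algebra_simps sum.distrib)
  have \<phi>_scale: "\<phi> (k *s v) = to_ac k * \<phi> v" for k v
    using representation_scale[OF bs(2), of v k] bs(3)
    by (simp add: \<phi>_def algebra_simps sum_distrib_left)
  have \<phi>_0: "\<phi> 0 = 0" using \<phi>_scale[of 0 0] by simp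
  have \<phi>_sum: "\<phi> (sum g I) = (\<Sum>i\<in>I. \<phi> (g i))" for g and I :: "nat set"
    by (induction I rule: infinite_finite_induct) (simp_all add: \<phi>_0 \<phi>_add)
  have \<phi>_basis: "\<phi> (bs ! j) = w $ j" if "j < n" for j
  proof -
    have "\<phi> (bs ! j) = (\<Sum>i<n. if i = j then w $ i else 0)"
      unfolding \<phi>_def
    proof (rule sum.cong)
      fix i assume "i \<in> {..<n}"
      then show "to_ac (representation (set bs) (bs ! j) (bs ! i)) * w $ i = (if i = j then w $ i else 0)"
        using that bs(1) representation_basis[OF bs(2), of "bs ! j"]
        by (auto simp: n_def nth_eq_iff_index_eq)
    qed simp
    then show ?thesis using that by simp
  qed
  have \<phi>_u: "\<phi> (u v) = l * \<phi> v" for v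
  proof -
    have "span (set bs) \<subseteq> {v. \<phi> (u v) = l * \<phi> v}"
    proof (rule span_minimal)
      show "set bs \<subseteq> {v. \<phi> (u v) = l * \<phi> v}"
      proof
        fix b assume "b \<in> set bs"
        then obtain j where j: "j < n" "b = bs ! j" by (auto simp: in_set_conv_nth n_def)
        then show "b \<in> {v. \<phi> (u v) = l * \<phi> v}"
          using wj[OF j(1)] by (simp add: col \<phi>_sum \<phi>_scale \<phi>_basis)
      qed
      show "subspace {v. \<phi> (u v) = l * \<phi> v}"
        by (rule subspaceI) (simp_all add: u_0 \<phi>_0 u_add \<phi>_add u_scale \<phi>_scale algebra_simps)
    qed
    with bs(3) show ?thesis by blast
  qed
  have \<phi>_act: "\<phi> (f \<star> v) = poly (map_poly to_ac f) l * \<phi> v" for f v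
    by (induction f) (simp_all add: act_0 \<phi>_0 act_pCons \<phi>_add \<phi>_scale \<phi>_u map_poly_pCons algebra_simps)
  obtain j where "j < n" "w $ j \<noteq> 0" using w(1,2) by (metis eq_vecI carrier_vecD index_zero_vec(1) index_zero_vec(2))
  then show ?thesis using \<phi>_act[of f "bs ! j"] \<phi>_basis ann \<phi>_0 by simp
qed

text \<open>The chain of iterates of \<open>x\<close> is completed to a basis; the matrix is then
  block triangular with the companion matrix of \<open>d\<close> in the upper left corner, and an
  eigenvector of that block is padded by zeros.\<close>

lemma eigenvalue_of_irreducible:
  assumes d: "Factorial_Ring.irreducible d" "Polynomial.lead_coeff d = 1"
    and x: "d \<star> x = 0" "x \<noteq> 0" and l: "poly (map_poly to_ac d) l = 0"
  shows "closure_eigenvalue scale u l"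
proof -
  define n where "n = Polynomial.degree d"
  have ann: "d dvd f" if "f \<star> x = 0" for f
  proof (rule ccontr)
    assume "\<not> d dvd f"
    then obtain a b where "a * d + b * f = 1" using poly_bezout irreducible_coprime[OF d(1)] by metis
    from arg_cong[OF this, of "\<lambda>f. f \<star> x"] show False
      using x that by (simp add: act_add_left act_mult act_zero_right act_1)
  qed
  define xs where "xs = map (\<lambda>j. (u ^^ j) x) [0..<n]"
  have indep: "c j = 0" if "(\<Sum>j<n. c j *s (u ^^ j) x) = 0" "j < n" for c j
  proof -
    let ?p = "\<Sum>j<n. Polynomial.monom (c j) j"
    have "d dvd ?p" by (rule ann) (simp add: act_poly_sum that)
    then have "?p = 0" using degree_poly_sum[where n = n and c = c] dvd_imp_degree_le[of d ?p] by (force simp: n_def)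
    from arg_cong[OF this, of "\<lambda>p. Polynomial.coeff p j"] show ?thesis
      unfolding coeff_poly_sum using that(2) by simp
  qed
  have inj: "inj_on (\<lambda>j. (u ^^ j) x) {..<n}"
  proof (rule inj_onI, rule ccontr)
    fix i j assume ij: "i \<in> {..<n}" "j \<in> {..<n}" "(u ^^ i) x = (u ^^ j) x" "i \<noteq> j"
    with collision_relation[of "{..<n}" i j "\<lambda>j. (u ^^ j) x"] indep show False by auto
  qed
  have xs: "distinct xs" "set xs = (\<lambda>j. (u ^^ j) x) ` {..<n}"
    using inj by (auto simp: xs_def distinct_map atLeast0LessThan)
  have "independent (set xs)"
    unfolding xs(2) independent_image[OF finite_lessThan inj] using indep by blast
  define E where "E = extend_basis (set xs)"
  have E: "set xs \<subseteq> E" "independent E" "span E = UNIV"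
    unfolding E_def using extend_basis_superset independent_extend_basis span_extend_basis
      \<open>independent (set xs)\<close> by simp_all
  then have "finite E" by (intro finiteI_independent)
  then obtain cs where cs: "set cs = E - set xs" "distinct cs" using finite_distinct_list[of "E - set xs"] by blast
  define bs where "bs = xs @ cs"
  have set_bs: "set bs = E" using cs E(1) by (auto simp: bs_def)
  have ob: "ordered_basis scale bs"
    unfolding ordered_basis_def set_bs using xs(1) cs E by (auto simp: bs_def)
  define m where "m = length bs"
  have nm: "n \<le> m" by (simp add: m_def bs_def xs_def)
  have nth: "bs ! j = (u ^^ j) x" if "j < n" for j
    using that by (simp add: bs_def xs_def nth_append)
  let ?rep = "representation E"
  define A where "A = mat m m (\<lambda>(i, j). ?rep (u (bs ! j)) (bs ! i))"
  have rep: "represented_by scale u bs A"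
    using represented_by_representation[OF ob] by (simp add: A_def m_def set_bs)
  have dist: "bs ! i = bs ! j \<longleftrightarrow> i = j" if "i < m" "j < m" for i j
    using that ob by (simp add: ordered_basis_def nth_eq_iff_index_eq m_def)
  have basis: "?rep (bs ! j) (bs ! i) = (if i = j then 1 else 0)" if "i < m" "j < m" for i j
    using that representation_basis[OF E(2), of "bs ! j"] dist set_bs by (auto simp: m_def)
  have n0: "n > 0" using d by (auto simp: n_def irreducible_def elim!: degree_eq_zeroE)
  have lead: "Polynomial.coeff d n = 1" using d by (simp add: n_def)
  have last: "u (bs ! (n - 1)) = (\<Sum>i<n. (- Polynomial.coeff d i) *s bs ! i)"
  proof -
    have "0 = (\<Sum>i\<le>n. Polynomial.coeff d i *s (u ^^ i) x)" using x(1) by (simp add: endo_poly_def n_def)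
    also have "\<dots> = (\<Sum>i<n. Polynomial.coeff d i *s (u ^^ i) x) + (u ^^ n) x"
      by (simp add: lessThan_Suc_atMost[symmetric] lead)
    finally have "(u ^^ n) x = - (\<Sum>i<n. Polynomial.coeff d i *s (u ^^ i) x)"
      by (metis add_eq_0_iff)
    moreover have "u (bs ! (n - 1)) = (u ^^ n) x" using n0 nth[of "n - 1"] by (cases n) simp_all
    ultimately show ?thesis by (simp add: nth sum_negf)
  qed
  have ent: "A $$ (i, j) = (if j = n - 1 then (if i < n then - Polynomial.coeff d i else 0)
      else if i = Suc j then 1 else 0)" if i: "i < m" and j: "j < n" for i j
  proof (cases "j = n - 1")
    case True
    have "?rep (u (bs ! j)) (bs ! i) = (\<Sum>k<n. ?rep ((- Polynomial.coeff d k) *s bs ! k) (bs ! i))"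
      unfolding True last using E by (subst representation_sum) auto
    also have "\<dots> = (\<Sum>k<n. if k = i then - Polynomial.coeff d k else 0)"
      by (rule sum.cong) (use E nm i in \<open>auto simp: representation_scale representation_neg basis simp del: scale_minus_left\<close>)
    also have "\<dots> = (if i < n then - Polynomial.coeff d i else 0)" by simp
    finally show ?thesis using i j nm True by (simp add: A_def)
  next
    case False
    then have "Suc j < n" using j by simp
    then have "u (bs ! j) = bs ! Suc j" using nth[of j] nth[of "Suc j"] by simp
    then show ?thesis using i j nm False \<open>Suc j < n\<close> basis[of i "Suc j"] by (simp add: A_def)
  qed
  let ?d = "map_poly to_ac d"
  \<comment> \<open>The companion block is multiplication by \<open>X\<close> modulo
    \<open>d\<close>. With \<open>d = (X - l) e\<close> one has \<open>X e = l e + d\<close>, so the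
    coefficients of \<open>e\<close> form an eigenvector; \<open>e\<close> is monic of degree
    \<open>n - 1\<close>, hence this vector is nonzero.\<close>
  obtain e where e: "?d = [:- l, 1:] * e" using l by (auto simp: poly_eq_0_iff_dvd elim: Rings.dvdE)
  have coeff_d: "to_ac (Polynomial.coeff d i) = (case i of 0 \<Rightarrow> 0 | Suc k \<Rightarrow> Polynomial.coeff e k) - l * Polynomial.coeff e i" for i
  proof -
    have "to_ac (Polynomial.coeff d i) = Polynomial.coeff ?d i" by (simp add: coeff_map_poly)
    then show ?thesis unfolding e by (simp add: coeff_pCons split: nat.splits)
  qed
  have "Polynomial.degree ?d = n" by (simp add: n_def degree_map_poly)
  moreover have "?d \<noteq> 0" using n0 calculation by auto
  then have "e \<noteq> 0" using e by auto
  then have "Polynomial.degree ([:- l, 1:] * e) = Polynomial.degree [:- l, 1:] + Polynomial.degree e"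
    by (intro degree_mult_eq) simp_all
  ultimately have "n = Suc (Polynomial.degree e)" unfolding e by simp
  then have en: "Polynomial.coeff e i = 0" if "i \<ge> n" for i using that by (simp add: coeff_eq_0)
  have etop: "Polynomial.coeff e (n - 1) = 1"
    using coeff_d[of n] lead n0 en[of n] by (cases n) simp_all
  define w where "w = vec m (Polynomial.coeff e)"
  have w: "w \<in> carrier_vec m" by (simp add: w_def)
  have "map_mat to_ac A *\<^sub>v w = l \<cdot>\<^sub>v w"
  proof (rule eq_vecI)
    fix i assume "i < dim_vec (l \<cdot>\<^sub>v w)"
    then have i: "i < m" by (simp add: w_def)
    have "(map_mat to_ac A *\<^sub>v w) $ i = (\<Sum>j<m. to_ac (A $$ (i, j)) * Polynomial.coeff e j)"
      using i by (simp add: A_def w_def scalar_prod_def atLeast0LessThan)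
    also have "\<dots> = (\<Sum>j<n. to_ac (A $$ (i, j)) * Polynomial.coeff e j)"
      by (rule sum.mono_neutral_right) (use nm en in auto)
    also have "\<dots> = (\<Sum>j<n. (if j = n - 1 then - (if i < n then to_ac (Polynomial.coeff d i) else 0) else 0)
        + (if Suc j = i \<and> i < n then Polynomial.coeff e j else 0))"
      by (rule sum.cong) (use i etop in \<open>auto simp: ent\<close>)
    also have "\<dots> = - (if i < n then to_ac (Polynomial.coeff d i) else 0)
        + (case i of 0 \<Rightarrow> 0 | Suc k \<Rightarrow> if i < n then Polynomial.coeff e k else 0)"
      using n0 by (simp add: sum.distrib split: nat.splits)
    also have "\<dots> = l * Polynomial.coeff e i"
      using en[of i] by (simp add: coeff_d split: nat.splits)
    finally show "(map_mat to_ac A *\<^sub>v w) $ i = (l \<cdot>\<^sub>v w) $ i" using i by (simp add: w_def)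
  qed (simp add: A_def w_def)
  moreover have "w \<noteq> 0\<^sub>v m"
  proof
    assume "w = 0\<^sub>v m"
    then have "w $ (n - 1) = 0" using n0 nm by simp
    then show False using etop n0 nm by (simp add: w_def)
  qed
  ultimately have "eigenvalue (map_mat to_ac A) l"
    unfolding eigenvalue_def eigenvector_def using w by (intro exI[of _ w]) (simp add: A_def)
  with rep show ?thesis unfolding closure_eigenvalue_def by blast
qed

text \<open>One more iterate of a vector than the dimension, and there is a relation, trivially so
  if two iterates coincide. The product of the resulting polynomials over \<open>Basis\<close> kills
  every basis vector.\<close>

lemma annihilator_exists: "\<exists>f. f \<noteq> 0 \<and> (\<forall>v. f \<star> v = 0)"
proof -
  have "\<exists>f. f \<noteq> 0 \<and> f \<star> x = 0" for x
  proof -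
    define n where "n = Suc (dim UNIV)"
    have "\<exists>c. (\<Sum>j<n. c j *s (u ^^ j) x) = 0 \<and> (\<exists>j<n. c j \<noteq> 0)"
    proof (cases "inj_on (\<lambda>j. (u ^^ j) x) {..<n}")
      case True
      have "card ((\<lambda>j. (u ^^ j) x) ` {..<n}) = n" by (simp add: card_image[OF True])
      then have "\<not> independent ((\<lambda>j. (u ^^ j) x) ` {..<n})"
        using independent_card_le_dim[of "(\<lambda>j. (u ^^ j) x) ` {..<n}" UNIV] by (auto simp: n_def)
      then show ?thesis unfolding independent_image[OF finite_lessThan True] by auto
    next
      case False
      then obtain i j where ij: "i < n" "j < n" "(u ^^ i) x = (u ^^ j) x" "i \<noteq> j" by (auto simp: inj_on_def)
      with collision_relation[of "{..<n}" i j "\<lambda>j. (u ^^ j) x"] show ?thesis by auto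
    qed
    then obtain c j where c: "(\<Sum>j<n. c j *s (u ^^ j) x) = 0" "j < n" "c j \<noteq> 0" by blast
    let ?f = "\<Sum>j<n. Polynomial.monom (c j) j"
    have "Polynomial.coeff ?f j \<noteq> 0" unfolding coeff_poly_sum using c by simp
    then have "?f \<noteq> 0" by (metis coeff_0)
    with c(1) show ?thesis by (intro exI[of _ ?f]) (simp add: act_poly_sum)
  qed
  then obtain F where F: "\<And>x. F x \<noteq> 0" "\<And>x. F x \<star> x = 0" by metis
  let ?f = "\<Prod>x\<in>Basis. F x"
  have "?f \<noteq> 0" using F finite_Basis by simp
  have kill: "?f \<star> x = 0" if "x \<in> Basis" for x
  proof -
    have "?f = (\<Prod>x\<in>Basis - {x}. F x) * F x" using that finite_Basis by (simp add: prod.remove mult.commute)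
    then show ?thesis by (simp add: act_mult F act_zero_right)
  qed
  have "span Basis \<subseteq> {v. ?f \<star> v = 0}"
    by (rule span_minimal) (use kill in \<open>auto intro!: subspaceI simp: act_zero_right act_add_right act_scale\<close>)
  then have "?f \<star> v = 0" for v using span_Basis by auto
  with \<open>?f \<noteq> 0\<close> show ?thesis by blast
qed

text \<open>The annihilating polynomials form a nonzero ideal; the definite description denotes its
  monic generator.\<close>

lemma min_poly_dvd_iff: "min_poly scale u dvd f \<longleftrightarrow> (\<forall>v. f \<star> v = 0)"
  and min_poly_monic: "Polynomial.lead_coeff (min_poly scale u) = 1"
proof -
  obtain g where g: "\<And>f. f \<in> {f. \<forall>v. f \<star> v = 0} \<longleftrightarrow> g dvd f"
    by (rule poly_ideal_principal[of "{f. \<forall>v. f \<star> v = 0}"])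
      (auto simp: act_0 act_add_left act_mult act_zero_right)
  obtain f\<^sub>0 where "f\<^sub>0 \<noteq> 0" "\<forall>v. f\<^sub>0 \<star> v = 0" using annihilator_exists by blast
  with g[of f\<^sub>0] have g0: "g \<noteq> 0" by auto
  define m where "m = Polynomial.smult (inverse (Polynomial.lead_coeff g)) g"
  have m: "Polynomial.lead_coeff m = 1" "\<And>f. m dvd f \<longleftrightarrow> (\<forall>v. f \<star> v = 0)"
    using g0 g by (simp_all add: m_def smult_dvd_iff)
  have "min_poly scale u = m"
    unfolding min_poly_def annihilates_def
  proof (rule the_equality)
    show "Polynomial.lead_coeff m = 1 \<and> (\<forall>x. m \<star> x = 0) \<and> (\<forall>f. (\<forall>x. f \<star> x = 0) \<longrightarrow> m dvd f)"
      using m(1) m(2)[of m] m(2) by simp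
  next
    fix m' assume m': "Polynomial.lead_coeff m' = 1 \<and> (\<forall>x. m' \<star> x = 0) \<and> (\<forall>f. (\<forall>x. f \<star> x = 0) \<longrightarrow> m' dvd f)"
    have "m' dvd m" "m dvd m'" using m' m(2)[of m] m(2)[of m'] by simp_all
    with m' m(1) show "m' = m" by (intro monic_dvd_antisym) simp_all
  qed
  with m show "min_poly scale u dvd f \<longleftrightarrow> (\<forall>v. f \<star> v = 0)" "Polynomial.lead_coeff (min_poly scale u) = 1" by simp_all
qed

lemma linear_intro:
  assumes "\<And>v w. f (v + w) = f v + f w" "\<And>k v. f (k *s v) = k *s f v"
  shows "Vector_Spaces.linear scale scale f"
  by unfold_locales (simp_all add: assms)

end

context quad
begin

lemma K_dvd_cases:
  assumes "Factorial_Ring.irreducible d" "Polynomial.lead_coeff d = 1" "d dvd (K True * K False) ^ N"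
  shows "d = K True \<or> d = K False"
proof (rule ccontr)
  assume "\<not> ?thesis"
  then have "\<not> d dvd K b" for b
    using monic_irreducible_dvd[OF assms(2,1) K_monic[of b] K_irred[of b]] by (cases b) metis+
  then have "coprime d ((K True * K False) ^ N)"
    by (intro poly_coprime_power_right poly_coprime_mult_right irreducible_coprime[OF assms(1)])
  then have "d dvd 1" by (rule coprime_common_divisor[OF _ dvd_refl assms(3)])
  with Factorial_Ring.irreducible_not_unit[OF assms(1)] show False by simp
qed

lemma dvd_K_power:
  assumes "f \<noteq> 0" and "\<And>d. Factorial_Ring.irreducible d \<Longrightarrow> Polynomial.lead_coeff d = 1 \<Longrightarrow> d dvd f \<Longrightarrow> d = K True \<or> d = K False"
  shows "\<exists>N. f dvd (K True * K False) ^ N"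
  using assms
proof (induction "Polynomial.degree f" arbitrary: f rule: less_induct)
  case less
  show ?case
  proof (cases "Polynomial.degree f = 0")
    case True
    then have "f dvd 1" using less.prems(1) by (simp add: is_unit_iff_degree)
    then show ?thesis by (intro exI[of _ 0]) simp
  next
    case False
    then have "Polynomial.degree f > 0" by simp
    then obtain d where d: "Factorial_Ring.irreducible d" "Polynomial.lead_coeff d = 1" "d dvd f"
      by (rule irreducible_dvd_cases)
    then obtain g where f: "f = d * g" by (blast elim: Rings.dvdE)
    have dK: "d = K True \<or> d = K False" by (rule less.prems(2)[OF d])
    have "g \<noteq> 0" "d \<noteq> 0" using f less.prems(1) by auto
    moreover have "Polynomial.degree d = 2" using dK K_degree by auto
    ultimately have lt: "Polynomial.degree g < Polynomial.degree f" unfolding f by (simp add: degree_mult_eq)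
    have gd: "e = K True \<or> e = K False" if "Factorial_Ring.irreducible e" "Polynomial.lead_coeff e = 1" "e dvd g" for e
      by (rule less.prems(2)[OF that(1,2)]) (use that(3) in \<open>simp add: f\<close>)
    obtain N where "g dvd (K True * K False) ^ N" using less.hyps[OF lt \<open>g \<noteq> 0\<close> gd] by (rule exE)
    moreover have "d dvd K True * K False" using dK by auto
    ultimately have "f dvd (K True * K False) ^ Suc N" unfolding f by (simp add: mult_dvd_mono)
    then show ?thesis by blast
  qed
qed

end

subsection \<open>Exponents of the invariant factors\<close>

lemma diag_block_mat_concat:
  "diag_block_mat (concat Ass) = diag_block_mat (map diag_block_mat Ass)"
  by (induction Ass) (simp_all add: diag_block_mat_append Let_def)

lemma antimono_arrangement:
  fixes f :: "nat \<Rightarrow> nat"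
  obtains \<sigma> where "bij_betw \<sigma> {..<n} {..<n}" "\<And>i j. i \<le> j \<Longrightarrow> j < n \<Longrightarrow> f (\<sigma> j) \<le> f (\<sigma> i)"
proof -
  \<comment> \<open>Negating the values as integers turns the increasing sort into a decreasing
    one.\<close>
  define xs where "xs = sort_key (\<lambda>i. - int (f i)) [0..<n]"
  have xs: "length xs = n" "set xs = {..<n}" "distinct xs" by (auto simp: xs_def)
  have "sorted (map (\<lambda>i. - int (f i)) xs)" by (simp add: xs_def)
  then have "f (xs ! j) \<le> f (xs ! i)" if "i \<le> j" "j < n" for i j
    using sorted_nth_mono[of "map (\<lambda>i. - int (f i)) xs" i j] that xs by simp
  moreover have "bij_betw ((!) xs) {..<n} {..<n}"
    using xs by (intro bij_betw_nth) auto
  ultimately show ?thesis using that by blast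
qed

text \<open>The number of values that are at least \<open>m\<close> does not depend on the arrangement, and it exceeds
  \<open>k\<close> precisely when the \<open>k\<close>-th largest value is at least \<open>m\<close>.\<close>

lemma arrangement_mono:
  fixes f g :: "nat \<Rightarrow> nat"
  assumes \<sigma>: "bij_betw \<sigma> {..<n} {..<n}" "\<And>i j. i \<le> j \<Longrightarrow> j < n \<Longrightarrow> f (\<sigma> j) \<le> f (\<sigma> i)"
    and \<tau>: "bij_betw \<tau> {..<n} {..<n}" "\<And>i j. i \<le> j \<Longrightarrow> j < n \<Longrightarrow> g (\<tau> j) \<le> g (\<tau> i)"
    and le: "\<And>i. i < n \<Longrightarrow> f i \<le> Suc (g i)" and k: "k < n"
  shows "f (\<sigma> k) \<le> Suc (g (\<tau> k))"
proof (rule ccontr)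
  assume *: "\<not> f (\<sigma> k) \<le> Suc (g (\<tau> k))"
  define m where "m = f (\<sigma> k)"
  have card_perm: "card {i. i < n \<and> P (\<rho> i)} = card {i. i < n \<and> P i}"
    if \<rho>: "bij_betw \<rho> {..<n} {..<n}" for P and \<rho> :: "nat \<Rightarrow> nat"
  proof (rule bij_betw_same_card[of \<rho>])
    show "bij_betw \<rho> {i. i < n \<and> P (\<rho> i)} {i. i < n \<and> P i}"
      unfolding bij_betw_def
    proof
      show "inj_on \<rho> {i. i < n \<and> P (\<rho> i)}"
        using \<rho> by (auto simp: bij_betw_def intro: inj_on_subset)
      have im: "\<rho> ` {..<n} = {..<n}" using \<rho> by (simp add: bij_betw_def)
      show "\<rho> ` {i. i < n \<and> P (\<rho> i)} = {i. i < n \<and> P i}"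
      proof (intro equalityI subsetI)
        fix i assume "i \<in> \<rho> ` {i. i < n \<and> P (\<rho> i)}"
        then show "i \<in> {i. i < n \<and> P i}" using im by auto
      next
        fix i assume i: "i \<in> {i. i < n \<and> P i}"
        then have "i \<in> \<rho> ` {..<n}" unfolding im by simp
        then show "i \<in> \<rho> ` {i. i < n \<and> P (\<rho> i)}" using i by auto
      qed
    qed
  qed
  have "Suc k = card {..k}" by simp
  also have "\<dots> \<le> card {i. i < n \<and> m \<le> f (\<sigma> i)}"
    using k \<sigma>(2)[of _ k] by (intro card_mono) (auto simp: m_def)
  also have "\<dots> = card {i. i < n \<and> m \<le> f i}" by (rule card_perm[OF \<sigma>(1)])
  also have "\<dots> \<le> card {i. i < n \<and> m \<le> Suc (g i)}"
    by (intro card_mono) (auto dest: le)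
  also have "\<dots> = card {i. i < n \<and> m \<le> Suc (g (\<tau> i))}" by (rule card_perm[OF \<tau>(1), symmetric])
  also have "\<dots> \<le> card {..<k}"
  proof (intro card_mono subsetI)
    fix i assume "i \<in> {i. i < n \<and> m \<le> Suc (g (\<tau> i))}"
    then have i: "i < n" "m \<le> Suc (g (\<tau> i))" by simp_all
    have "\<not> k \<le> i"
    proof
      assume "k \<le> i"
      from \<tau>(2)[OF this i(1)] i(2) * show False by (simp add: m_def)
    qed
    then show "i \<in> {..<k}" by simp
  qed simp
  finally show False by simp
qed

context quad
begin

text \<open>The normal form behind all three conditions. The pairs of exponents come in no
  particular order, and pairs of zeros are permitted.\<close>

definition split_form :: bool where
  "split_form \<longleftrightarrow> (\<exists>(n::nat) x y a b. decomp ({..<n} <+> {..<n}) (case_sum x y)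
      (case_sum (\<lambda>i. K True ^ a i) (\<lambda>i. K False ^ b i)) \<and> (\<forall>i<n. \<bar>int (a i) - int (b i)\<bar> \<le> 1))"

lemma K_pow_monic: "Polynomial.lead_coeff (K b ^ n) = 1"
  by (simp add: lead_coeff_power K_monic)

lemma split_form_torsion:
  assumes split_form
  shows "\<exists>N. \<forall>v. ((K True * K False) ^ N) \<star> v = 0"
proof -
  from assms obtain n x y a b where
    d: "decomp ({..<n::nat} <+> {..<n}) (case_sum x y) (case_sum (\<lambda>i. K True ^ a i) (\<lambda>i. K False ^ b i))"
    unfolding split_form_def by blast
  define N where "N = (\<Sum>i<n. a i + b i)"
  have le: "a i + b i \<le> N" if "i < n" for i
    unfolding N_def using that by (intro member_le_sum) auto
  have "((K True * K False) ^ N) \<star> case_sum x y j = 0" if j: "j \<in> {..<n} <+> {..<n}" for j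
  proof -
    have "case_sum (\<lambda>i. K True ^ a i) (\<lambda>i. K False ^ b i) j dvd K True ^ N * K False ^ N"
      using j
    proof (elim PlusE)
      fix i assume i: "i \<in> {..<n}" "j = Inl i"
      then show ?thesis using le[of i] by (simp add: dvd_mult2 le_imp_power_dvd)
    next
      fix i assume i: "i \<in> {..<n}" "j = Inr i"
      then show ?thesis using le[of i] by (simp add: dvd_mult le_imp_power_dvd)
    qed
    then show ?thesis unfolding decomp_ann[OF d j] power_mult_distrib .
  qed
  then have kill: "f \<star> (K True * K False) ^ N \<star> case_sum x y j = 0" if "j \<in> {..<n} <+> {..<n}" for j f
    using that by (simp add: act_zero_right)
  have "((K True * K False) ^ N) \<star> v = 0" for v
  proof -
    obtain f where "v = (\<Sum>j\<in>{..<n} <+> {..<n}. f j \<star> case_sum x y j)" using decomp_gen[OF d] by blast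
    then have "((K True * K False) ^ N) \<star> v = (\<Sum>j\<in>{..<n} <+> {..<n}. f j \<star> (K True * K False) ^ N \<star> case_sum x y j)"
      by (simp only: P.scale_sum_right act_mult[symmetric] mult.commute)
    also have "\<dots> = 0" by (rule sum.neutral) (use kill in blast)
    finally show ?thesis .
  qed
  then show ?thesis by blast
qed

lemma split_form_of_invariant_factors:
  assumes r: "invariant_factors scale u r" and ab: "\<And>k::nat. r k = K True ^ \<alpha> k * K False ^ \<beta> k"
    "\<And>k. \<bar>int (\<alpha> k) - int (\<beta> k)\<bar> \<le> 1"
  shows split_form
proof -
  from r obtain N bs where "represented_by scale u bs (diag_block_mat (map (\<lambda>k. companion_mat (r k)) [0..<N]))"
    and monic: "\<And>k. Polynomial.lead_coeff (r k) = 1" unfolding invariant_factors_def by blast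
  moreover have "(\<exists>bs. represented_by scale u bs (diag_block_mat (map (\<lambda>k. companion_mat (r k)) [0..<N])))
      \<longleftrightarrow> (\<exists>x. decomp (set [0..<N]) x r)"
    by (rule represented_by_decomp) (simp_all add: monic)
  ultimately have "\<exists>x. decomp (set [0..<N]) x r" by metis
  then obtain x where "decomp {..<N} x r" by (auto simp: atLeast0LessThan)
  then have d: "decomp {..<N} x (\<lambda>k. K True ^ \<alpha> k * K False ^ \<beta> k)" by (rule decomp_cong) (simp_all add: ab)
  have "decomp ({..<N} <+> {..<N}) (case_sum (\<lambda>k. K False ^ \<beta> k \<star> x k) (\<lambda>k. K True ^ \<alpha> k \<star> x k))
      (case_sum (\<lambda>k. K True ^ \<alpha> k) (\<lambda>k. K False ^ \<beta> k))"
    by (rule decomp_split[OF d]) (use K_coprime_pow[of True] in simp)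
  with ab(2) show ?thesis unfolding split_form_def by blast
qed

text \<open>The exponents of the two factors are sorted separately, so that the merged polynomials
  form a divisibility chain. This changes which exponents are paired;
  \<open>arrangement_mono\<close>, used in both directions, preserves the bound on the
  differences.\<close>

lemma invariant_factors_of_split_form:
  assumes split_form
  shows "\<exists>r \<alpha> \<beta>. invariant_factors scale u r \<and>
    (\<forall>k::nat. r k = K True ^ \<alpha> k * K False ^ \<beta> k \<and> \<bar>int (\<alpha> k) - int (\<beta> k)\<bar> \<le> 1)"
proof -
  from assms obtain n x y a b where
    d: "decomp ({..<n::nat} <+> {..<n}) (case_sum x y) (case_sum (\<lambda>i. K True ^ a i) (\<lambda>i. K False ^ b i))"
    and ab: "\<And>i. i < n \<Longrightarrow> \<bar>int (a i) - int (b i)\<bar> \<le> 1"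
    unfolding split_form_def by blast
  obtain \<sigma> where \<sigma>: "bij_betw \<sigma> {..<n} {..<n}" "\<And>i j. i \<le> j \<Longrightarrow> j < n \<Longrightarrow> a (\<sigma> j) \<le> a (\<sigma> i)"
    using antimono_arrangement[of n a] by metis
  obtain \<tau> where \<tau>: "bij_betw \<tau> {..<n} {..<n}" "\<And>i j. i \<le> j \<Longrightarrow> j < n \<Longrightarrow> b (\<tau> j) \<le> b (\<tau> i)"
    using antimono_arrangement[of n b] by metis
  define \<alpha> where "\<alpha> k = (if k < n then a (\<sigma> k) else 0)" for k
  define \<beta> where "\<beta> k = (if k < n then b (\<tau> k) else 0)" for k
  define r where "r k = K True ^ \<alpha> k * K False ^ \<beta> k" for k
  have "bij_betw (map_sum \<sigma> \<tau>) ({..<n} <+> {..<n}) ({..<n} <+> {..<n})"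
    by (rule bij_betw_map_sum[OF \<sigma>(1) \<tau>(1)])
  from decomp_reindex[OF d this]
  have "decomp ({..<n} <+> {..<n}) (case_sum (x \<circ> \<sigma>) (y \<circ> \<tau>)) (case_sum (\<lambda>i. K True ^ \<alpha> i) (\<lambda>i. K False ^ \<beta> i))"
    by (rule decomp_cong) (auto simp: \<alpha>_def \<beta>_def)
  from decomp_merge[OF this] have "decomp {..<n} (\<lambda>i. (x \<circ> \<sigma>) i + (y \<circ> \<tau>) i) r"
    unfolding r_def using K_coprime_pow[of True] by simp
  moreover have monic: "Polynomial.lead_coeff (r k) = 1" for k
    unfolding r_def lead_coeff_mult by (simp add: K_pow_monic)
  ultimately obtain bs where bs: "represented_by scale u bs (diag_block_mat (map (\<lambda>k. companion_mat (r k)) [0..<n]))"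
    using represented_by_decomp[of "[0..<n]" r] by (auto simp: atLeast0LessThan)
  have "\<alpha> (Suc k) \<le> \<alpha> k" "\<beta> (Suc k) \<le> \<beta> k" for k
    using \<sigma>(2)[of k "Suc k"] \<tau>(2)[of k "Suc k"] by (auto simp: \<alpha>_def \<beta>_def)
  then have rdvd: "r (Suc k) dvd r k" for k
    unfolding r_def by (intro mult_dvd_mono le_imp_power_dvd)
  have r1: "r k = 1" if "k \<ge> n" for k using that by (simp add: r_def \<alpha>_def \<beta>_def)
  have "invariant_factors scale u r"
    unfolding invariant_factors_def
    by (intro conjI allI exI[of _ n] exI[of _ bs] impI monic rdvd r1 bs)
  moreover have "\<bar>int (\<alpha> k) - int (\<beta> k)\<bar> \<le> 1" for k
  proof (cases "k < n")
    case True
    have "a i \<le> Suc (b i)" "b i \<le> Suc (a i)" if "i < n" for i using ab[OF that] by auto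
    then have "a (\<sigma> k) \<le> Suc (b (\<tau> k))" "b (\<tau> k) \<le> Suc (a (\<sigma> k))"
      using arrangement_mono[of \<sigma> n a \<tau> b k] arrangement_mono[of \<tau> n b \<sigma> a k] \<sigma> \<tau> True by blast+
    then show ?thesis using True by (simp add: \<alpha>_def \<beta>_def)
  qed (simp add: \<alpha>_def \<beta>_def)
  ultimately show ?thesis using r_def by blast
qed

text \<open>The double blocks are flattened into a list of companion matrices indexed by a disjoint
  sum, to which \<open>represented_by_decomp\<close> applies.\<close>

lemma block_list_split_form:
  fixes a b :: "nat \<Rightarrow> nat"
  defines "C \<equiv> (\<lambda>i. diag_block_mat [companion_mat (K True ^ a i), companion_mat (K False ^ b i)])"
  assumes "distinct ks"
  shows "(\<exists>bs. represented_by scale u bs (diag_block_mat (map C ks))) \<longleftrightarrow>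
    (\<exists>x. decomp (set ks <+> set ks) x (case_sum (\<lambda>i. K True ^ a i) (\<lambda>i. K False ^ b i)))"
proof -
  let ?is = "concat (map (\<lambda>i. [Inl i, Inr i]) ks)"
  let ?r = "case_sum (\<lambda>i. K True ^ a i) (\<lambda>i. K False ^ b i)"
  have "map (\<lambda>i. companion_mat (?r i)) ?is =
      concat (map (\<lambda>i. [companion_mat (K True ^ a i), companion_mat (K False ^ b i)]) ks)"
    by (simp add: map_concat o_def)
  then have "diag_block_mat (map C ks) = diag_block_mat (map (\<lambda>i. companion_mat (?r i)) ?is)"
    by (simp only: diag_block_mat_concat C_def map_map o_def)
  moreover have "distinct ?is" using assms(2) by (induction ks) auto
  moreover have "set ?is = set ks <+> set ks" by auto
  moreover have "Polynomial.lead_coeff (?r i) = 1" for i by (cases i) (simp_all add: K_pow_monic)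
  ultimately show ?thesis using represented_by_decomp[of ?is ?r] by simp
qed

definition admissible :: "'a mat \<Rightarrow> bool" where
  "admissible B \<longleftrightarrow> (\<exists>n>0.
    B = diag_block_mat [companion_mat (K True ^ n), companion_mat (K False ^ n)] \<or>
    B = diag_block_mat [companion_mat (K True ^ n), companion_mat (K False ^ (n - 1))] \<or>
    B = diag_block_mat [companion_mat (K True ^ (n - 1)), companion_mat (K False ^ n)])"

text \<open>The number \<open>n\<close> is the larger of the two exponents; its positivity excludes
  only the empty block.\<close>

lemma admissible_iff:
  "admissible B \<longleftrightarrow> (\<exists>a b. B = diag_block_mat [companion_mat (K True ^ a), companion_mat (K False ^ b)] \<and>
      \<bar>int a - int b\<bar> \<le> 1 \<and> a + b > 0)" (is "_ \<longleftrightarrow> (\<exists>a b. ?P a b)")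
proof
  assume "admissible B"
  then obtain n where "n > 0" "?P n n \<or> ?P n (n - 1) \<or> ?P (n - 1) n"
    unfolding admissible_def by (auto simp del: diag_block_mat.simps)
  then show "\<exists>a b. ?P a b" by blast
next
  assume "\<exists>a b. ?P a b"
  then obtain a b where P: "?P a b" by blast
  then consider "b = a" "a > 0" | "b = a - 1" "a > 0" | "a = b - 1" "b > 0" by linarith
  then show "admissible B"
    unfolding admissible_def using P by cases blast+
qed

lemma split_form_iff_blocks:
  "split_form \<longleftrightarrow> (\<exists>bs Bs. represented_by scale u bs (diag_block_mat Bs) \<and> (\<forall>B\<in>set Bs. admissible B))"
proof
  assume split_form
  then obtain n x y a b where
    d: "decomp ({..<n::nat} <+> {..<n}) (case_sum x y) (case_sum (\<lambda>i. K True ^ a i) (\<lambda>i. K False ^ b i))"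
    and ab: "\<And>i. i < n \<Longrightarrow> \<bar>int (a i) - int (b i)\<bar> \<le> 1"
    unfolding split_form_def by blast
  \<comment> \<open>Pairs of zero exponents belong to empty blocks, which are not admissible, so
    they are discarded.\<close>
  let ?ks = "filter (\<lambda>i. a i + b i > 0) [0..<n]"
  let ?C = "\<lambda>i. diag_block_mat [companion_mat (K True ^ a i), companion_mat (K False ^ b i)]"
  have "decomp (set ?ks <+> set ?ks) (case_sum x y) (case_sum (\<lambda>i. K True ^ a i) (\<lambda>i. K False ^ b i))"
    by (rule decomp_remove_trivial[OF d]) (auto intro!: gr0I)
  moreover have "distinct ?ks" by simp
  ultimately obtain bs where "represented_by scale u bs (diag_block_mat (map ?C ?ks))"
    using block_list_split_form[of ?ks a b] by blast
  moreover have "admissible B" if "B \<in> set (map ?C ?ks)" for B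
    using that ab unfolding admissible_iff by (auto simp del: diag_block_mat.simps)
  ultimately show "\<exists>bs Bs. represented_by scale u bs (diag_block_mat Bs) \<and> (\<forall>B\<in>set Bs. admissible B)" by blast
next
  assume "\<exists>bs Bs. represented_by scale u bs (diag_block_mat Bs) \<and> (\<forall>B\<in>set Bs. admissible B)"
  then obtain bs Bs where rep: "represented_by scale u bs (diag_block_mat Bs)" and adm: "\<forall>B\<in>set Bs. admissible B"
    by blast
  define n where "n = length Bs"
  have "\<forall>i. \<exists>a b. i < n \<longrightarrow> Bs ! i = diag_block_mat [companion_mat (K True ^ a), companion_mat (K False ^ b)] \<and>
      \<bar>int a - int b\<bar> \<le> 1"
    using adm nth_mem unfolding n_def admissible_iff by metis
  then obtain a b where ab: "\<And>i. i < n \<Longrightarrow> Bs ! i = diag_block_mat [companion_mat (K True ^ a i), companion_mat (K False ^ b i)]"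
    "\<And>i. i < n \<Longrightarrow> \<bar>int (a i) - int (b i)\<bar> \<le> 1" by metis
  have "Bs = map (\<lambda>i. diag_block_mat [companion_mat (K True ^ a i), companion_mat (K False ^ b i)]) [0..<n]"
    by (rule nth_equalityI) (simp_all add: n_def ab[unfolded n_def] del: diag_block_mat.simps)
  with rep have "\<exists>x. decomp (set [0..<n] <+> set [0..<n]) x (case_sum (\<lambda>i. K True ^ a i) (\<lambda>i. K False ^ b i))"
    using block_list_split_form[of "[0..<n]" a b] by (metis distinct_upt)
  then obtain x where "decomp ({..<n} <+> {..<n}) x (case_sum (\<lambda>i. K True ^ a i) (\<lambda>i. K False ^ b i))"
    by (auto simp: atLeast0LessThan)
  then have "decomp ({..<n} <+> {..<n}) (case_sum (x \<circ> Inl) (x \<circ> Inr)) (case_sum (\<lambda>i. K True ^ a i) (\<lambda>i. K False ^ b i))"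
    by (rule decomp_cong) (auto split: sum.splits)
  with ab(2) show split_form unfolding split_form_def by blast
qed

lemma split_form_iff_invariant_factors:
  "split_form \<longleftrightarrow>
    (\<forall>d. Polynomial.lead_coeff d = 1 \<and> Factorial_Ring.irreducible d \<and> d dvd min_poly scale u
       \<longrightarrow> d \<in> {K True, K False}) \<and>
    (\<exists>r \<alpha> \<beta>. invariant_factors scale u r \<and>
       (\<forall>k::nat. r k = K True ^ \<alpha> k * K False ^ \<beta> k \<and> \<bar>int (\<alpha> k) - int (\<beta> k)\<bar> \<le> 1))" (is "_ \<longleftrightarrow> ?min \<and> ?inv")
proof
  assume S: split_form
  obtain N where "\<forall>v. ((K True * K False) ^ N) \<star> v = 0" using split_form_torsion[OF S] by blast
  then have m: "min_poly scale u dvd (K True * K False) ^ N" by (simp add: min_poly_dvd_iff)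
  have ?min
  proof (intro allI impI)
    fix d assume d: "Polynomial.lead_coeff d = 1 \<and> Factorial_Ring.irreducible d \<and> d dvd min_poly scale u"
    then have "d dvd (K True * K False) ^ N" using m by (metis dvd_trans)
    then show "d \<in> {K True, K False}" using K_dvd_cases[of d N] d by simp
  qed
  with invariant_factors_of_split_form[OF S] show "?min \<and> ?inv" by (rule conjI[rotated])
next
  assume "?min \<and> ?inv"
  then show split_form using split_form_of_invariant_factors by metis
qed

end

subsection \<open>Exceptional quotients\<close>

lemma poly_to_ac_mult:
    "poly (map_poly to_ac (f * g)) x = poly (map_poly to_ac f) x * poly (map_poly to_ac g) x"
  and poly_to_ac_add:
    "poly (map_poly to_ac (f + g)) x = poly (map_poly to_ac f) x + poly (map_poly to_ac g) x"
  and poly_to_ac_1: "poly (map_poly to_ac 1) x = 1"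
proof -
  interpret map_poly_comm_ring_hom "to_ac :: 'a::field \<Rightarrow> 'a alg_closure"
    by unfold_locales simp_all
  show "poly (map_poly to_ac (f * g)) x = poly (map_poly to_ac f) x * poly (map_poly to_ac g) x"
    "poly (map_poly to_ac (f + g)) x = poly (map_poly to_ac f) x + poly (map_poly to_ac g) x"
    "poly (map_poly to_ac 1) x = 1" for f g :: "'a poly" and x
    by (simp_all add: hom_mult hom_add)
qed

context endo
begin

lemma annihilates_quadratic:
  "annihilates scale [:m, - k, 1:] a \<longleftrightarrow> (\<forall>v. a (a v) = k *s a v - m *s v)"
proof -
  have "endo_poly scale [:m, - k, 1:] a v = m *s v - k *s a v + a (a v)" for v
    by (simp add: endo_poly_def numeral_2_eq_2)
  moreover have "m *s v - k *s a v + a (a v) = 0 \<longleftrightarrow> a (a v) = k *s a v - m *s v" for v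
    by (auto simp: add_eq_0_iff algebra_simps)
  ultimately show ?thesis by (simp add: annihilates_def)
qed

text \<open>From \<open>a (k - a) = m\<close> the inverse \<open>m\<^sup>-\<^sup>1 (k - a)\<close>
  can be read off.\<close>

lemma automorphism_quadratic:
  assumes add: "\<And>v w. a (v + w) = a v + a w" and scale: "\<And>k v. a (k *s v) = k *s a v"
    and quad: "\<And>v. a (a v) = k *s a v - m *s v" and m: "m \<noteq> 0"
  shows "automorphism scale a"
proof -
  have minus: "a (v - w) = a v - a w" for v w
    using add[of v "- w"] scale[of "-1" w] by simp
  have "inj a"
  proof (rule injI)
    fix v w assume "a v = a w"
    then have 0: "a (v - w) = 0" by (simp add: minus)
    then have "m *s (v - w) = 0" using quad[of "v - w"] scale[of 0 0] by simp
    then show "v = w" using m by simp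
  qed
  moreover have "a (inverse m *s (k *s v - a v)) = v" for v
    using quad[of v] m by (simp add: scale minus)
  then have "surj a" by (rule surjI)
  ultimately show ?thesis
    unfolding automorphism_def bij_def using linear_intro[of a] add scale by blast
qed

end

context quad
begin

lemma Root_iff: "l \<in> Root [:al, - lam, 1:] \<longleftrightarrow> l * l = to_ac lam * l - to_ac al"
  by (auto simp: Root_def map_poly_pCons algebra_simps add_eq_0_iff)

lemma Root_split: "Root ([:- y\<^sub>1, 1:] * [:- y\<^sub>2, 1:]) = {to_ac y\<^sub>1, to_ac y\<^sub>2}"
  by (auto simp: Root_def poly_to_ac_mult map_poly_pCons simp del: mult_pCons_left mult_pCons_right)

lemma K_root_iff:
  "poly (map_poly to_ac (K b)) l = 0 \<longleftrightarrow> to_ac (if b then y\<^sub>1 else y\<^sub>2) * l \<in> Root [:al, - lam, 1:]"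
proof -
  define d where "d = (if b then y\<^sub>1 else y\<^sub>2)"
  have d: "to_ac d \<noteq> 0" using y by (simp add: d_def)
  have "K b = [:al / d^2, - lam / d, 1:]" by (simp add: K_True K_False d_def)
  then have "poly (map_poly to_ac (K b)) l = to_ac al / (to_ac d)^2 + l * (- to_ac lam / to_ac d + l)"
    by (simp add: map_poly_pCons)
  also have "\<dots> = 0 \<longleftrightarrow> to_ac d * l * (to_ac d * l) = to_ac lam * (to_ac d * l) - to_ac al"
    using d by (simp add: field_simps power2_eq_square)
  finally show ?thesis by (simp add: Root_iff d_def)
qed

lemma exceptional_values:
  "l \<in> {x * inverse y | x y. x \<in> Root [:al, - lam, 1:] \<and> y \<in> Root ([:- y\<^sub>1, 1:] * [:- y\<^sub>2, 1:])} \<longleftrightarrow>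
    (\<exists>b. poly (map_poly to_ac (K b)) l = 0)"
proof -
  have eq: "l = x * inverse z \<longleftrightarrow> x = z * l" if "z \<noteq> 0" for x z :: "'a alg_closure"
    using that by (auto simp: field_simps)
  have "l \<in> {x * inverse y | x y. x \<in> Root [:al, - lam, 1:] \<and> y \<in> Root ([:- y\<^sub>1, 1:] * [:- y\<^sub>2, 1:])} \<longleftrightarrow>
      to_ac y\<^sub>1 * l \<in> Root [:al, - lam, 1:] \<or> to_ac y\<^sub>2 * l \<in> Root [:al, - lam, 1:]" (is "?l \<longleftrightarrow> ?r")
  proof
    assume ?l
    then obtain x z where "l = x * inverse z" "x \<in> Root [:al, - lam, 1:]" "z = to_ac y\<^sub>1 \<or> z = to_ac y\<^sub>2"
      unfolding Root_split by blast
    moreover from this have "x = z * l" using eq[of z x] y by auto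
    ultimately show ?r by metis
  next
    have "l = (to_ac y\<^sub>1 * l) * inverse (to_ac y\<^sub>1)" "l = (to_ac y\<^sub>2 * l) * inverse (to_ac y\<^sub>2)"
      using eq[of "to_ac y\<^sub>1" "to_ac y\<^sub>1 * l"] eq[of "to_ac y\<^sub>2" "to_ac y\<^sub>2 * l"] y by simp_all
    moreover assume ?r
    ultimately show ?l unfolding Root_split by blast
  qed
  also have "\<dots> \<longleftrightarrow> (\<exists>b. poly (map_poly to_ac (K b)) l = 0)"
    unfolding K_root_iff by (metis (full_types))
  finally show ?thesis .
qed

text \<open>A root of an irreducible divisor \<open>d\<close> of the minimal polynomial is an
  eigenvalue; under exceptionality it is shared with some \<open>K b\<close>, so \<open>d\<close>
  and \<open>K b\<close> are not coprime and coincide. Conversely, every eigenvalue is a root of an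
  annihilating power of \<open>K True * K False\<close>.\<close>

lemma exceptional_iff_torsion:
  "q_exceptional scale [:al, - lam, 1:] ([:- y\<^sub>1, 1:] * [:- y\<^sub>2, 1:]) u \<longleftrightarrow>
    (\<exists>N. \<forall>v. ((K True * K False) ^ N) \<star> v = 0)"
proof
  assume ex: "q_exceptional scale [:al, - lam, 1:] ([:- y\<^sub>1, 1:] * [:- y\<^sub>2, 1:]) u"
  let ?m = "min_poly scale u"
  have m0: "?m \<noteq> 0" using min_poly_monic by auto
  have "d = K True \<or> d = K False"
    if d: "Factorial_Ring.irreducible d" "Polynomial.lead_coeff d = 1" "d dvd ?m" for d
  proof -
    obtain k where k: "?m = d * k" using d(3) by (blast elim: Rings.dvdE)
    have unit: "\<not> d dvd 1" using d(1) by (rule Factorial_Ring.irreducible_not_unit)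
    \<comment> \<open>The cofactor of \<open>d\<close> does not annihilate the space, so some
      \<open>k \<star> x\<close> is a nonzero vector killed by \<open>d\<close>.\<close>
    have "\<not> ?m dvd k"
    proof
      assume "?m dvd k"
      then obtain j where "k = ?m * j" by (blast elim: Rings.dvdE)
      then have "?m * (d * j) = ?m * 1" using k by (metis mult.left_commute mult.right_neutral)
      then have "d * j = 1" using m0 by (metis mult_cancel_left)
      then have "d dvd 1" by (metis dvd_triv_left)
      with unit show False by simp
    qed
    then obtain x where x: "k \<star> x \<noteq> 0" by (auto simp: min_poly_dvd_iff)
    have "d \<star> k \<star> x = 0"
      using min_poly_dvd_iff[of ?m] by (simp add: act_mult[symmetric] k[symmetric])
    have "Polynomial.degree d > 0"
    proof (rule ccontr)
      assume "\<not> ?thesis"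
      moreover have "d \<noteq> 0" using d(2) by auto
      ultimately have "d dvd 1" by (simp add: is_unit_iff_degree)
      with unit show False by simp
    qed
    then have "Polynomial.degree (map_poly to_ac d) > 0" by (simp add: degree_map_poly)
    then obtain l where l: "poly (map_poly to_ac d) l = 0" using alg_closed_imp_poly_has_root by blast
    have "closure_eigenvalue scale u l"
      by (rule eigenvalue_of_irreducible[OF d(1,2) \<open>d \<star> k \<star> x = 0\<close> x l])
    then obtain b where b: "poly (map_poly to_ac (K b)) l = 0"
      using ex unfolding q_exceptional_def exceptional_values by blast
    have "d dvd K b"
    proof (rule ccontr)
      assume "\<not> d dvd K b"
      then obtain f g where "f * d + g * K b = 1" using poly_bezout irreducible_coprime[OF d(1)] by metis
      from arg_cong[OF this, of "\<lambda>f. poly (map_poly to_ac f) l"] show False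
        by (simp add: poly_to_ac_add poly_to_ac_mult poly_to_ac_1 l b)
    qed
    then have "d = K b" by (rule monic_irreducible_dvd[OF d(2,1) K_monic K_irred])
    then show ?thesis by (cases b) auto
  qed
  then obtain N where "?m dvd (K True * K False) ^ N" using dvd_K_power[OF m0] by metis
  then show "\<exists>N. \<forall>v. ((K True * K False) ^ N) \<star> v = 0" unfolding min_poly_dvd_iff by (rule exI)
next
  assume "\<exists>N. \<forall>v. ((K True * K False) ^ N) \<star> v = 0"
  then obtain N where N: "\<And>v. ((K True * K False) ^ N) \<star> v = 0" by blast
  have pow: "poly (map_poly to_ac (f ^ n)) l = poly (map_poly to_ac f) l ^ n" for f l n
    by (induction n) (simp_all add: poly_to_ac_1 poly_to_ac_mult)
  show "q_exceptional scale [:al, - lam, 1:] ([:- y\<^sub>1, 1:] * [:- y\<^sub>2, 1:]) u"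
    unfolding q_exceptional_def exceptional_values
  proof (intro allI impI)
    fix l assume "closure_eigenvalue scale u l"
    then obtain bs A where "represented_by scale u bs A" "eigenvalue (map_mat to_ac A) l"
      unfolding closure_eigenvalue_def by blast
    from eigenvalue_root[OF this N] have "poly (map_poly to_ac (K True)) l = 0 \<or> poly (map_poly to_ac (K False)) l = 0"
      by (auto simp: pow poly_to_ac_mult)
    then show "\<exists>b. poly (map_poly to_ac (K b)) l = 0" by blast
  qed
qed

lemma split_q: "[:- y\<^sub>1, 1:] * [:- y\<^sub>2, 1:] = [:be, - mu, 1:]"
  by (simp add: be_def mu_def)

theorem exceptional_quotient_iff_split_form:
  "pq_quotient scale [:al, - lam, 1:] ([:- y\<^sub>1, 1:] * [:- y\<^sub>2, 1:]) u \<and>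
    q_exceptional scale [:al, - lam, 1:] ([:- y\<^sub>1, 1:] * [:- y\<^sub>2, 1:]) u \<longleftrightarrow> split_form"
proof
  assume *: "pq_quotient scale [:al, - lam, 1:] ([:- y\<^sub>1, 1:] * [:- y\<^sub>2, 1:]) u \<and>
    q_exceptional scale [:al, - lam, 1:] ([:- y\<^sub>1, 1:] * [:- y\<^sub>2, 1:]) u"
  then obtain N where N: "\<And>v. ((K True * K False) ^ N) \<star> v = 0" unfolding exceptional_iff_torsion by blast
  interpret torsion scale Basis u lam al y\<^sub>1 y\<^sub>2 K N by unfold_locales (rule N)
  from * obtain a b where ab: "automorphism scale a" "automorphism scale b" "u = a \<circ> inv_into UNIV b"
    and aa: "\<And>v. a (a v) = lam *s a v - al *s v" and bb: "\<And>v. b (b v) = mu *s b v - be *s v"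
    unfolding pq_quotient_def split_q annihilates_quadratic by blast
  interpret b: Vector_Spaces.linear scale scale b using ab(2) by (simp add: automorphism_def)
  have ub: "u (b v) = a v" for v using ab by (simp add: automorphism_def bij_def)
  have ubub: "u (b (u (b v))) = lam *s u (b v) - al *s v" for v by (simp add: ub aa)
  obtain s where s: "\<And>v w. s (v + w) = s v + s w" "\<And>k v. s (k *s v) = k *s s v"
    "\<And>v. s (u v) = sigma \<star> s v" "\<And>v. s (s v) = kappa \<star> v"
    using semilinear_of_quotient[OF b.add b.scale bb ubub] by blast
  interpret semilinear scale Basis u lam al y\<^sub>1 y\<^sub>2 K N s
    by unfold_locales (use s semilinear_act[OF s(1,2,3)] in auto)
  show split_form unfolding split_form_def by (rule decomp_exists)
next
  assume S: split_form
  then obtain N where N: "\<And>v. ((K True * K False) ^ N) \<star> v = 0" using split_form_torsion by blast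
  interpret torsion scale Basis u lam al y\<^sub>1 y\<^sub>2 K N by unfold_locales (rule N)
  from S obtain n x y a b where
    d: "decomp ({..<n::nat} <+> {..<n}) (case_sum x y) (case_sum (\<lambda>i. K True ^ a i) (\<lambda>i. K False ^ b i))"
    and ab: "\<And>i. i < n \<Longrightarrow> \<bar>int (a i) - int (b i)\<bar> \<le> 1"
    unfolding split_form_def by blast
  obtain s where s: "\<And>v w. s (v + w) = s v + s w" "\<And>f v. s (f \<star> v) = star f \<star> s v"
    "\<And>v. s (s v) = kappa \<star> v"
    using semilinear_of_decomp[OF d ab] by blast
  obtain c where c: "\<And>v w. c (v + w) = c v + c w" "\<And>k v. c (k *s v) = k *s c v"
    "\<And>v. c (c v) = mu *s c v - be *s v" "\<And>v. u (c (u (c v))) = lam *s u (c v) - al *s v"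
    using quotient_of_semilinear[OF s] by blast
  have c_auto: "automorphism scale c" by (rule automorphism_quadratic[OF c(1-3) be_nz])
  have "automorphism scale (u \<circ> c)"
    by (rule automorphism_quadratic[where k = lam, OF _ _ _ al]) (simp_all add: c u_add u_scale)
  moreover have "u = (u \<circ> c) \<circ> inv_into UNIV c"
    using c_auto by (auto simp: automorphism_def bij_def surj_f_inv_f fun_eq_iff)
  moreover have "annihilates scale [:al, - lam, 1:] (u \<circ> c)" "annihilates scale [:be, - mu, 1:] c"
    unfolding annihilates_quadratic by (simp_all add: c)
  ultimately have "pq_quotient scale [:al, - lam, 1:] ([:- y\<^sub>1, 1:] * [:- y\<^sub>2, 1:]) u"
    unfolding pq_quotient_def split_q using c_auto by blast
  moreover have "\<exists>N. \<forall>v. ((K True * K False) ^ N) \<star> v = 0" using N by blast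
  ultimately show "pq_quotient scale [:al, - lam, 1:] ([:- y\<^sub>1, 1:] * [:- y\<^sub>2, 1:]) u \<and>
    q_exceptional scale [:al, - lam, 1:] ([:- y\<^sub>1, 1:] * [:- y\<^sub>2, 1:]) u"
    unfolding exceptional_iff_torsion by blast
qed

end

section \<open>The substitution \<open>H\<close> and the final translation to \<open>p\<close> and
  \<open>q\<close>\<close>

lemma H_quadratic: "d \<noteq> 0 \<Longrightarrow> H d [:m, - k, 1:] = [:m / d^2, - k / d, 1:]"
  by (simp add: H_def pcompose_pCons field_simps power2_eq_square)

text \<open>The map \<open>c\<close> undoes \<open>H d\<close> and preserves degrees, so a
  factorization of \<open>H d p\<close> becomes one of \<open>p\<close> with factors of the same
  degrees.\<close>

lemma irreducible_H:
  assumes p: "Factorial_Ring.irreducible p" and d: "d \<noteq> 0"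
  shows "Factorial_Ring.irreducible (H d p)"
proof (rule Factorial_Ring.irreducibleI)
  define c where "c f = Polynomial.smult (d ^ 2) (pcompose f [:0, inverse d:])" for f
  have cH: "c (H d p) = p"
    using d by (simp add: c_def H_def pcompose_smult pcompose_assoc[symmetric] pcompose_pCons)
  show "H d p \<noteq> 0" using p cH by (auto simp: c_def)
  have degree: "Polynomial.degree (pcompose f [:0, inverse d:]) = Polynomial.degree f" for f
    using d by (simp add: degree_pcompose)
  show "\<not> H d p dvd 1"
  proof
    assume "H d p dvd 1"
    then have "Polynomial.degree (H d p) = 0" by (simp add: poly_dvd_1)
    then have "Polynomial.degree p = 0" using cH degree[of "H d p"] d by (metis c_def degree_smult_eq power_not_zero)
    moreover have "p \<noteq> 0" using p by auto
    ultimately have "p dvd 1" by (simp add: is_unit_iff_degree)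
    with Factorial_Ring.irreducible_not_unit[OF p] show False by simp
  qed
  fix f g assume fg: "H d p = f * g"
  then have ne: "f \<noteq> 0" "g \<noteq> 0" using \<open>H d p \<noteq> 0\<close> by auto
  have "p = c (H d p)" by (rule cH[symmetric])
  also have "\<dots> = c f * pcompose g [:0, inverse d:]" unfolding fg by (simp add: c_def pcompose_mult)
  finally have "p = c f * pcompose g [:0, inverse d:]" .
  from Factorial_Ring.irreducibleD[OF p this] have "Polynomial.degree f = 0 \<or> Polynomial.degree g = 0"
    using degree[of f] degree[of g] d by (auto simp: poly_dvd_1 c_def)
  then show "f dvd 1 \<or> g dvd 1" using ne by (auto simp: is_unit_iff_degree)
qed

theorem theorem4p22:
  fixes scale :: "'a::field \<Rightarrow> 'b::ab_group_add \<Rightarrow> 'b"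
    and Basis :: "'b set"
    and p q :: "'a poly"
    and y\<^sub>1 y\<^sub>2 :: 'a
    and u :: "'b \<Rightarrow> 'b"
  assumes V: "finite_dimensional_vector_space scale Basis"
    and u: "Vector_Spaces.linear scale scale u"
    and p: "Polynomial.lead_coeff p = 1" "Polynomial.degree p = 2"
    and q: "Polynomial.lead_coeff q = 1" "Polynomial.degree q = 2"
    and pq0: "poly p 0 * poly q 0 \<noteq> 0"
    and p_irred: "Factorial_Ring.irreducible p"
    and q_split: "q = [:- y\<^sub>1, 1:] * [:- y\<^sub>2, 1:]" "y\<^sub>1 \<noteq> y\<^sub>2"
    and tr: "(poly_tr p, poly_tr q) \<noteq> (0, 0)"
  defines "cond_i \<equiv> pq_quotient scale p q u \<and> q_exceptional scale p q u"
    and "cond_ii \<equiv>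
      (\<forall>d. Polynomial.lead_coeff d = 1 \<and> Factorial_Ring.irreducible d \<and> d dvd min_poly scale u
         \<longrightarrow> d \<in> {H y\<^sub>1 p, H y\<^sub>2 p}) \<and>
      (\<exists>r \<alpha> \<beta>. invariant_factors scale u r \<and>
         (\<forall>k::nat. r k = H y\<^sub>1 p ^ \<alpha> k * H y\<^sub>2 p ^ \<beta> k \<and> \<bar>int (\<alpha> k) - int (\<beta> k)\<bar> \<le> 1))"
    and "cond_iii \<equiv>
      (\<exists>bs Bs. represented_by scale u bs (diag_block_mat Bs) \<and>
         (\<forall>B\<in>set Bs. \<exists>n>0.
            B = diag_block_mat [companion_mat (H y\<^sub>1 p ^ n), companion_mat (H y\<^sub>2 p ^ n)] \<or>
            B = diag_block_mat [companion_mat (H y\<^sub>1 p ^ n), companion_mat (H y\<^sub>2 p ^ (n - 1))] \<or>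
            B = diag_block_mat [companion_mat (H y\<^sub>1 p ^ (n - 1)), companion_mat (H y\<^sub>2 p ^ n)]))"
  shows "(cond_i \<longleftrightarrow> cond_ii) \<and> (cond_ii \<longleftrightarrow> cond_iii)"
proof -
  define lam al where "lam = poly_tr p" and "al = Polynomial.coeff p 0"
  have p_eq: "p = [:al, - lam, 1:]"
  proof (rule poly_eqI)
    fix i :: nat
    consider "i = 0" | "i = 1" | "i = 2" | "i > 2" by linarith
    then show "Polynomial.coeff p i = Polynomial.coeff [:al, - lam, 1:] i"
      using p by cases (simp_all add: lam_def al_def poly_tr_def coeff_eq_0 numeral_2_eq_2 coeff_pCons split: nat.splits)
  qed
  have nz: "al \<noteq> 0" "y\<^sub>1 \<noteq> 0" "y\<^sub>2 \<noteq> 0"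
    using pq0 by (auto simp: q_split(1) p_eq)
  define K where "K b = H (if b then y\<^sub>1 else y\<^sub>2) p" for b
  have K_eq: "K True = [:al / y\<^sub>1^2, - lam / y\<^sub>1, 1:]" "K False = [:al / y\<^sub>2^2, - lam / y\<^sub>2, 1:]"
    using nz by (simp_all add: K_def p_eq H_quadratic)
  \<comment> \<open>Equal linear coefficients and \<open>y\<^sub>1 \<noteq> y\<^sub>2\<close> give
    \<open>lam = 0\<close>; equal constant ones give
    \<open>y\<^sub>1\<^sup>2 = y\<^sub>2\<^sup>2\<close>, hence
    \<open>y\<^sub>1 + y\<^sub>2 = 0\<close>. Both traces would vanish.\<close>
  have "K True \<noteq> K False"
  proof
    assume "K True = K False"
    then have eqs: "al / y\<^sub>1^2 = al / y\<^sub>2^2" "lam / y\<^sub>1 = lam / y\<^sub>2" unfolding K_eq by simp_all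
    then have "lam * (y\<^sub>1 - y\<^sub>2) = 0" using nz by (simp add: field_simps)
    then have "lam = 0" using q_split(2) by simp
    have "(y\<^sub>1 - y\<^sub>2) * (y\<^sub>1 + y\<^sub>2) = 0" using eqs(1) nz by (simp add: field_simps power2_eq_square)
    then have "y\<^sub>1 + y\<^sub>2 = 0" using q_split(2) by simp
    moreover have "poly_tr q = y\<^sub>1 + y\<^sub>2" unfolding poly_tr_def q(2) by (simp add: q_split(1))
    ultimately show False using tr \<open>lam = 0\<close> by (simp add: lam_def)
  qed
  moreover have "Factorial_Ring.irreducible (K b)" for b
    using irreducible_H[OF p_irred] nz by (simp add: K_def)
  ultimately interpret quad scale Basis u lam al y\<^sub>1 y\<^sub>2 K
    using V u nz K_eq by (intro quad.intro endo.intro endo_axioms.intro quad_axioms.intro) simp_all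
  have KH: "K True = H y\<^sub>1 p" "K False = H y\<^sub>2 p" by (simp_all add: K_def)
  have "cond_i \<longleftrightarrow> split_form"
    unfolding cond_i_def q_split(1) using exceptional_quotient_iff_split_form unfolding p_eq .
  moreover have "cond_ii \<longleftrightarrow> split_form"
    unfolding cond_ii_def KH[symmetric] using split_form_iff_invariant_factors by (rule sym)
  moreover have "cond_iii \<longleftrightarrow> split_form"
    unfolding cond_iii_def KH[symmetric] using split_form_iff_blocks unfolding admissible_def by (rule sym)
  ultimately show ?thesis by simp
qed

end
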